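(* Let $\nu$, $J_0$, $a_1$, $a_2$, $c(x,y)$, $J$ and the regular Dirichlet form $(\mathcal{E}^{(1)},\mathcal{F}^{(1)})$ on $L^2(\mathbb{R}^d)$ (the small jump part) be as described in the context. If there exist a constant $c>0$ and $p>(2-d)/2$ such that $$a_1(x)\ge c(1+|x|^2)^p\quad\text{for any } x\in\mathbb{R}^d,$$ then $(\mathcal{E}^{(1)},\mathcal{F}^{(1)})$ is transient.
   Context: Setting. $\nu(\mathrm{d}z)$ is a positive and rotationally invariant Borel measure on $\mathbb{R}^d$ with $\int_{\mathbb{R}^d\setminus\{0\}}(1\wedge|z|^2)\,\nu(\mathrm{d}z)<\infty$. $J_0(x,\mathrm{d}y)$ is a nonnegative kernel on $\mathbb{R}^d\times\mathcal{B}(\mathbb{R}^d)$ such that the measure $J_0(x,\mathrm{d}y)\,\mathrm{d}x$ on $\mathbb{R}^d\times\mathbb{R}^d$ is symmetric and $J_0(x,x+A)\ge\nu(A)$ for all $x\in\mathbb{R}^d$, $A\in\mathcal{B}(\mathbb{R}^d)$. $a_1,a_2$ are positive Borel measurable functions on $\mathbb{R}^d$, $$c(x,y)=(a_1(x)+a_1(y))\mathbf{1}_{\{|x-y|<1\}}+(a_2(x)+a_2(y))\mathbf{1}_{\{|x-y|\ge 1\}},$$ $J(x,\mathrm{d}y)=c(x,y)J_0(x,\mathrm{d}y)$ and $J(\mathrm{d}x\,\mathrm{d}y)=J(x,\mathrm{d}y)\,\mathrm{d}x$. It is assumed that $J(\mathrm{d}x\,\mathrm{d}y)$ is symmetric on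 $\mathbb{R}^d\times\mathbb{R}^d$ and that $x\mapsto\int_{\mathbb{R}^d}(1\wedge|x-y|^2)J(x,\mathrm{d}y)$ belongs to $L^1_{\rm loc}(\mathbb{R}^d)$. Small jump form. Let $J^{(1)}(\mathrm{d}x\,\mathrm{d}y)=\mathbf{1}_{\{|x-y|<1\}}J(\mathrm{d}x\,\mathrm{d}y)$ and $$\mathcal{E}^{(1)}(u,v)=\iint_{\mathbb{R}^d\times\mathbb{R}^d}(u(x)-u(y))(v(x)-v(y))\,J^{(1)}(\mathrm{d}x\,\mathrm{d}y)$$ on $\mathcal{D}(\mathcal{E}^{(1)})=\{u\in L^2(\mathbb{R}^d):\iint_{\mathbb{R}^d\times\mathbb{R}^d}(u(x)-u(y))^2J^{(1)}(\mathrm{d}x\,\mathrm{d}y)<\infty\}$. Then $\mathcal{F}^{(1)}$ denotes the closure of $C_0^\infty(\mathbb{R}^d)$ (smooth functions with compact support) in $\mathcal{D}(\mathcal{E}^{(1)})$ with respect to the norm $(\mathcal{E}^{(1)}(u,u)+\|u\|_{L^2}^2)^{1/2}$; $(\mathcal{E}^{(1)},\mathcal{F}^{(1)})$ is a regular Dirichlet form on $L^2(\mathbb{R}^d)$. Transience. Let $\{T_t\}_{t>0}$ be the strongly continuous Markovian semigroup on $L^2$ associated with a Dirichlet form, $S_tf=\int_0^tT_sf\,\mathrm{d}s$ (extended from $L^1\cap L^2$ to $L^1$), and $Gf=\lim_{N\to\infty}S_Nf$ for $f\in L^1$, $f\ge 0$ a.e. The form is transient if $Gf<\infty$ a.e.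 for every $f\in L^1$ with $f\ge0$ a.e.
   Formalization: The measure ν is additionally assumed to charge the punctured unit ball, ν({0<|z|<1})>0; without this (e.g. ν uniform on the sphere |z|=2 and J_0 its translates) the small jump form is zero and not transient. *)

theory Defs
  imports "HOL-Analysis.Analysis"
begin

section \<open>Kernels and the measures they induce\<close>

text \<open>
  A kernel on Rd times the Borel sets. Since a kernel may have infinite mass near x, measurability of
  the map from x to K(x, C_x) for a Borel subset C of the product space (with section C_x) is not automatic;
  it is exactly what is needed for K(x,dy) dx to be a measure on the product space.
  For countable sums of finite kernels the third conjunct follows from the first two.
\<close>

definition borel_kernel :: "('a::euclidean_space \<Rightarrow> 'a measure) \<Rightarrow> bool" where
  "borel_kernel K \<longleftrightarrow>
     (\<forall>x. sets (K x) = sets borel) \<and>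
     (\<forall>A\<in>sets borel. (\<lambda>x. emeasure (K x) A) \<in> borel_measurable borel) \<and>
     (\<forall>C\<in>sets (borel :: ('a \<times> 'a) measure).
        (\<lambda>x. emeasure (K x) (Pair x -` C)) \<in> borel_measurable lebesgue)"

text \<open>The measure K(x,dy) dx.\<close>

definition kernel_measure :: "('a::euclidean_space \<Rightarrow> 'a measure) \<Rightarrow> ('a \<times> 'a) measure" where
  "kernel_measure K =
     measure_of UNIV (sets borel) (\<lambda>C. \<integral>\<^sup>+x. emeasure (K x) (Pair x -` C) \<partial>lebesgue)"

lemma sets_kernel_measure [simp]: "sets (kernel_measure K) = sets borel"
  unfolding kernel_measure_def
  by (metis sets.sets_measure_of_eq space_borel)

lemma space_kernel_measure [simp]: "space (kernel_measure K) = UNIV"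
  unfolding kernel_measure_def by (simp add: space_measure_of_conv)

lemma emeasure_kernel_measure:
  fixes K :: "'a::euclidean_space \<Rightarrow> 'a measure"
  assumes K: "\<And>x. sets (K x) = sets borel"
      "\<And>C. C \<in> sets borel \<Longrightarrow> (\<lambda>x. emeasure (K x) (Pair x -` C)) \<in> borel_measurable lebesgue"
    and C: "C \<in> sets borel"
  shows "emeasure (kernel_measure K) C = (\<integral>\<^sup>+x. emeasure (K x) (Pair x -` C) \<partial>lebesgue)"
proof (rule emeasure_measure_of[OF kernel_measure_def])
  show "sets borel \<subseteq> Pow (UNIV :: ('a \<times> 'a) set)" by simp
  show "C \<in> sets (kernel_measure K)" using C by simp
  show "positive (sets (kernel_measure K)) (\<lambda>C. \<integral>\<^sup>+x. emeasure (K x) (Pair x -` C) \<partial>lebesgue)"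
    by (simp add: positive_def)
  show "countably_additive (sets (kernel_measure K))
          (\<lambda>C. \<integral>\<^sup>+x. emeasure (K x) (Pair x -` C) \<partial>lebesgue)"
  proof (rule countably_additiveI)
    fix A :: "nat \<Rightarrow> ('a \<times> 'a) set"
    assume A: "range A \<subseteq> sets (kernel_measure K)" and dis: "disjoint_family A"
    have dis_pt: "m = n" if "z \<in> A m" "z \<in> A n" for m n z
      using dis that unfolding disjoint_family_on_def by blast
    have Ab: "A i \<in> sets borel" for i using A by auto
    have sec: "Pair x -` A i \<in> sets (K x)" for x i
    proof -
      have "(Pair x :: 'a \<Rightarrow> 'a \<times> 'a) \<in> borel_measurable borel"
        by (intro borel_measurable_continuous_onI continuous_intros)
      from measurable_sets[OF this Ab[of i]] show ?thesis
        by (simp add: K(1))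
    qed
    have "(\<Sum>i. \<integral>\<^sup>+x. emeasure (K x) (Pair x -` A i) \<partial>lebesgue)
        = (\<integral>\<^sup>+x. (\<Sum>i. emeasure (K x) (Pair x -` A i)) \<partial>lebesgue)"
      using K(2) Ab by (intro nn_integral_suminf[symmetric]) auto
    also have "\<dots> = (\<integral>\<^sup>+x. emeasure (K x) (Pair x -` (\<Union>i. A i)) \<partial>lebesgue)"
    proof (intro nn_integral_cong)
      fix x :: 'a
      have "(\<Sum>i. emeasure (K x) (Pair x -` A i)) = emeasure (K x) (\<Union>i. Pair x -` A i)"
        using sec dis by (intro suminf_emeasure) (auto simp: disjoint_family_on_def dest: dis_pt)
      then show "(\<Sum>i. emeasure (K x) (Pair x -` A i)) = emeasure (K x) (Pair x -` (\<Union>i. A i))"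
        by (simp add: vimage_UN)
    qed
    finally show "(\<Sum>i. \<integral>\<^sup>+x. emeasure (K x) (Pair x -` A i) \<partial>lebesgue)
        = (\<integral>\<^sup>+x. emeasure (K x) (Pair x -` (\<Union>i. A i)) \<partial>lebesgue)" .
  qed
qed

definition symmetric_measure :: "('a::euclidean_space \<times> 'a) measure \<Rightarrow> bool" where
  "symmetric_measure M \<longleftrightarrow> distr M M prod.swap = M"

text \<open>Local integrability of a nonnegative function.\<close>

definition locally_integrable :: "('a::euclidean_space \<Rightarrow> ennreal) \<Rightarrow> bool" where
  "locally_integrable F \<longleftrightarrow> F \<in> borel_measurable lebesgue \<and>
     (\<forall>K. compact K \<longrightarrow> (\<integral>\<^sup>+x\<in>K. F x \<partial>lebesgue) < \<infinity>)"

text \<open>For d = 1 the orthogonal maps are id and -id, so rotation invariance means symmetry.\<close>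

definition rotation_invariant :: "'a::euclidean_space measure \<Rightarrow> bool" where
  "rotation_invariant N \<longleftrightarrow>
     (\<forall>R A. orthogonal_transformation R \<and> A \<in> sets borel \<longrightarrow> emeasure N (R ` A) = emeasure N A)"

section \<open>Jump kernel and small jump form\<close>

definition jump_coeff ::
    "('a::euclidean_space \<Rightarrow> real) \<Rightarrow> ('a \<Rightarrow> real) \<Rightarrow> 'a \<Rightarrow> 'a \<Rightarrow> real" where
  "jump_coeff a1 a2 x y = (if norm (x - y) < 1 then a1 x + a1 y else a2 x + a2 y)"

definition jump_kernel ::
    "('a::euclidean_space \<Rightarrow> real) \<Rightarrow> ('a \<Rightarrow> real) \<Rightarrow> ('a \<Rightarrow> 'a measure) \<Rightarrow> 'a \<Rightarrow> 'a measure" where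
  "jump_kernel a1 a2 J0 x = density (J0 x) (\<lambda>y. ennreal (jump_coeff a1 a2 x y))"

definition small_jump_measure :: "('a::euclidean_space \<times> 'a) measure \<Rightarrow> ('a \<times> 'a) measure" where
  "small_jump_measure M = density M (indicator {(x, y). norm (x - y) < 1})"

text \<open>
  Elements of the Lebesgue spaces are represented by Borel functions; every class has such a
  representative. All notions below are invariant under modification on null sets.
\<close>

definition L1 :: "('a::euclidean_space \<Rightarrow> real) set" where
  "L1 = {f. integrable lborel f}"

definition L2 :: "('a::euclidean_space \<Rightarrow> real) set" where
  "L2 = {f \<in> borel_measurable borel. integrable lborel (\<lambda>x. (f x)\<^sup>2)}"

definition L2_inner :: "('a::euclidean_space \<Rightarrow> real) \<Rightarrow> ('a \<Rightarrow> real) \<Rightarrow> real" where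
  "L2_inner f g = (\<integral>x. f x * g x \<partial>lborel)"

definition L2_norm :: "('a::euclidean_space \<Rightarrow> real) \<Rightarrow> real" where
  "L2_norm f = sqrt (L2_inner f f)"

definition L1_dist :: "('a::euclidean_space \<Rightarrow> real) \<Rightarrow> ('a \<Rightarrow> real) \<Rightarrow> ennreal" where
  "L1_dist f g = (\<integral>\<^sup>+x. ennreal \<bar>f x - g x\<bar> \<partial>lborel)"

definition jump_form ::
    "('a::euclidean_space \<times> 'a) measure \<Rightarrow> ('a \<Rightarrow> real) \<Rightarrow> ('a \<Rightarrow> real) \<Rightarrow> real" where
  "jump_form M u v = (\<integral>(x, y). (u x - u y) * (v x - v y) \<partial>M)"

definition jump_form_dom :: "('a::euclidean_space \<times> 'a) measure \<Rightarrow> ('a \<Rightarrow> real) set" where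
  "jump_form_dom M = {u \<in> L2. (\<integral>\<^sup>+(x, y). ennreal ((u x - u y)\<^sup>2) \<partial>M) < \<infinity>}"

primrec iterated_derivative ::
    "'a::euclidean_space list \<Rightarrow> ('a \<Rightarrow> real) \<Rightarrow> 'a \<Rightarrow> real" where
  "iterated_derivative [] f = f"
| "iterated_derivative (v # vs) f = (\<lambda>x. frechet_derivative (iterated_derivative vs f) (at x) v)"

text \<open>Smooth functions with compact support.\<close>

definition test_functions :: "('a::euclidean_space \<Rightarrow> real) set" where
  "test_functions =
     {f. (\<forall>vs x. iterated_derivative vs f differentiable at x) \<and> compact (closure {x. f x \<noteq> 0})}"

definition form_norm :: "('a::euclidean_space \<times> 'a) measure \<Rightarrow> ('a \<Rightarrow> real) \<Rightarrow> real" where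
  "form_norm M u = sqrt (jump_form M u u + (L2_norm u)\<^sup>2)"

definition form_closure :: "('a::euclidean_space \<times> 'a) measure \<Rightarrow> ('a \<Rightarrow> real) set" where
  "form_closure M = {u \<in> jump_form_dom M.
     \<forall>e>0. \<exists>f \<in> test_functions \<inter> jump_form_dom M. form_norm M (\<lambda>x. u x - f x) < e}"

section \<open>Semigroups and transience\<close>

text \<open>Strongly continuous Markovian semigroups (of symmetric operators) on L2, indexed by t > 0.\<close>

definition markovian_semigroup ::
    "(real \<Rightarrow> ('a::euclidean_space \<Rightarrow> real) \<Rightarrow> 'a \<Rightarrow> real) \<Rightarrow> bool" where
  "markovian_semigroup T \<longleftrightarrow>
     (\<forall>t>0. \<forall>u\<in>L2. T t u \<in> L2) \<and>
     (\<forall>t>0. \<forall>u\<in>L2. \<forall>v\<in>L2. (AE x in lborel. u x = v x) \<longrightarrow> (AE x in lborel. T t u x = T t v x)) \<and>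
     (\<forall>t>0. \<forall>u\<in>L2. \<forall>v\<in>L2. \<forall>a b.
        AE x in lborel. T t (\<lambda>y. a * u y + b * v y) x = a * T t u x + b * T t v x) \<and>
     (\<forall>t>0. \<forall>u\<in>L2. \<forall>v\<in>L2. L2_inner (T t u) v = L2_inner u (T t v)) \<and>
     (\<forall>t>0. \<forall>u\<in>L2. L2_norm (T t u) \<le> L2_norm u) \<and>
     (\<forall>s>0. \<forall>t>0. \<forall>u\<in>L2. AE x in lborel. T (s + t) u x = T s (T t u) x) \<and>
     (\<forall>u\<in>L2. ((\<lambda>t. L2_norm (\<lambda>x. T t u x - u x)) \<longlongrightarrow> 0) (at_right 0)) \<and>
     (\<forall>t>0. \<forall>u\<in>L2. (AE x in lborel. 0 \<le> u x \<and> u x \<le> 1) \<longrightarrow>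
        (AE x in lborel. 0 \<le> T t u x \<and> T t u x \<le> 1))"

text \<open>
  T is associated with the form (E, F): F consists of those u for which (u - T_t u, u) / t has a
  finite limit as t decreases to 0, and E(u, v) is the limit of (u - T_t u, v) / t on F.
\<close>

definition approx_form ::
    "(real \<Rightarrow> ('a::euclidean_space \<Rightarrow> real) \<Rightarrow> 'a \<Rightarrow> real) \<Rightarrow> real \<Rightarrow> ('a \<Rightarrow> real) \<Rightarrow> ('a \<Rightarrow> real) \<Rightarrow> real"
  where "approx_form T t u v = L2_inner (\<lambda>x. u x - T t u x) v / t"

definition associated_semigroup ::
    "(('a::euclidean_space \<Rightarrow> real) \<Rightarrow> ('a \<Rightarrow> real) \<Rightarrow> real) \<Rightarrow> ('a \<Rightarrow> real) set \<Rightarrow>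
     (real \<Rightarrow> ('a \<Rightarrow> real) \<Rightarrow> 'a \<Rightarrow> real) \<Rightarrow> bool" where
  "associated_semigroup E F T \<longleftrightarrow>
     markovian_semigroup T \<and>
     F = {u \<in> L2. \<exists>l. ((\<lambda>t. approx_form T t u u) \<longlongrightarrow> l) (at_right 0)} \<and>
     (\<forall>u\<in>F. \<forall>v\<in>F. ((\<lambda>t. approx_form T t u v) \<longlongrightarrow> E u v) (at_right 0))"

text \<open>
  The integral of T_s f over (0, t], for f in L2, as the L2-valued integral (tested against L2);
  it is unique up to null sets. Then its L1-continuous extension from the intersection of L1 and L2
  to L1.
\<close>

definition semigroup_integral2 ::
    "(real \<Rightarrow> ('a::euclidean_space \<Rightarrow> real) \<Rightarrow> 'a \<Rightarrow> real) \<Rightarrow> real \<Rightarrow> ('a \<Rightarrow> real) \<Rightarrow> 'a \<Rightarrow> real" where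
  "semigroup_integral2 T t f = (SOME h. h \<in> L2 \<and>
     (\<forall>v\<in>L2. L2_inner h v = (LINT s:{0<..t}|lborel. L2_inner (T s f) v)))"

definition semigroup_integral ::
    "(real \<Rightarrow> ('a::euclidean_space \<Rightarrow> real) \<Rightarrow> 'a \<Rightarrow> real) \<Rightarrow> real \<Rightarrow> ('a \<Rightarrow> real) \<Rightarrow> 'a \<Rightarrow> real" where
  "semigroup_integral T t f = (SOME h. h \<in> L1 \<and>
     (\<exists>\<phi>. (\<forall>n. \<phi> n \<in> L1 \<inter> L2) \<and> (\<lambda>n. L1_dist (\<phi> n) f) \<longlonglongrightarrow> 0 \<and>
          (\<lambda>n. L1_dist (semigroup_integral2 T t (\<phi> n)) h) \<longlonglongrightarrow> 0))"

definition potential ::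
    "(real \<Rightarrow> ('a::euclidean_space \<Rightarrow> real) \<Rightarrow> 'a \<Rightarrow> real) \<Rightarrow> ('a \<Rightarrow> real) \<Rightarrow> 'a \<Rightarrow> ereal" where
  "potential T f x = lim (\<lambda>N. ereal (semigroup_integral T (real N) f x))"

text \<open>
  The semigroup associated with a Dirichlet form exists and is unique up to null sets, so the
  quantifier over T just names it.
\<close>

definition transient_form ::
    "(('a::euclidean_space \<Rightarrow> real) \<Rightarrow> ('a \<Rightarrow> real) \<Rightarrow> real) \<Rightarrow> ('a \<Rightarrow> real) set \<Rightarrow> bool" where
  "transient_form E F \<longleftrightarrow>
     (\<forall>T. associated_semigroup E F T \<longrightarrow>
        (\<forall>f\<in>L1. (AE x in lborel. 0 \<le> f x) \<longrightarrow> (AE x in lborel. potential T f x < \<infinity>)))"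

end

theory Submission
  imports Defs
begin

text \<open>
  Transience follows from a Hardy inequality: there are a weight \<open>w > 0\<close> and a constant \<open>C\<close> such that the
  integral of \<open>u\<^sup>2 w\<close> is at most \<open>C\<close> times the energy of \<open>u\<close>, for all \<open>u\<close> in the form domain.

  \<^emph>\<open>The Hardy inequality.\<close> Since \<open>J0\<close> dominates the translates of \<open>\<nu>\<close> and \<open>a1\<close> grows at least like a power, the
  energy dominates (\<open>small_jump_energy_ge\<close>) that of the kernel \<open>(b(x) + b(x + z)) \<mu>(dz) dx\<close>, where \<open>\<mu>\<close> is the
  restriction of \<open>\<nu>\<close> to an annulus on which it is finite and nonzero, and \<open>b\<close> is a multiple of \<open>s\<close> to the power
  \<open>p\<close>, with \<open>s(x) = R + |x|\<^sup>2\<close>. The exponent may be lowered to at most 1, which keeps the condition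
  \<open>d + 2 p - 2 > 0\<close>. For any function \<open>\<phi> > 0\<close>, the elementary inequality
  \<open>(a - b)\<^sup>2 + r a\<^sup>2 + b\<^sup>2 / r \<ge> a\<^sup>2 + b\<^sup>2\<close> with \<open>r = \<phi>(y) / \<phi>(x)\<close> and the reversibility of the kernel bound the energy of \<open>u\<close>
  from below by twice the integral of \<open>u\<^sup>2 (- L \<phi>) / \<phi>\<close>, where \<open>L\<close> is the jump operator (\<open>radial_Hardy\<close>). The function
  \<open>\<phi>\<close> is \<open>s\<close> to the power \<open>- q\<close>. Along a jump \<open>z\<close> everything depends only on the relative increment
  \<open>t = (2 x \<bullet> z + |z|\<^sup>2) / s\<close>, and \<open>(- L \<phi>) / \<phi>\<close> is \<open>b\<close> times the \<open>\<mu>\<close>-integral of \<open>2 q t + q (p - q - 1) t\<^sup>2 + O(t\<^sup>3)\<close>.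
  By rotation invariance the first moment of \<open>\<mu>\<close> vanishes and its second moments are those of a multiple of the
  identity, with trace \<open>m\<close>; hence the leading term is \<open>(2 q m / s) (1 + (2 (p - q - 1) / d) (|x|\<^sup>2 / s))\<close>.
  The bracket is bounded below by a positive constant as soon as \<open>d + 2 (p - q - 1) > 0\<close>, and some \<open>q > 0\<close> satisfies
  this exactly when \<open>p > (2 - d) / 2\<close>. The remainder has the smaller order of \<open>s\<close> to the power \<open>- 3/2\<close>, so
  a large \<open>R\<close> absorbs it uniformly in \<open>x\<close> (\<open>drift_bound\<close>). The resulting weight is a multiple of \<open>s\<close> to the power
  \<open>p - 1\<close>. The inequality is first obtained for test functions and extends to their closure (\<open>Hardy_closure\<close>).

  \<^emph>\<open>From Hardy to transience.\<close> Let \<open>g > 0\<close> be such that \<open>g\<^sup>2 / w\<close> is integrable. The time integral \<open>S N g\<close> of the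
  semigroup lies in the form domain and its energy is at most the inner product of \<open>g\<close> and \<open>S N g\<close>. The
  Hardy inequality and the arithmetic-geometric mean inequality then bound this inner product uniformly in
  \<open>N\<close> (\<open>energy_bound\<close>), so \<open>S N g\<close> stays bounded almost everywhere. To pass to an arbitrary integrable \<open>f\<close>, let
  \<open>k \<le> S 1 g\<close> be concentrated on the set where every \<open>S N g\<close> is at most \<open>n\<close>. A maximum principle gives
  \<open>S N k \<le> n\<close> in the weak sense (\<open>maximum_principle\<close>), and by symmetry the integral of \<open>k S N f\<close> is at most
  \<open>n\<close> times that of \<open>f\<close>. As the sets \<open>k > 0\<close> exhaust the space when \<open>n\<close> grows, the potential of \<open>f\<close> is finite almost
  everywhere (\<open>transient_of_Hardy\<close>).
\<close>

section \<open>Square integrable functions\<close>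
lemma Fatou_bound:
  fixes u :: "nat \<Rightarrow> 'b \<Rightarrow> ennreal"
  assumes [measurable]: "\<And>i. u i \<in> borel_measurable M"
    and lim: "AE x in M. (\<lambda>i. u i x) \<longlonglongrightarrow> v x"
    and le: "\<forall>\<^sub>F i in sequentially. (\<integral>\<^sup>+x. u i x \<partial>M) \<le> c"
  shows "(\<integral>\<^sup>+x. v x \<partial>M) \<le> c"
proof -
  have "(\<integral>\<^sup>+x. v x \<partial>M) = (\<integral>\<^sup>+x. liminf (\<lambda>i. u i x) \<partial>M)"
    using lim by (intro nn_integral_cong_AE) (auto elim!: eventually_mono dest: lim_imp_Liminf[rotated])
  also have "\<dots> \<le> liminf (\<lambda>i. \<integral>\<^sup>+x. u i x \<partial>M)"
    by (rule nn_integral_liminf) simp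
  also have "\<dots> \<le> liminf (\<lambda>i. c)"
    by (rule Liminf_mono[OF le])
  finally show ?thesis by (simp add: Liminf_const)
qed

lemma L2_measurable [measurable_dest]: "f \<in> L2 \<Longrightarrow> f \<in> borel_measurable borel"
  by (simp add: L2_def)

lemma L2_square: "f \<in> L2 \<Longrightarrow> integrable lborel (\<lambda>x. (f x)\<^sup>2)"
  by (simp add: L2_def)

lemma L2_mult:
  assumes "f \<in> L2" "g \<in> L2" shows "integrable lborel (\<lambda>x. f x * g x)"
proof (rule Bochner_Integration.integrable_bound)
  show "integrable lborel (\<lambda>x. (f x)\<^sup>2 + (g x)\<^sup>2)" using assms by (simp add: L2_square)
  show "(\<lambda>x. f x * g x) \<in> borel_measurable lborel" using assms by measurable
  have "\<bar>a * b\<bar> \<le> a\<^sup>2 + b\<^sup>2" for a b :: real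
  proof -
    have "0 \<le> \<bar>a\<bar> * \<bar>b\<bar>" by simp
    then have "\<bar>a\<bar> * \<bar>b\<bar> \<le> a\<^sup>2 + b\<^sup>2"
      using sum_squares_bound[of "\<bar>a\<bar>" "\<bar>b\<bar>"] unfolding mult.assoc power2_abs by linarith
    then show ?thesis by (simp add: abs_mult)
  qed
  then show "AE x in lborel. norm (f x * g x) \<le> norm ((f x)\<^sup>2 + (g x)\<^sup>2)" by simp
qed

lemma L2_bound:
  assumes "f \<in> L2" and [measurable]: "g \<in> borel_measurable borel"
    and "AE x in lborel. \<bar>g x\<bar> \<le> \<bar>f x\<bar>"
  shows "g \<in> L2"
proof -
  have "integrable lborel (\<lambda>x. (g x)\<^sup>2)"
    by (rule Bochner_Integration.integrable_bound[OF L2_square[OF assms(1)]])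
       (use assms(3) in \<open>auto elim!: eventually_mono simp: abs_le_square_iff\<close>)
  then show ?thesis by (simp add: L2_def)
qed

lemma L2_lincomb:
  assumes "f \<in> L2" "g \<in> L2" shows "(\<lambda>x. a * f x + b * g x) \<in> L2"
proof -
  have [measurable]: "f \<in> borel_measurable borel" "g \<in> borel_measurable borel"
    using assms by auto
  have eq: "(\<lambda>x. (a * f x + b * g x)\<^sup>2) = (\<lambda>x. a\<^sup>2 * (f x)\<^sup>2 + b\<^sup>2 * (g x)\<^sup>2 + 2 * a * b * (f x * g x))"
    by (auto simp: power2_eq_square algebra_simps)
  have "integrable lborel (\<lambda>x. (a * f x + b * g x)\<^sup>2)"
    unfolding eq using assms
    by (intro Bochner_Integration.integrable_add integrable_mult_right L2_square L2_mult)
  then show ?thesis by (simp add: L2_def)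
qed

lemma L2_diff: "f \<in> L2 \<Longrightarrow> g \<in> L2 \<Longrightarrow> (\<lambda>x. f x - g x) \<in> L2"
  using L2_lincomb[of f g 1 "-1"] by simp

lemma L2_add: "f \<in> L2 \<Longrightarrow> g \<in> L2 \<Longrightarrow> (\<lambda>x. f x + g x) \<in> L2"
  using L2_lincomb[of f g 1 1] by simp

lemma L2_scale: "f \<in> L2 \<Longrightarrow> (\<lambda>x. a * f x) \<in> L2"
  using L2_lincomb[of f f a 0] by simp

lemma L2_zero: "(\<lambda>x. 0) \<in> L2"
  by (simp add: L2_def)

lemma L2_abs: "f \<in> L2 \<Longrightarrow> (\<lambda>x. \<bar>f x\<bar>) \<in> L2"
  by (rule L2_bound) auto

lemma L2_inner_sym: "L2_inner f g = L2_inner g f"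
  by (simp add: L2_inner_def mult.commute)

lemma L2_inner_lincomb:
  assumes "f \<in> L2" "g \<in> L2" "h \<in> L2"
  shows "L2_inner (\<lambda>x. a * f x + b * g x) h = a * L2_inner f h + b * L2_inner g h"
proof -
  have "(\<lambda>x. (a * f x + b * g x) * h x) = (\<lambda>x. a * (f x * h x) + b * (g x * h x))"
    by (auto simp: algebra_simps)
  then show ?thesis using assms by (simp add: L2_inner_def L2_mult)
qed

lemma L2_inner_lincomb_right:
  assumes "f \<in> L2" "g \<in> L2" "h \<in> L2"
  shows "L2_inner h (\<lambda>x. a * f x + b * g x) = a * L2_inner h f + b * L2_inner h g"
  using L2_inner_lincomb[OF assms] by (simp add: L2_inner_sym[of h])

lemma L2_inner_diff:
  assumes "f \<in> L2" "g \<in> L2" "h \<in> L2"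
  shows "L2_inner (\<lambda>x. f x - g x) h = L2_inner f h - L2_inner g h"
  using L2_inner_lincomb[OF assms, of 1 "-1"] by simp

lemma L2_inner_add:
  assumes "f \<in> L2" "g \<in> L2" "h \<in> L2"
  shows "L2_inner (\<lambda>x. f x + g x) h = L2_inner f h + L2_inner g h"
  using L2_inner_lincomb[OF assms, of 1 1] by simp

lemma L2_inner_scale: "L2_inner (\<lambda>x. a * f x) h = a * L2_inner f h"
  by (simp add: L2_inner_def mult.assoc)

lemma L2_inner_cong:
  assumes "f \<in> L2" "f' \<in> L2" "h \<in> L2" "AE x in lborel. f x = f' x"
  shows "L2_inner f h = L2_inner f' h"
proof -
  have [measurable]: "f \<in> borel_measurable borel" "f' \<in> borel_measurable borel" "h \<in> borel_measurable borel"
    using assms by auto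
  show ?thesis unfolding L2_inner_def
    by (rule integral_cong_AE) (use assms(4) in auto)
qed

lemma L2_inner_mono:
  assumes "f \<in> L2" "f' \<in> L2" "h \<in> L2" "AE x in lborel. f x \<le> f' x" "AE x in lborel. 0 \<le> h x"
  shows "L2_inner f h \<le> L2_inner f' h"
  unfolding L2_inner_def
  by (rule integral_mono_AE) (use assms in \<open>auto simp: L2_mult intro: mult_right_mono\<close>)

lemma L2_inner_nonneg:
  assumes "AE x in lborel. 0 \<le> f x" "AE x in lborel. 0 \<le> h x"
  shows "0 \<le> L2_inner f h"
  unfolding L2_inner_def
  by (rule integral_nonneg_AE) (use assms in \<open>auto\<close>)

lemma L2_inner_self_nonneg: "0 \<le> L2_inner f f"
  by (auto simp: L2_inner_def intro!: integral_nonneg_AE)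

lemma L2_norm_square: "(L2_norm f)\<^sup>2 = L2_inner f f"
  by (simp add: L2_norm_def L2_inner_self_nonneg)

lemma L2_norm_nonneg: "0 \<le> L2_norm f"
  by (simp add: L2_norm_def L2_inner_self_nonneg)

lemma L2_inner_self_0_AE:
  assumes "f \<in> L2" "L2_inner f f = 0" shows "AE x in lborel. f x = 0"
proof -
  have "AE x in lborel. f x * f x = 0"
    using assms by (subst integral_nonneg_eq_0_iff_AE[symmetric]) (auto simp: L2_mult L2_inner_def)
  then show ?thesis by simp
qed

lemma L2_Cauchy_Schwarz:
  assumes f: "f \<in> L2" and g: "g \<in> L2"
  shows "\<bar>L2_inner f g\<bar> \<le> L2_norm f * L2_norm g"
proof -
  let ?A = "L2_inner f f" and ?B = "L2_inner f g" and ?C = "L2_inner g g"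
  have "?B\<^sup>2 \<le> ?A * ?C"
  proof (cases "?C = 0")
    case True
    then have "AE x in lborel. f x * g x = 0" using L2_inner_self_0_AE[OF g] by auto
    then have "?B = 0" unfolding L2_inner_def by (rule integral_eq_zero_AE)
    then show ?thesis using True by simp
  next
    case False
    then have C: "?C > 0" using L2_inner_self_nonneg[of g] by simp
    let ?k = "\<lambda>x. ?C * f x + (- ?B) * g x"
    have "L2_inner ?k ?k = ?C * (?C * ?A + (- ?B) * ?B) + (- ?B) * (?C * ?B + (- ?B) * ?C)"
      using f g by (simp only: L2_inner_lincomb L2_inner_lincomb_right L2_lincomb L2_inner_sym[of g f])
    then have "0 \<le> ?C * (?A * ?C - ?B\<^sup>2)"
      using L2_inner_self_nonneg[of ?k] by (simp add: algebra_simps power2_eq_square)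
    then show ?thesis using C by (simp add: zero_le_mult_iff)
  qed
  then have "?B\<^sup>2 \<le> (L2_norm f * L2_norm g)\<^sup>2"
    by (simp add: power_mult_distrib L2_norm_square)
  then show ?thesis
    using abs_le_square_iff[of ?B "L2_norm f * L2_norm g"] L2_norm_nonneg[of f] L2_norm_nonneg[of g]
    by simp
qed

text \<open>
  The truncated negative part of \<open>u\<close> is itself an admissible test function.
\<close>

lemma L2_nonneg_dual:
  assumes u: "u \<in> L2"
    and pos: "\<And>v. v \<in> L2 \<Longrightarrow> (\<And>x. 0 \<le> v x) \<Longrightarrow> (\<And>x. v x \<le> 1) \<Longrightarrow> 0 \<le> L2_inner u v"
  shows "AE x in lborel. 0 \<le> u x"
proof -
  have [measurable]: "u \<in> borel_measurable borel" using u by auto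
  let ?v = "\<lambda>x. min (max (- u x) 0) 1"
  have v: "?v \<in> L2" by (rule L2_bound[OF u]) auto
  have "0 \<le> L2_inner u ?v" using v by (rule pos) auto
  also have "\<dots> \<le> L2_inner (\<lambda>x. - ?v x) ?v"
    using L2_scale[OF v, of "-1"] u v unfolding L2_inner_def
    by (intro integral_mono L2_mult) (auto simp: min_def max_def mult_right_mono zero_le_mult_iff)
  also have "\<dots> = - L2_inner ?v ?v"
    using L2_inner_scale[of "-1" ?v ?v] by simp
  finally have "L2_inner ?v ?v = 0" using L2_inner_self_nonneg[of ?v] by simp
  then have "AE x in lborel. ?v x = 0" by (rule L2_inner_self_0_AE[OF v])
  then show ?thesis
  proof (rule eventually_mono)
    show "0 \<le> u x" if "?v x = 0" for x using that by (auto simp: min_def max_def split: if_splits)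
  qed
qed

lemma L2_le_dual:
  assumes "u \<in> L2" "u' \<in> L2"
    and "\<And>v. v \<in> L2 \<Longrightarrow> (\<And>x. 0 \<le> v x) \<Longrightarrow> (\<And>x. v x \<le> 1) \<Longrightarrow> L2_inner u v \<le> L2_inner u' v"
  shows "AE x in lborel. u x \<le> u' x"
proof -
  have "AE x in lborel. 0 \<le> u' x - u x"
    by (rule L2_nonneg_dual) (use assms in \<open>auto simp: L2_diff L2_inner_diff\<close>)
  then show ?thesis by auto
qed

lemma L2_eq_dual:
  assumes "u \<in> L2" "u' \<in> L2" "\<And>v. v \<in> L2 \<Longrightarrow> L2_inner u v = L2_inner u' v"
  shows "AE x in lborel. u x = u' x"
proof -
  have "AE x in lborel. u x \<le> u' x" "AE x in lborel. u' x \<le> u x"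
    by (rule L2_le_dual; use assms in simp)+
  then show ?thesis by auto
qed

section \<open>Completeness and duality\<close>

lemma ex_positive_integrable:
  "\<exists>h :: 'a::euclidean_space \<Rightarrow> real. h \<in> borel_measurable borel \<and> (\<forall>x. 0 < h x) \<and> integrable lborel h"
proof -
  obtain h :: "'a \<Rightarrow> ennreal" where h: "h \<in> borel_measurable lborel"
    "integral\<^sup>N lborel h \<noteq> \<infinity>" "\<And>x. 0 < h x \<and> h x < \<infinity>"
    using sigma_finite_measure.Ex_finite_integrable_function[OF lborel.sigma_finite_measure_axioms] by auto
  let ?h = "\<lambda>x. enn2real (h x)"
  have "?h \<in> borel_measurable borel" using h(1) by measurable
  moreover have "0 < ?h x" for x using h(3)[of x] by (simp add: enn2real_positive_iff)
  moreover have "integrable lborel ?h"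
    using h by (intro integrableI_nonneg) (auto simp: less_top)
  ultimately show ?thesis by blast
qed

lemma ex_positive_L2:
  "\<exists>g :: 'a::euclidean_space \<Rightarrow> real. g \<in> L2 \<and> (\<forall>x. 0 < g x)"
proof -
  obtain h :: "'a \<Rightarrow> real" where h: "h \<in> borel_measurable borel" "\<And>x. 0 < h x" "integrable lborel h"
    using ex_positive_integrable by blast
  have "(sqrt (h x))\<^sup>2 = h x" for x using h(2)[of x] by simp
  then have "(\<lambda>x. sqrt (h x)) \<in> L2" using h by (simp add: L2_def)
  then show ?thesis using h(2) by (intro exI[of _ "\<lambda>x. sqrt (h x)"]) auto
qed

lemma nn_integral_L2:
  assumes "f \<in> L2"
  shows "(\<integral>\<^sup>+x. ennreal ((f x)\<^sup>2) \<partial>lborel) = ennreal ((L2_norm f)\<^sup>2)"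
  unfolding L2_norm_square unfolding L2_inner_def power2_eq_square
  by (rule nn_integral_eq_integral[OF L2_mult[OF assms assms]]) auto

lemma L2_complete:
  fixes f :: "nat \<Rightarrow> 'a::euclidean_space \<Rightarrow> real"
  assumes f: "\<And>n. f n \<in> L2"
    and cau: "\<And>e. 0 < e \<Longrightarrow> \<exists>N. \<forall>i\<ge>N. \<forall>j\<ge>N. L2_norm (\<lambda>x. f i x - f j x) < e"
  obtains h where "h \<in> L2" "(\<lambda>n. L2_norm (\<lambda>x. f n x - h x)) \<longlonglongrightarrow> 0"
proof -
  have [measurable]: "f n \<in> borel_measurable borel" for n using f by auto
  obtain g :: "'a \<Rightarrow> real" where g: "g \<in> L2" "\<And>x. 0 < g x"
    using ex_positive_L2 by blast
  \<comment> \<open>Multiplication by a positive square integrable weight turns a Cauchy sequence in mean square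
      into one in mean, which has an almost everywhere convergent subsequence.\<close>
  have weighted: "\<exists>N. \<forall>i\<ge>N. \<forall>j\<ge>N. (LINT x|lborel. norm (f i x * g x - f j x * g x)) < e"
    if "0 < e" for e :: real
  proof -
    have G: "0 < L2_norm g + 1" using L2_norm_nonneg[of g] by simp
    obtain N where N: "\<And>i j. i \<ge> N \<Longrightarrow> j \<ge> N \<Longrightarrow> L2_norm (\<lambda>x. f i x - f j x) < e / (L2_norm g + 1)"
      using cau[OF divide_pos_pos[OF \<open>0 < e\<close> G]] by blast
    have "(LINT x|lborel. norm (f i x * g x - f j x * g x)) < e" if "i \<ge> N" "j \<ge> N" for i j
    proof -
      let ?d = "\<lambda>x. f i x - f j x"
      have d: "?d \<in> L2" by (intro L2_diff f)
      have "norm (f i x * g x - f j x * g x) = \<bar>?d x\<bar> * g x" for x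
        using g(2)[of x] by (simp add: left_diff_distrib[symmetric] abs_mult)
      then have "(LINT x|lborel. norm (f i x * g x - f j x * g x)) = L2_inner (\<lambda>x. \<bar>?d x\<bar>) g"
        by (simp add: L2_inner_def)
      also have "\<dots> \<le> L2_norm (\<lambda>x. \<bar>?d x\<bar>) * L2_norm g"
        using L2_Cauchy_Schwarz[OF L2_abs[OF d] g(1)] by simp
      also have "L2_norm (\<lambda>x. \<bar>?d x\<bar>) = L2_norm ?d"
        by (simp add: L2_norm_def L2_inner_def)
      also have "L2_norm ?d * L2_norm g \<le> L2_norm ?d * (L2_norm g + 1)"
        by (intro mult_left_mono L2_norm_nonneg) simp
      also have "\<dots> < e" using N[OF that] G by (simp add: pos_less_divide_eq)
      finally show ?thesis .
    qed
    then show ?thesis by blast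
  qed
  obtain r where r: "strict_mono r" "AE x in lborel. Cauchy (\<lambda>i. f (r i) x * g x)"
    by (rule cauchy_L1_AE_cauchy_subseq[OF L2_mult[OF f g(1)] weighted])
  define h where "h = (\<lambda>x. lim (\<lambda>i. f (r i) x))"
  have [measurable]: "h \<in> borel_measurable borel" unfolding h_def by measurable
  have conv: "AE x in lborel. (\<lambda>i. f (r i) x) \<longlonglongrightarrow> h x"
    using r(2)
  proof (rule eventually_mono)
    fix x assume "Cauchy (\<lambda>i. f (r i) x * g x)"
    then have "convergent (\<lambda>i. f (r i) x * g x)" by (rule Cauchy_convergent)
    then obtain l where "(\<lambda>i. f (r i) x * g x) \<longlonglongrightarrow> l" by (auto simp: convergent_def)
    then have "(\<lambda>i. f (r i) x * g x / g x) \<longlonglongrightarrow> l / g x"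
      using g(2)[of x] by (intro tendsto_divide) auto
    then have "(\<lambda>i. f (r i) x) \<longlonglongrightarrow> l / g x" using g(2)[of x] by simp
    then show "(\<lambda>i. f (r i) x) \<longlonglongrightarrow> h x" unfolding h_def by (simp add: limI)
  qed
  have close: "\<exists>N. \<forall>n\<ge>N. (\<integral>\<^sup>+x. ennreal ((f n x - h x)\<^sup>2) \<partial>lborel) \<le> ennreal (e\<^sup>2)" if "0 < e" for e
  proof -
    obtain N where N: "\<And>i j. i \<ge> N \<Longrightarrow> j \<ge> N \<Longrightarrow> L2_norm (\<lambda>x. f i x - f j x) < e"
      using cau[OF \<open>0 < e\<close>] by blast
    have "(\<integral>\<^sup>+x. ennreal ((f n x - h x)\<^sup>2) \<partial>lborel) \<le> ennreal (e\<^sup>2)" if n: "n \<ge> N" for n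
    proof (rule Fatou_bound[where u = "\<lambda>i x. ennreal ((f n x - f (r i) x)\<^sup>2)"])
      show "AE x in lborel. (\<lambda>i. ennreal ((f n x - f (r i) x)\<^sup>2)) \<longlonglongrightarrow> ennreal ((f n x - h x)\<^sup>2)"
        using conv by (auto elim!: eventually_mono intro!: tendsto_intros tendsto_ennrealI)
      show "\<forall>\<^sub>F i in sequentially. (\<integral>\<^sup>+x. ennreal ((f n x - f (r i) x)\<^sup>2) \<partial>lborel) \<le> ennreal (e\<^sup>2)"
        using eventually_ge_at_top[of N]
      proof (rule eventually_mono)
        fix i assume "i \<ge> N"
        then have "r i \<ge> N" using seq_suble[OF r(1), of i] by simp
        from N[OF n this] have "(L2_norm (\<lambda>x. f n x - f (r i) x))\<^sup>2 \<le> e\<^sup>2"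
          by (intro power_mono L2_norm_nonneg) simp
        then show "(\<integral>\<^sup>+x. ennreal ((f n x - f (r i) x)\<^sup>2) \<partial>lborel) \<le> ennreal (e\<^sup>2)"
          using nn_integral_L2[OF L2_diff[OF f f], of n "r i"] by (simp add: ennreal_leI)
      qed
    qed simp
    then show ?thesis by blast
  qed
  have diff: "(\<lambda>x. f n x - h x) \<in> L2"
    if "(\<integral>\<^sup>+x. ennreal ((f n x - h x)\<^sup>2) \<partial>lborel) \<le> ennreal (e\<^sup>2)" for n e
    unfolding L2_def using le_less_trans[OF that ennreal_less_top]
    by (auto intro!: integrableI_nonneg)
  have h: "h \<in> L2"
  proof -
    obtain N where "(\<integral>\<^sup>+x. ennreal ((f N x - h x)\<^sup>2) \<partial>lborel) \<le> ennreal (1\<^sup>2)"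
      using close[of 1] by auto
    from L2_diff[OF f[of N] diff[OF this]] show ?thesis by simp
  qed
  have "(\<lambda>n. L2_norm (\<lambda>x. f n x - h x)) \<longlonglongrightarrow> 0"
  proof (rule LIMSEQ_I)
    fix e :: real assume "0 < e"
    then obtain N where N: "\<forall>n\<ge>N. (\<integral>\<^sup>+x. ennreal ((f n x - h x)\<^sup>2) \<partial>lborel) \<le> ennreal ((e/2)\<^sup>2)"
      using close[of "e/2"] by auto
    have "norm (L2_norm (\<lambda>x. f n x - h x) - 0) < e" if "n \<ge> N" for n
    proof -
      have "(L2_norm (\<lambda>x. f n x - h x))\<^sup>2 \<le> (e/2)\<^sup>2"
      proof -
        have "ennreal ((L2_norm (\<lambda>x. f n x - h x))\<^sup>2) \<le> ennreal ((e/2)\<^sup>2)"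
          using N that unfolding nn_integral_L2[OF L2_diff[OF f[of n] h], symmetric] by blast
        then show ?thesis by (subst (asm) ennreal_le_iff) auto
      qed
      then have "L2_norm (\<lambda>x. f n x - h x) \<le> e/2"
        by (rule power2_le_imp_le) (use \<open>0 < e\<close> in simp)
      then show ?thesis using \<open>0 < e\<close> L2_norm_nonneg[of "\<lambda>x. f n x - h x"]
        unfolding real_norm_def diff_0_right by linarith
    qed
    then show "\<exists>N. \<forall>n\<ge>N. norm (L2_norm (\<lambda>x. f n x - h x) - 0) < e" by blast
  qed
  with h show ?thesis by (rule that)
qed

lemma L1_complete:
  fixes f :: "nat \<Rightarrow> 'a::euclidean_space \<Rightarrow> real"
  assumes f: "\<And>n. f n \<in> L1"
    and cau: "\<And>e. 0 < e \<Longrightarrow> \<exists>N. \<forall>i\<ge>N. \<forall>j\<ge>N. L1_dist (f i) (f j) < ennreal e"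
  obtains h where "h \<in> L1" "(\<lambda>n. L1_dist (f n) h) \<longlonglongrightarrow> 0"
proof -
  have int: "integrable lborel (f n)" for n using f by (simp add: L1_def)
  have [measurable]: "f n \<in> borel_measurable borel" for n using int[of n] by auto
  have dist: "L1_dist (f i) (f j) = ennreal (LINT x|lborel. norm (f i x - f j x))" for i j
    unfolding L1_dist_def
    by (subst nn_integral_eq_integral[symmetric]) (use int in auto)
  have mean: "\<exists>N. \<forall>i\<ge>N. \<forall>j\<ge>N. (LINT x|lborel. norm (f i x - f j x)) < e" if "0 < e" for e
    using cau[OF that] unfolding dist by (simp add: ennreal_less_iff)
  obtain r where r: "strict_mono r" "AE x in lborel. Cauchy (\<lambda>i. f (r i) x)"
    by (rule cauchy_L1_AE_cauchy_subseq[OF int mean])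
  define h where "h = (\<lambda>x. lim (\<lambda>i. f (r i) x))"
  have [measurable]: "h \<in> borel_measurable borel" unfolding h_def by measurable
  have conv: "AE x in lborel. (\<lambda>i. f (r i) x) \<longlonglongrightarrow> h x"
    using r(2) by (rule eventually_mono) (simp add: h_def Cauchy_convergent_iff convergent_LIMSEQ_iff)
  have close: "\<exists>N. \<forall>n\<ge>N. L1_dist (f n) h \<le> ennreal e" if "0 < e" for e
  proof -
    obtain N where N: "\<And>i j. i \<ge> N \<Longrightarrow> j \<ge> N \<Longrightarrow> L1_dist (f i) (f j) < ennreal e"
      using cau[OF \<open>0 < e\<close>] by blast
    have "L1_dist (f n) h \<le> ennreal e" if n: "n \<ge> N" for n
      unfolding L1_dist_def
    proof (rule Fatou_bound[where u = "\<lambda>i x. ennreal \<bar>f n x - f (r i) x\<bar>"])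
      show "AE x in lborel. (\<lambda>i. ennreal \<bar>f n x - f (r i) x\<bar>) \<longlonglongrightarrow> ennreal \<bar>f n x - h x\<bar>"
        using conv by (auto elim!: eventually_mono intro!: tendsto_intros tendsto_ennrealI)
      show "\<forall>\<^sub>F i in sequentially. (\<integral>\<^sup>+x. ennreal \<bar>f n x - f (r i) x\<bar> \<partial>lborel) \<le> ennreal e"
        using eventually_ge_at_top[of N]
      proof (rule eventually_mono)
        fix i assume "i \<ge> N"
        then have "r i \<ge> N" using seq_suble[OF r(1), of i] by simp
        from N[OF n this] show "(\<integral>\<^sup>+x. ennreal \<bar>f n x - f (r i) x\<bar> \<partial>lborel) \<le> ennreal e"
          by (simp add: L1_dist_def less_imp_le)
      qed
    qed simp
    then show ?thesis by blast
  qed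
  have h: "h \<in> L1"
  proof -
    obtain N where N: "L1_dist (f N) h \<le> ennreal 1" using close[of 1] by auto
    have "integrable lborel (\<lambda>x. f N x - h x)"
      using le_less_trans[OF N ennreal_less_top]
      by (intro integrableI_bounded) (auto simp: L1_dist_def)
    from Bochner_Integration.integrable_diff[OF int[of N] this] show ?thesis by (simp add: L1_def)
  qed
  have "(\<lambda>n. L1_dist (f n) h) \<longlonglongrightarrow> 0"
  proof (rule order_tendstoI)
    fix a :: ennreal assume "0 < a"
    then obtain b where b: "0 < b" "b < a" using dense by blast
    then have "b \<noteq> top" by auto
    then have e: "b = ennreal (enn2real b)" "0 < enn2real b"
      using b(1) by (auto simp: enn2real_positive_iff less_top)
    from close[OF e(2)] obtain N where "\<forall>n\<ge>N. L1_dist (f n) h \<le> b" using e(1) by auto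
    then show "\<forall>\<^sub>F n in sequentially. L1_dist (f n) h < a"
      using b(2) unfolding eventually_sequentially by (meson le_less_trans)
  qed simp
  with h show ?thesis by (rule that)
qed

text \<open>
  Needed to define the time integral of the semigroup, which is only specified by its inner products.
\<close>

lemma L2_Riesz:
  fixes B :: "('a::euclidean_space \<Rightarrow> real) \<Rightarrow> real"
  assumes lin: "\<And>u v a b. u \<in> L2 \<Longrightarrow> v \<in> L2 \<Longrightarrow> B (\<lambda>x. a * u x + b * v x) = a * B u + b * B v"
    and bound: "\<And>v. v \<in> L2 \<Longrightarrow> \<bar>B v\<bar> \<le> M * L2_norm v"
  obtains h where "h \<in> L2" "\<And>v. v \<in> L2 \<Longrightarrow> L2_inner h v = B v"
proof -
  \<comment> \<open>The representing element minimises the energy below; the parallelogram identity makes every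
      minimising sequence Cauchy.\<close>
  define Q where "Q v = L2_inner v v - 2 * B v" for v
  define d where "d = (INF v\<in>L2. Q v)"
  have lower: "- M\<^sup>2 \<le> Q v" if "v \<in> L2" for v
  proof -
    have "B v \<le> M * L2_norm v" using bound[OF that] by simp
    then have "(L2_norm v - M)\<^sup>2 - M\<^sup>2 \<le> Q v"
      unfolding Q_def L2_norm_square[symmetric] by (simp add: power2_eq_square algebra_simps)
    then show ?thesis using zero_le_power2[of "L2_norm v - M"] by linarith
  qed
  have bdd: "bdd_below (Q ` L2)" using lower by (intro bdd_belowI2[of _ "- M\<^sup>2"])
  have d_le: "d \<le> Q v" if "v \<in> L2" for v unfolding d_def by (rule cINF_lower[OF bdd that])
  have "\<exists>v\<in>L2. Q v < d + 1 / real (Suc n)" for n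
  proof -
    have "(INF v\<in>L2. Q v) < d + 1 / real (Suc n)" by (simp add: d_def)
    then show ?thesis using cINF_less_iff[OF _ bdd] L2_zero by blast
  qed
  then obtain f where f: "\<And>n. f n \<in> L2" "\<And>n. Q (f n) < d + 1 / real (Suc n)" by metis
  have near: "(L2_norm (\<lambda>x. f i x - f j x))\<^sup>2 \<le> 2 / real (Suc i) + 2 / real (Suc j)" for i j
  proof -
    let ?m = "\<lambda>x. (1/2) * f i x + (1/2) * f j x" and ?d = "\<lambda>x. 1 * f i x + (-1) * f j x"
    have "L2_inner ?d ?d = 2 * Q (f i) + 2 * Q (f j) - 4 * Q ?m"
      unfolding Q_def using f(1)
      by (simp only: L2_inner_lincomb L2_inner_lincomb_right L2_lincomb lin L2_inner_sym[of "f j" "f i"])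
         (simp add: algebra_simps)
    moreover have "d \<le> Q ?m" using f(1) by (intro d_le L2_lincomb)
    ultimately have "L2_inner ?d ?d \<le> 2 / real (Suc i) + 2 / real (Suc j)"
      using f(2)[of i] f(2)[of j] by linarith
    then show ?thesis by (simp add: L2_norm_square)
  qed
  have cau: "\<exists>N. \<forall>i\<ge>N. \<forall>j\<ge>N. L2_norm (\<lambda>x. f i x - f j x) < e" if "0 < e" for e
  proof -
    obtain N where N: "4 / e\<^sup>2 < real N" using reals_Archimedean2 by blast
    have "L2_norm (\<lambda>x. f i x - f j x) < e" if "i \<ge> N" "j \<ge> N" for i j
    proof -
      have "0 < 4 / e\<^sup>2" using \<open>0 < e\<close> by simp
      then have "0 < real N" using N by linarith
      have "2 / real (Suc i) < e\<^sup>2 / 2" "2 / real (Suc j) < e\<^sup>2 / 2"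
      proof -
        have *: "4 < real (Suc k) * e\<^sup>2" if "k \<ge> N" for k
        proof -
          have "4 < real N * e\<^sup>2" using N \<open>0 < e\<close> by (simp add: pos_divide_less_eq)
          also have "\<dots> \<le> real (Suc k) * e\<^sup>2" using that by (intro mult_right_mono) auto
          finally show ?thesis .
        qed
        show "2 / real (Suc i) < e\<^sup>2 / 2" "2 / real (Suc j) < e\<^sup>2 / 2"
          using *[OF \<open>i \<ge> N\<close>] *[OF \<open>j \<ge> N\<close>] by (simp_all add: divide_simps mult.commute)
      qed
      then have "(L2_norm (\<lambda>x. f i x - f j x))\<^sup>2 < e\<^sup>2" using near[of i j] by simp
      then show ?thesis by (rule power_less_imp_less_base) (use \<open>0 < e\<close> in simp)
    qed
    then show ?thesis by blast
  qed
  obtain h where h: "h \<in> L2" "(\<lambda>n. L2_norm (\<lambda>x. f n x - h x)) \<longlonglongrightarrow> 0"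
    by (rule L2_complete[OF f(1) cau])
  have Qh: "Q h \<le> d"
  proof -
    let ?e = "\<lambda>n. L2_norm (\<lambda>x. f n x - h x)"
    have "Q h \<le> d + 1 / real (Suc n) + (2 * L2_norm h + 2 * M) * ?e n" for n
    proof -
      let ?r = "\<lambda>x. f n x - h x"
      have r: "?r \<in> L2" using f(1) h(1) by (intro L2_diff)
      have "f n = (\<lambda>x. 1 * h x + 1 * ?r x)" by auto
      then have "Q (f n) = Q (\<lambda>x. 1 * h x + 1 * ?r x)" by simp
      also have "\<dots> = Q h + 2 * L2_inner h ?r + L2_inner ?r ?r - 2 * B ?r"
        unfolding Q_def using r h(1)
        by (simp only: L2_inner_lincomb L2_inner_lincomb_right L2_lincomb lin L2_inner_sym[of ?r h])
           (simp add: algebra_simps)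
      finally have "Q h = Q (f n) - 2 * L2_inner h ?r - L2_inner ?r ?r + 2 * B ?r" by simp
      moreover have "- L2_inner h ?r \<le> L2_norm h * ?e n" using L2_Cauchy_Schwarz[OF h(1) r] by linarith
      moreover have "B ?r \<le> M * ?e n" using bound[OF r] by linarith
      ultimately show ?thesis using f(2)[of n] L2_inner_self_nonneg[of ?r]
        by (simp add: algebra_simps)
    qed
    moreover have "(\<lambda>n. d + 1 / real (Suc n) + (2 * L2_norm h + 2 * M) * ?e n)
        \<longlonglongrightarrow> d + 0 + (2 * L2_norm h + 2 * M) * 0"
      by (intro tendsto_intros h(2) LIMSEQ_Suc[OF lim_1_over_n])
    ultimately show ?thesis by (intro LIMSEQ_le_const[where a = "Q h"]) auto
  qed
  have "L2_inner h v = B v" if v: "v \<in> L2" for v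
  proof -
    let ?k = "L2_inner h v - B v" and ?V = "L2_inner v v"
    have ineq: "0 \<le> 2 * t * ?k + t\<^sup>2 * ?V" for t
    proof -
      have "Q (\<lambda>x. 1 * h x + t * v x) = Q h + 2 * t * ?k + t\<^sup>2 * ?V"
        unfolding Q_def using v h(1)
        by (simp only: L2_inner_lincomb L2_inner_lincomb_right L2_lincomb lin L2_inner_sym[of v h])
           (simp add: algebra_simps power2_eq_square)
      then show ?thesis using Qh d_le[OF L2_lincomb[OF h(1) v, of 1 t]] by linarith
    qed
    show ?thesis
    proof (rule ccontr)
      assume "L2_inner h v \<noteq> B v"
      then have k: "?k \<noteq> 0" by simp
      let ?t = "- ?k / (?V + 1)"
      have V: "0 < ?V + 1" using L2_inner_self_nonneg[of v] by simp
      have "2 * (- k / W) * k + (- k / W)\<^sup>2 * (W - 1) = - (k\<^sup>2 * (W + 1)) / W\<^sup>2" if "0 < W" for k W :: real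
        using that by (simp add: field_simps power2_eq_square)
      from this[OF V, of ?k] have "2 * ?t * ?k + ?t\<^sup>2 * ?V = - (?k\<^sup>2 * (?V + 2)) / (?V + 1)\<^sup>2"
        by (simp add: add.assoc)
      also have "\<dots> < 0"
      proof (rule divide_neg_pos)
        have "0 < ?k\<^sup>2 * (?V + 2)" using k V by (intro mult_pos_pos) auto
        then show "- (?k\<^sup>2 * (?V + 2)) < 0" by linarith
        show "0 < (?V + 1)\<^sup>2" using V by (intro zero_less_power)
      qed
      finally show False using ineq[of ?t] by linarith
    qed
  qed
  with h(1) show ?thesis by (rule that)
qed

section \<open>Integrable functions\<close>

lemma L1_dist_triangle:
  assumes [measurable]: "f \<in> borel_measurable borel" "g \<in> borel_measurable borel" "h \<in> borel_measurable borel"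
  shows "L1_dist f h \<le> L1_dist f g + L1_dist g h"
proof -
  have "L1_dist f h \<le> (\<integral>\<^sup>+x. ennreal \<bar>f x - g x\<bar> + ennreal \<bar>g x - h x\<bar> \<partial>lborel)"
    unfolding L1_dist_def
    by (intro nn_integral_mono) (simp add: ennreal_plus[symmetric] del: ennreal_plus)
  also have "\<dots> = L1_dist f g + L1_dist g h"
    unfolding L1_dist_def by (rule nn_integral_add) auto
  finally show ?thesis .
qed

lemma L1_dist_sym: "L1_dist f g = L1_dist g f"
  by (simp add: L1_dist_def abs_minus_commute)

lemma L1_limit_mono:
  assumes [measurable]: "\<And>n. f n \<in> borel_measurable borel" "\<And>n. g n \<in> borel_measurable borel"
      "f' \<in> borel_measurable borel" "g' \<in> borel_measurable borel"
    and le: "\<And>n. AE x in lborel. f n x \<le> g n x"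
    and f: "(\<lambda>n. L1_dist (f n) f') \<longlonglongrightarrow> 0" and g: "(\<lambda>n. L1_dist (g n) g') \<longlonglongrightarrow> 0"
  shows "AE x in lborel. f' x \<le> g' x"
proof -
  let ?I = "\<integral>\<^sup>+x. ennreal (f' x - g' x) \<partial>lborel"
  have "?I \<le> L1_dist (f n) f' + L1_dist (g n) g'" for n
  proof -
    have "?I \<le> (\<integral>\<^sup>+x. ennreal \<bar>f n x - f' x\<bar> + ennreal \<bar>g n x - g' x\<bar> \<partial>lborel)"
      using le[of n]
      by (intro nn_integral_mono_AE)
         (auto elim!: eventually_mono simp: ennreal_plus[symmetric] simp del: ennreal_plus intro!: ennreal_leI)
    also have "\<dots> = L1_dist (f n) f' + L1_dist (g n) g'"
      unfolding L1_dist_def by (rule nn_integral_add) auto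
    finally show ?thesis .
  qed
  moreover have "(\<lambda>n. L1_dist (f n) f' + L1_dist (g n) g') \<longlonglongrightarrow> 0 + 0"
    by (intro tendsto_add f g)
  ultimately have "?I \<le> 0 + 0" by (intro LIMSEQ_le_const[where a = ?I]) auto
  then have "AE x in lborel. ennreal (f' x - g' x) = 0"
    by (simp add: nn_integral_0_iff_AE)
  then show ?thesis by (simp add: ennreal_eq_0_iff)
qed

text \<open>
  Where \<open>\<bar>f\<bar> \<le> n\<close>, the square of \<open>f\<close> is at most \<open>n \<bar>f\<bar>\<close>, so cutting \<open>f\<close> off at height \<open>n\<close> makes it square integrable.
\<close>

lemma L1_approx:
  assumes "f \<in> L1"
  obtains \<phi> where "\<And>n. \<phi> n \<in> L1 \<inter> L2" "(\<lambda>n. L1_dist (\<phi> n) f) \<longlonglongrightarrow> 0"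
    "\<And>n. (AE x in lborel. 0 \<le> f x) \<Longrightarrow> AE x in lborel. 0 \<le> \<phi> n x"
proof -
  have int: "integrable lborel f" using assms by (simp add: L1_def)
  have [measurable]: "f \<in> borel_measurable borel" using int by auto
  define \<phi> where "\<phi> n x = (if \<bar>f x\<bar> \<le> real n then f x else 0)" for n x
  have [measurable]: "\<phi> n \<in> borel_measurable borel" for n unfolding \<phi>_def by measurable
  have "\<phi> n \<in> L1" for n
    unfolding L1_def mem_Collect_eq
    by (rule Bochner_Integration.integrable_bound[OF int]) (auto simp: \<phi>_def)
  moreover have "\<phi> n \<in> L2" for n
  proof -
    have "\<bar>\<phi> n x\<bar> * \<bar>\<phi> n x\<bar> \<le> real n * \<bar>f x\<bar>" for x
    proof (cases "\<bar>f x\<bar> \<le> real n")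
      case True
      then have "\<phi> n x = f x" by (simp add: \<phi>_def)
      then show ?thesis using mult_right_mono[OF True abs_ge_zero[of "f x"]] by (simp only:)
    qed (simp add: \<phi>_def)
    then have "integrable lborel (\<lambda>x. (\<phi> n x)\<^sup>2)"
      by (intro Bochner_Integration.integrable_bound[OF integrable_mult_right[OF int, of "real n"]])
         (auto simp: power2_eq_square abs_mult)
    then show ?thesis by (simp add: L2_def)
  qed
  moreover have "(\<lambda>n. L1_dist (\<phi> n) f) \<longlonglongrightarrow> 0"
  proof -
    have "(\<lambda>n. \<integral>\<^sup>+x. ennreal \<bar>\<phi> n x - f x\<bar> \<partial>lborel) \<longlonglongrightarrow> (\<integral>\<^sup>+x. 0 \<partial>(lborel::'a measure))"
    proof (rule nn_integral_dominated_convergence[where w = "\<lambda>x. ennreal \<bar>f x\<bar>"])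
      show "AE x in lborel. ennreal \<bar>\<phi> n x - f x\<bar> \<le> ennreal \<bar>f x\<bar>" for n
        by (auto simp: \<phi>_def)
      show "(\<integral>\<^sup>+x. ennreal \<bar>f x\<bar> \<partial>lborel) < \<infinity>"
        using int by (simp add: integrable_iff_bounded)
      show "AE x in lborel. (\<lambda>n. ennreal \<bar>\<phi> n x - f x\<bar>) \<longlonglongrightarrow> 0"
      proof (rule AE_I2)
        fix x :: 'a
        obtain N where N: "\<bar>f x\<bar> \<le> real N" using real_arch_simple by blast
        have "ennreal \<bar>\<phi> n x - f x\<bar> = 0" if "n \<ge> N" for n using N that by (auto simp: \<phi>_def)
        then show "(\<lambda>n. ennreal \<bar>\<phi> n x - f x\<bar>) \<longlonglongrightarrow> 0"
          by (intro tendsto_eventually) (auto simp: eventually_sequentially)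
      qed
    qed auto
    then show ?thesis by (simp add: L1_dist_def)
  qed
  moreover have "AE x in lborel. 0 \<le> \<phi> n x" if "AE x in lborel. 0 \<le> f x" for n
    using that by (auto elim!: eventually_mono simp: \<phi>_def)
  ultimately show ?thesis by (intro that[of \<phi>]) auto
qed

section \<open>The semigroup and its time integrals\<close>

locale L2_semigroup =
  fixes T :: "real \<Rightarrow> ('a::euclidean_space \<Rightarrow> real) \<Rightarrow> 'a \<Rightarrow> real"
  assumes markovian: "markovian_semigroup T"
begin

text \<open>
  Setting time zero to the identity makes the functions \<open>s \<mapsto> L2_inner (run s f) v\<close> continuous up to the end point
  of the closed half line, so that their time integrals can be taken over closed intervals.
\<close>
definition run :: "real \<Rightarrow> ('a \<Rightarrow> real) \<Rightarrow> 'a \<Rightarrow> real" where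
  "run s f = (if s \<le> 0 then f else T s f)"

lemma run_0 [simp]: "run 0 f = f" by (simp add: run_def)

lemma run_pos: "0 < s \<Longrightarrow> run s f = T s f" by (simp add: run_def)

lemma run_L2: "f \<in> L2 \<Longrightarrow> run s f \<in> L2"
  using markovian by (auto simp: run_def markovian_semigroup_def)

lemma run_cong:
  "f \<in> L2 \<Longrightarrow> g \<in> L2 \<Longrightarrow> AE x in lborel. f x = g x \<Longrightarrow> AE x in lborel. run s f x = run s g x"
  using markovian by (auto simp: run_def markovian_semigroup_def)

lemma run_sym: "f \<in> L2 \<Longrightarrow> g \<in> L2 \<Longrightarrow> L2_inner (run s f) g = L2_inner f (run s g)"
  using markovian by (auto simp: run_def markovian_semigroup_def)

lemma run_norm_le: "f \<in> L2 \<Longrightarrow> L2_norm (run s f) \<le> L2_norm f"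
  using markovian by (auto simp: run_def markovian_semigroup_def)

lemma run_add:
  assumes "f \<in> L2" "0 \<le> s" "0 \<le> t" shows "AE x in lborel. run (s + t) f x = run s (run t f) x"
proof (cases "s = 0 \<or> t = 0")
  case False
  then have "0 < s" "0 < t" using assms by auto
  then show ?thesis using markovian assms(1) by (simp add: run_pos markovian_semigroup_def)
qed auto

lemma run_inner_add:
  assumes "f \<in> L2" "v \<in> L2" "0 \<le> s" "0 \<le> t"
  shows "L2_inner (run t f) (run s v) = L2_inner (run (s + t) f) v"
  using L2_inner_cong[OF _ _ assms(2) run_add[OF assms(1,3,4)]] assms
  by (simp add: run_sym[symmetric] run_L2)

lemma run_near_0: "f \<in> L2 \<Longrightarrow> ((\<lambda>t. L2_norm (\<lambda>x. run t f x - f x)) \<longlongrightarrow> 0) (at_right 0)"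
  using markovian unfolding markovian_semigroup_def
  by (auto intro: Lim_transform_eventually simp: run_pos eventually_at_filter)

text \<open>
  By symmetry the operator at time \<open>s\<close> can be moved to the test function, where it is a contraction; so the
  modulus of continuity at time \<open>s\<close> is no worse than at time zero.
\<close>

lemma run_inner_lipschitz:
  assumes f: "f \<in> L2" and v: "v \<in> L2" and st: "0 \<le> s" "s \<le> t"
  shows "\<bar>L2_inner (run t f) v - L2_inner (run s f) v\<bar>
    \<le> L2_norm (\<lambda>x. run (t - s) f x - f x) * L2_norm v"
proof -
  let ?d = "\<lambda>x. run (t - s) f x - f x"
  have "L2_inner (run t f) v = L2_inner (run (t - s) f) (run s v)"
    using run_inner_add[OF f v, of s "t - s"] st by simp
  then have "\<bar>L2_inner (run t f) v - L2_inner (run s f) v\<bar> = \<bar>L2_inner ?d (run s v)\<bar>"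
    using f v by (simp add: run_sym[of f v s] L2_inner_diff run_L2)
  also have "\<dots> \<le> L2_norm ?d * L2_norm (run s v)"
    using f v by (intro L2_Cauchy_Schwarz L2_diff run_L2)
  also have "\<dots> \<le> L2_norm ?d * L2_norm v"
    by (rule mult_left_mono[OF run_norm_le[OF v] L2_norm_nonneg])
  finally show ?thesis .
qed

lemma continuous_run:
  assumes f: "f \<in> L2" and v: "v \<in> L2"
  shows "continuous_on {0..} (\<lambda>s. L2_inner (run s f) v)"
  unfolding continuous_on_iff
proof (intro ballI allI impI)
  fix s e :: real assume s: "s \<in> {0..}" and e: "0 < e"
  let ?\<omega> = "\<lambda>r. L2_norm (\<lambda>x. run r f x - f x)"
  have V: "0 < L2_norm v + 1" using L2_norm_nonneg[of v] by simp
  have "\<forall>\<^sub>F r in at_right 0. ?\<omega> r < e / (L2_norm v + 1)"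
    by (rule order_tendstoD(2)[OF run_near_0[OF f]]) (use e V in simp)
  then obtain d where d: "0 < d" "\<And>r. 0 < r \<Longrightarrow> r < d \<Longrightarrow> ?\<omega> r < e / (L2_norm v + 1)"
    unfolding eventually_at_right_field by blast
  have small: "\<bar>L2_inner (run t f) v - L2_inner (run r f) v\<bar> < e" if rt: "0 \<le> r" "r < t" "t - r < d" for r t
  proof -
    have "\<bar>L2_inner (run t f) v - L2_inner (run r f) v\<bar> \<le> ?\<omega> (t - r) * L2_norm v"
      using rt by (intro run_inner_lipschitz f v) auto
    also have "\<dots> \<le> ?\<omega> (t - r) * (L2_norm v + 1)"
      by (rule mult_left_mono[OF _ L2_norm_nonneg]) simp
    also have "\<dots> < e" using d(2)[of "t - r"] rt V by (simp add: pos_less_divide_eq)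
    finally show ?thesis .
  qed
  have "dist (L2_inner (run t f) v) (L2_inner (run s f) v) < e" if "t \<in> {0..}" "dist t s < d" for t
    using small[of s t] small[of t s] that s e
    by (cases t s rule: linorder_cases) (auto simp: dist_real_def)
  then show "\<exists>d>0. \<forall>t\<in>{0..}. dist t s < d \<longrightarrow> dist (L2_inner (run t f) v) (L2_inner (run s f) v) < e"
    using d(1) by blast
qed

lemma continuous_run':
  "f \<in> L2 \<Longrightarrow> v \<in> L2 \<Longrightarrow> 0 \<le> a \<Longrightarrow> continuous_on {a..b} (\<lambda>s. L2_inner (run s f) v)"
  by (rule continuous_on_subset[OF continuous_run]) auto

lemma integrable_run:
  "f \<in> L2 \<Longrightarrow> v \<in> L2 \<Longrightarrow> 0 \<le> a \<Longrightarrow> (\<lambda>s. L2_inner (run s f) v) integrable_on {a..b}"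
  by (intro integrable_continuous_real continuous_run')

text \<open>
  The Markov property speaks of functions with values in the unit interval only; symmetry moves it to such a
  test function, and \<open>f\<close> itself need not be bounded.
\<close>

lemma run_nonneg:
  assumes "f \<in> L2" "AE x in lborel. 0 \<le> f x" shows "AE x in lborel. 0 \<le> run s f x"
proof (rule L2_nonneg_dual[OF run_L2[OF assms(1)]])
  fix v :: "'a \<Rightarrow> real" assume v: "v \<in> L2" "\<And>x. 0 \<le> v x" "\<And>x. v x \<le> 1"
  then have "AE x in lborel. 0 \<le> run s v x"
    using markovian by (auto simp: run_def markovian_semigroup_def)
  then show "0 \<le> L2_inner (run s f) v"
    using assms v by (simp add: run_sym L2_inner_nonneg)
qed

lemma run_mono:
  assumes "f \<in> L2" "g \<in> L2" "AE x in lborel. f x \<le> g x" shows "AE x in lborel. run s f x \<le> run s g x"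
proof (rule L2_le_dual)
  fix v :: "'a \<Rightarrow> real" assume v: "v \<in> L2" "\<And>x. 0 \<le> v x" "\<And>x. v x \<le> 1"
  show "L2_inner (run s f) v \<le> L2_inner (run s g) v"
    using assms v by (simp add: run_sym run_L2 run_nonneg L2_inner_mono)
qed (use assms in \<open>simp_all add: run_L2\<close>)

lemma run_le_const:
  assumes f: "f \<in> L2" and c: "0 < c" and b: "AE x in lborel. 0 \<le> f x" "AE x in lborel. f x \<le> c"
  shows "AE x in lborel. run s f x \<le> c"
proof (cases "0 < s")
  case True
  let ?g = "\<lambda>x. (1 / c) * f x"
  have g: "?g \<in> L2" using f by (rule L2_scale)
  have "AE x in lborel. 0 \<le> ?g x \<and> ?g x \<le> 1" using b c by (auto simp: divide_simps)
  then have "AE x in lborel. run s ?g x \<le> 1"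
    using markovian g True by (auto simp: markovian_semigroup_def run_def)
  moreover have "AE x in lborel. run s ?g x = (1 / c) * run s f x"
    by (rule L2_eq_dual) (use f g in \<open>simp_all only: run_L2 L2_scale L2_inner_scale run_sym\<close>)
  ultimately show ?thesis
  proof eventually_elim
    case (elim x)
    then have "run s f x / c \<le> 1" by simp
    then show ?case using c by (simp add: pos_divide_le_eq)
  qed
qed (use b in \<open>simp add: run_def\<close>)

abbreviation S :: "real \<Rightarrow> ('a \<Rightarrow> real) \<Rightarrow> 'a \<Rightarrow> real" where
  "S \<equiv> semigroup_integral2 T"

lemma run_inner_bound:
  assumes "f \<in> L2" "v \<in> L2"
  shows "\<bar>L2_inner (run s f) v\<bar> \<le> L2_norm f * L2_norm v"
proof -
  have "\<bar>L2_inner (run s f) v\<bar> \<le> L2_norm (run s f) * L2_norm v"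
    using assms by (intro L2_Cauchy_Schwarz run_L2)
  also have "\<dots> \<le> L2_norm f * L2_norm v"
    by (rule mult_right_mono[OF run_norm_le[OF assms(1)] L2_norm_nonneg])
  finally show ?thesis .
qed

lemma integral_T_eq_integral_run:
  assumes f: "f \<in> L2" and v: "v \<in> L2"
  shows "(LINT s:{0<..t}|lborel. L2_inner (T s f) v) = integral {0..t} (\<lambda>s. L2_inner (run s f) v)"
proof -
  let ?\<psi> = "\<lambda>s. L2_inner (run s f) v"
  have int: "set_integrable lborel {0..t} ?\<psi>"
    by (intro borel_integrable_atLeastAtMost' continuous_run' f v) simp
  then have int': "set_integrable lborel {0<..t} ?\<psi>"
    by (rule set_integrable_subset) auto
  have "(LINT s:{0<..t}|lborel. L2_inner (T s f) v) = (LINT s:{0<..t}|lborel. ?\<psi> s)"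
    by (intro set_lebesgue_integral_cong) (auto simp: run_pos)
  also have "\<dots> = (LINT s:{0..t}|lborel. ?\<psi> s)"
    unfolding set_lebesgue_integral_def
  proof (rule integral_cong_AE)
    show "AE s in lborel. indicator {0<..t} s *\<^sub>R ?\<psi> s = indicator {0..t} s *\<^sub>R ?\<psi> s"
      using AE_lborel_singleton[of "0::real"] by (auto elim!: eventually_mono simp: indicator_def)
  qed (use int int' in \<open>auto simp: set_integrable_def\<close>)
  also have "\<dots> = integral {0..t} ?\<psi>"
    using set_borel_integral_eq_integral(2)[OF int] .
  finally show ?thesis .
qed

text \<open>
  The integral of the inner products is a bounded linear functional of the test function.
\<close>

lemma S_exists:
  assumes f: "f \<in> L2" and t: "0 \<le> t"
  shows "\<exists>h\<in>L2. \<forall>v\<in>L2. L2_inner h v = integral {0..t} (\<lambda>s. L2_inner (run s f) v)"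
proof -
  let ?B = "\<lambda>v. integral {0..t} (\<lambda>s. L2_inner (run s f) v)"
  show ?thesis
  proof (rule L2_Riesz[of ?B "t * L2_norm f"])
    fix u v :: "'a \<Rightarrow> real" and a b :: real assume uv: "u \<in> L2" "v \<in> L2"
    show "?B (\<lambda>x. a * u x + b * v x) = a * ?B u + b * ?B v"
      using f uv by (simp add: L2_inner_lincomb_right run_L2 integral_add integrable_run integrable_on_mult_right)
  next
    fix v :: "'a \<Rightarrow> real" assume v: "v \<in> L2"
    have "norm (?B v) \<le> integral {0..t} (\<lambda>s. L2_norm f * L2_norm v)"
      using f v by (intro integral_norm_bound_integral integrable_run) (auto simp: run_inner_bound)
    then show "\<bar>?B v\<bar> \<le> t * L2_norm f * L2_norm v"
      using t by (simp add: mult.commute mult.left_commute)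
  next
    fix h assume "h \<in> L2" "\<And>v. v \<in> L2 \<Longrightarrow> L2_inner h v = ?B v"
    then show ?thesis by blast
  qed
qed

lemma S_spec:
  assumes f: "f \<in> L2" and t: "0 \<le> t"
  shows "S t f \<in> L2" "v \<in> L2 \<Longrightarrow> L2_inner (S t f) v = integral {0..t} (\<lambda>s. L2_inner (run s f) v)"
proof -
  have "\<exists>h. h \<in> L2 \<and> (\<forall>v\<in>L2. L2_inner h v = (LINT s:{0<..t}|lborel. L2_inner (T s f) v))"
    using S_exists[OF f t] f by (auto simp: integral_T_eq_integral_run)
  from someI_ex[OF this, folded semigroup_integral2_def]
  show "S t f \<in> L2" "v \<in> L2 \<Longrightarrow> L2_inner (S t f) v = integral {0..t} (\<lambda>s. L2_inner (run s f) v)"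
    using f by (auto simp: integral_T_eq_integral_run)
qed

lemma S_sym: "f \<in> L2 \<Longrightarrow> v \<in> L2 \<Longrightarrow> 0 \<le> t \<Longrightarrow> L2_inner (S t f) v = L2_inner f (S t v)"
  by (simp add: S_spec run_sym L2_inner_sym[of f])

lemma S_lincomb:
  assumes "f \<in> L2" "g \<in> L2" "0 \<le> t"
  shows "AE x in lborel. S t (\<lambda>y. a * f y + b * g y) x = a * S t f x + b * S t g x"
proof (rule L2_eq_dual)
  let ?l = "\<lambda>y. a * f y + b * g y"
  fix v :: "'a \<Rightarrow> real" assume v: "v \<in> L2"
  have "L2_inner (S t ?l) v = L2_inner ?l (S t v)"
    by (rule S_sym[OF L2_lincomb[OF assms(1,2)] v assms(3)])
  also have "\<dots> = a * L2_inner f (S t v) + b * L2_inner g (S t v)"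
    by (rule L2_inner_lincomb[OF assms(1,2) S_spec(1)[OF v assms(3)]])
  also have "\<dots> = a * L2_inner (S t f) v + b * L2_inner (S t g) v"
    by (simp only: S_sym assms v)
  also have "\<dots> = L2_inner (\<lambda>x. a * S t f x + b * S t g x) v"
    by (rule L2_inner_lincomb[symmetric]) (use assms v in \<open>simp_all add: S_spec\<close>)
  finally show "L2_inner (S t ?l) v = L2_inner (\<lambda>x. a * S t f x + b * S t g x) v" .
qed (use assms in \<open>simp_all add: S_spec L2_lincomb\<close>)

lemma S_diff:
  assumes "f \<in> L2" "g \<in> L2" "0 \<le> t"
  shows "AE x in lborel. S t (\<lambda>y. f y - g y) x = S t f x - S t g x"
  using S_lincomb[OF assms, of 1 "-1"] by simp

lemma S_nonneg:
  assumes "f \<in> L2" "0 \<le> t" "AE x in lborel. 0 \<le> f x" shows "AE x in lborel. 0 \<le> S t f x"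
  by (rule L2_nonneg_dual)
     (use assms in \<open>auto simp: S_spec run_nonneg L2_inner_nonneg integrable_run intro!: integral_nonneg\<close>)

lemma S_mono:
  assumes "f \<in> L2" "g \<in> L2" "0 \<le> t" "AE x in lborel. f x \<le> g x" shows "AE x in lborel. S t f x \<le> S t g x"
proof -
  have "AE x in lborel. 0 \<le> S t (\<lambda>y. g y - f y) x"
    by (rule S_nonneg) (use assms in \<open>auto intro: L2_diff\<close>)
  with S_diff[OF assms(2,1,3)] show ?thesis by auto
qed

lemma S_mono_time:
  assumes f: "f \<in> L2" "AE x in lborel. 0 \<le> f x" and st: "0 \<le> s" "s \<le> t"
  shows "AE x in lborel. S s f x \<le> S t f x"
proof (rule L2_le_dual)
  fix v :: "'a \<Rightarrow> real" assume v: "v \<in> L2" "\<And>x. 0 \<le> v x"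
  then show "L2_inner (S s f) v \<le> L2_inner (S t f) v"
    using f st by (auto simp: S_spec run_nonneg L2_inner_nonneg intro!: integral_subset_le integrable_run)
qed (use assms in \<open>simp_all add: S_spec\<close>)

lemma inner_run_S:
  assumes f: "f \<in> L2" and v: "v \<in> L2" and st: "0 \<le> s" "0 \<le> t"
  shows "L2_inner (run s (S t f)) v = integral {s..s + t} (\<lambda>r. L2_inner (run r f) v)"
proof -
  have "L2_inner (run s (S t f)) v = integral {0..t} (\<lambda>r. L2_inner (run r f) (run s v))"
    using assms by (simp add: run_sym S_spec run_L2)
  also have "\<dots> = integral {0..t} ((\<lambda>r. L2_inner (run r f) v) \<circ> (\<lambda>r. r + s))"
    using assms by (intro integral_cong) (simp add: run_inner_add add.commute)
  also have "\<dots> = integral {0 + s..t + s} (\<lambda>r. L2_inner (run r f) v)"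
    using assms by (intro integral_shift continuous_run') auto
  finally show ?thesis by (simp add: add.commute)
qed

text \<open>
  Both sides have the same inner products: an integral over \<open>{0..s + t}\<close> is split at \<open>s\<close>.
\<close>

lemma S_add:
  assumes f: "f \<in> L2" and st: "0 \<le> s" "0 \<le> t"
  shows "AE x in lborel. S (s + t) f x = S s f x + run s (S t f) x"
proof (rule L2_eq_dual)
  fix v :: "'a \<Rightarrow> real" assume v: "v \<in> L2"
  have "integral {0..s} (\<lambda>r. L2_inner (run r f) v) + integral {s..s + t} (\<lambda>r. L2_inner (run r f) v)
      = integral {0..s + t} (\<lambda>r. L2_inner (run r f) v)"
    using st by (intro Henstock_Kurzweil_Integration.integral_combine integrable_run f v) auto
  then show "L2_inner (S (s + t) f) v = L2_inner (\<lambda>x. S s f x + run s (S t f) x) v"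
    using f v st by (simp add: L2_inner_add S_spec run_L2 inner_run_S)
qed (use assms in \<open>simp_all add: S_spec run_L2 L2_add\<close>)

lemma S_run_commute:
  assumes f: "f \<in> L2" and st: "0 \<le> s" "0 \<le> t"
  shows "AE x in lborel. run s (S t f) x = S t (run s f) x"
proof (rule L2_eq_dual)
  fix v :: "'a \<Rightarrow> real" assume v: "v \<in> L2"
  have "L2_inner (S t (run s f)) v = L2_inner f (run s (S t v))"
    using assms v by (simp add: S_sym run_sym run_L2 S_spec)
  also have "\<dots> = integral {s..s + t} (\<lambda>r. L2_inner (run r v) f)"
    using assms v by (subst L2_inner_sym) (simp add: inner_run_S)
  also have "\<dots> = integral {s..s + t} (\<lambda>r. L2_inner (run r f) v)"
    using assms v by (simp add: run_sym L2_inner_sym[of v])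
  also have "\<dots> = L2_inner (run s (S t f)) v"
    using assms v by (simp add: inner_run_S)
  finally show "L2_inner (run s (S t f)) v = L2_inner (S t (run s f)) v" by simp
qed (use assms in \<open>simp_all add: S_spec run_L2\<close>)

end

lemma indicator_ball_L2: "(indicator (ball 0 r) :: 'a::euclidean_space \<Rightarrow> real) \<in> L2"
proof -
  have "integrable lborel (indicator (ball 0 r) :: 'a \<Rightarrow> real)"
    by (rule integrable_real_indicator) (use emeasure_lborel_ball_finite[of "0::'a" r] in simp_all)
  moreover have "(\<lambda>x. (indicator (ball 0 r) x :: real)\<^sup>2) = indicator (ball (0::'a) r)"
    by (auto simp: indicator_def)
  ultimately show ?thesis by (simp add: L2_def)
qed

text \<open>
  Allows testing against the constant function 1, which is not square integrable.
\<close>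

lemma nn_integral_le_of_balls:
  assumes u: "u \<in> L2" "AE x in lborel. 0 \<le> u x"
    and le: "\<And>n. L2_inner u (indicator (ball 0 (real n))) \<le> c"
  shows "(\<integral>\<^sup>+x. ennreal (u x) \<partial>lborel) \<le> ennreal c"
proof (rule Fatou_bound[where u = "\<lambda>n x. ennreal (u x * indicator (ball 0 (real n)) x)"])
  have [measurable]: "u \<in> borel_measurable borel" using u by auto
  have [measurable]: "(indicator (ball (0::'a) (real n)) :: 'a \<Rightarrow> real) \<in> borel_measurable borel" for n
    by (rule L2_measurable[OF indicator_ball_L2])
  show "(\<lambda>x. ennreal (u x * indicator (ball 0 (real n)) x)) \<in> borel_measurable lborel" for n
    by measurable
  show "AE x in lborel. (\<lambda>n. ennreal (u x * indicator (ball 0 (real n)) x)) \<longlonglongrightarrow> ennreal (u x)"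
  proof (rule AE_I2)
    fix x :: 'a
    obtain N where N: "norm x < real N" using reals_Archimedean2 by blast
    then have "ennreal (u x * indicator (ball 0 (real n)) x) = ennreal (u x)" if "n \<ge> N" for n
      using that by (auto simp: indicator_def)
    then show "(\<lambda>n. ennreal (u x * indicator (ball 0 (real n)) x)) \<longlonglongrightarrow> ennreal (u x)"
      by (intro tendsto_eventually) (auto simp: eventually_sequentially)
  qed
  have "(\<integral>\<^sup>+x. ennreal (u x * indicator (ball 0 (real n)) x) \<partial>lborel)
      = ennreal (L2_inner u (indicator (ball 0 (real n))))" for n
    unfolding L2_inner_def
    by (rule nn_integral_eq_integral[OF L2_mult[OF u(1) indicator_ball_L2]])
       (use u(2) in \<open>auto elim!: eventually_mono\<close>)
  then show "\<forall>\<^sub>F n in sequentially. (\<integral>\<^sup>+x. ennreal (u x * indicator (ball 0 (real n)) x) \<partial>lborel) \<le> ennreal c"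
    by (simp add: le ennreal_leI)
qed

lemma L1_L2_diff: "f \<in> L1 \<inter> L2 \<Longrightarrow> g \<in> L1 \<inter> L2 \<Longrightarrow> (\<lambda>x. f x - g x) \<in> L1 \<inter> L2"
  by (auto simp: L1_def L2_diff)

lemma L1_L2_abs: "f \<in> L1 \<inter> L2 \<Longrightarrow> (\<lambda>x. \<bar>f x\<bar>) \<in> L1 \<inter> L2"
  by (auto simp: L1_def L2_abs)

context L2_semigroup
begin

text \<open>
  By symmetry this is the preservation of the upper bound \<open>c\<close> by the semigroup, in a form that makes sense
  when \<open>c\<close> as a constant function is not square integrable.
\<close>

lemma run_inner_le:
  assumes f: "f \<in> L1 \<inter> L2" "AE x in lborel. 0 \<le> f x"
    and k: "k \<in> L2" "AE x in lborel. 0 \<le> k x" "AE x in lborel. k x \<le> c" and c: "0 < c"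
  shows "L2_inner (run s f) k \<le> c * (LINT x|lborel. f x)"
proof -
  have "L2_inner (run s f) k = (LINT x|lborel. f x * run s k x)"
    using f k by (simp add: run_sym) (simp add: L2_inner_def)
  also have "\<dots> \<le> (LINT x|lborel. c * f x)"
  proof (rule integral_mono_AE)
    show "integrable lborel (\<lambda>x. f x * run s k x)" using f k by (intro L2_mult run_L2) auto
    show "integrable lborel (\<lambda>x. c * f x)" using f by (simp add: L1_def)
    show "AE x in lborel. f x * run s k x \<le> c * f x"
      using f(2) run_le_const[OF k(1) c k(2,3), of s]
    proof eventually_elim
      case (elim x)
      then show ?case using mult_left_mono[of "run s k x" c "f x"] by (simp add: mult.commute)
    qed
  qed
  finally show ?thesis by simp
qed

lemma S_inner_le:
  assumes "f \<in> L1 \<inter> L2" "AE x in lborel. 0 \<le> f x"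
    and "k \<in> L2" "AE x in lborel. 0 \<le> k x" "AE x in lborel. k x \<le> c" "0 < c" and t: "0 \<le> t"
  shows "L2_inner (S t f) k \<le> t * (c * (LINT x|lborel. f x))"
proof -
  have "L2_inner (S t f) k = integral {0..t} (\<lambda>s. L2_inner (run s f) k)"
    using assms by (simp add: S_spec)
  also have "\<dots> \<le> integral {0..t} (\<lambda>s. c * (LINT x|lborel. f x))"
    using assms(1,3) by (intro integral_le integrable_run run_inner_le[OF assms(1-6)]) auto
  also have "\<dots> = t * (c * (LINT x|lborel. f x))" using t by (simp add: mult.commute mult.left_commute)
  finally show ?thesis .
qed

lemma S_L1_nonneg:
  assumes f: "f \<in> L1 \<inter> L2" "AE x in lborel. 0 \<le> f x" and t: "0 \<le> t"
  shows "(\<integral>\<^sup>+x. ennreal (S t f x) \<partial>lborel) \<le> ennreal t * (\<integral>\<^sup>+x. ennreal (f x) \<partial>lborel)"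
proof -
  have "(\<integral>\<^sup>+x. ennreal (S t f x) \<partial>lborel) \<le> ennreal (t * (1 * (LINT x|lborel. f x)))"
    using f t by (intro nn_integral_le_of_balls S_nonneg S_inner_le S_spec indicator_ball_L2)
                 (auto simp: indicator_def)
  also have "\<dots> = ennreal t * ennreal (LINT x|lborel. f x)"
    using t by (simp add: ennreal_mult')
  also have "ennreal (LINT x|lborel. f x) = (\<integral>\<^sup>+x. ennreal (f x) \<partial>lborel)"
    using f by (intro nn_integral_eq_integral[symmetric]) (auto simp: L1_def)
  finally show ?thesis .
qed

lemma S_abs_le:
  assumes f: "f \<in> L2" and t: "0 \<le> t"
  shows "AE x in lborel. \<bar>S t f x\<bar> \<le> S t (\<lambda>x. \<bar>f x\<bar>) x"
proof -
  have "AE x in lborel. S t f x \<le> S t (\<lambda>x. \<bar>f x\<bar>) x"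
    using f t by (intro S_mono L2_abs) auto
  moreover have "AE x in lborel. S t (\<lambda>x. (-1) * f x + 0 * f x) x \<le> S t (\<lambda>x. \<bar>f x\<bar>) x"
    by (rule S_mono[OF L2_lincomb L2_abs]) (use f t in auto)
  moreover have "AE x in lborel. S t (\<lambda>x. (-1) * f x + 0 * f x) x = (-1) * S t f x + 0 * S t f x"
    by (rule S_lincomb[OF f f t])
  ultimately show ?thesis by eventually_elim auto
qed

lemma S_L1_abs:
  assumes f: "f \<in> L1 \<inter> L2" and t: "0 \<le> t"
  shows "(\<integral>\<^sup>+x. ennreal \<bar>S t f x\<bar> \<partial>lborel) \<le> ennreal t * (\<integral>\<^sup>+x. ennreal \<bar>f x\<bar> \<partial>lborel)"
proof -
  have "(\<integral>\<^sup>+x. ennreal \<bar>S t f x\<bar> \<partial>lborel) \<le> (\<integral>\<^sup>+x. ennreal (S t (\<lambda>x. \<bar>f x\<bar>) x) \<partial>lborel)"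
    using f t by (intro nn_integral_mono_AE eventually_mono[OF S_abs_le] ennreal_leI) auto
  also have "\<dots> \<le> ennreal t * (\<integral>\<^sup>+x. ennreal \<bar>f x\<bar> \<partial>lborel)"
    by (rule S_L1_nonneg[OF L1_L2_abs[OF f]]) (use t in auto)
  finally show ?thesis .
qed

lemma S_L1:
  assumes f: "f \<in> L1 \<inter> L2" and t: "0 \<le> t"
  shows "S t f \<in> L1"
proof -
  have [measurable]: "S t f \<in> borel_measurable borel" using S_spec(1)[of f t] f t by auto
  have "(\<integral>\<^sup>+x. ennreal \<bar>f x\<bar> \<partial>lborel) < \<infinity>" using f by (simp add: L1_def integrable_iff_bounded)
  then have "ennreal t * (\<integral>\<^sup>+x. ennreal \<bar>f x\<bar> \<partial>lborel) < \<infinity>"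
    by (simp add: ennreal_mult_less_top)
  with S_L1_abs[OF f t] have "(\<integral>\<^sup>+x. ennreal \<bar>S t f x\<bar> \<partial>lborel) < \<infinity>" by (rule le_less_trans)
  then show ?thesis by (simp add: L1_def integrable_iff_bounded)
qed

lemma S_L1_dist:
  assumes f: "f \<in> L1 \<inter> L2" and g: "g \<in> L1 \<inter> L2" and t: "0 \<le> t"
  shows "L1_dist (S t f) (S t g) \<le> ennreal t * L1_dist f g"
proof -
  have "L1_dist (S t f) (S t g) = (\<integral>\<^sup>+x. ennreal \<bar>S t (\<lambda>x. f x - g x) x\<bar> \<partial>lborel)"
    unfolding L1_dist_def using S_diff[of f g t] f g t
    by (intro nn_integral_cong_AE) (auto elim!: eventually_mono)
  also have "\<dots> \<le> ennreal t * L1_dist f g"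
    unfolding L1_dist_def by (rule S_L1_abs[OF L1_L2_diff[OF f g] t])
  finally show ?thesis .
qed

lemma L1_measurable: "f \<in> L1 \<Longrightarrow> f \<in> borel_measurable borel"
  by (auto simp: L1_def)

abbreviation SI :: "real \<Rightarrow> ('a \<Rightarrow> real) \<Rightarrow> 'a \<Rightarrow> real" where
  "SI \<equiv> semigroup_integral T"

text \<open>
  On \<open>L1 \<inter> L2\<close> the time integral is bounded by \<open>t\<close> in mean, so it maps approximating sequences to Cauchy
  sequences.
\<close>

lemma SI_spec:
  assumes f: "f \<in> L1" and t: "0 \<le> t"
  shows "SI t f \<in> L1 \<and> (\<exists>\<phi>. (\<forall>n. \<phi> n \<in> L1 \<inter> L2) \<and> (\<lambda>n. L1_dist (\<phi> n) f) \<longlonglongrightarrow> 0 \<and>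
    (\<lambda>n. L1_dist (S t (\<phi> n)) (SI t f)) \<longlonglongrightarrow> 0)"
proof -
  obtain \<phi> where \<phi>: "\<And>n. \<phi> n \<in> L1 \<inter> L2" "(\<lambda>n. L1_dist (\<phi> n) f) \<longlonglongrightarrow> 0"
    by (rule L1_approx[OF f]) blast
  have cau: "\<exists>N. \<forall>i\<ge>N. \<forall>j\<ge>N. L1_dist (S t (\<phi> i)) (S t (\<phi> j)) < ennreal e" if "0 < e" for e
  proof -
    let ?d = "\<lambda>n. ennreal t * L1_dist (\<phi> n) f"
    have "?d \<longlonglongrightarrow> ennreal t * 0" by (rule ennreal_tendsto_cmult[OF _ \<phi>(2)]) simp
    then have "\<forall>\<^sub>F n in sequentially. ?d n < ennreal (e/2)"
      by (rule order_tendstoD) (use that in simp)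
    then obtain N where N: "\<And>n. n \<ge> N \<Longrightarrow> ?d n < ennreal (e/2)"
      unfolding eventually_sequentially by blast
    have "L1_dist (S t (\<phi> i)) (S t (\<phi> j)) < ennreal e" if ij: "i \<ge> N" "j \<ge> N" for i j
    proof -
      have "L1_dist (S t (\<phi> i)) (S t (\<phi> j)) \<le> ennreal t * L1_dist (\<phi> i) (\<phi> j)"
        by (rule S_L1_dist[OF \<phi>(1) \<phi>(1) t])
      also have "\<dots> \<le> ennreal t * (L1_dist (\<phi> i) f + L1_dist f (\<phi> j))"
        using \<phi>(1) f by (intro mult_left_mono L1_dist_triangle) (auto simp: L1_measurable)
      also have "\<dots> = ?d i + ?d j" by (simp add: distrib_left L1_dist_sym[of f])
      also have "\<dots> < ennreal (e/2) + ennreal (e/2)" by (intro add_strict_mono N ij)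
      also have "\<dots> = ennreal e" using \<open>0 < e\<close> by (simp add: ennreal_plus[symmetric] del: ennreal_plus)
      finally show ?thesis .
    qed
    then show ?thesis by blast
  qed
  have "\<exists>h. h \<in> L1 \<and> (\<exists>\<phi>. (\<forall>n. \<phi> n \<in> L1 \<inter> L2) \<and> (\<lambda>n. L1_dist (\<phi> n) f) \<longlonglongrightarrow> 0 \<and>
    (\<lambda>n. L1_dist (S t (\<phi> n)) h) \<longlonglongrightarrow> 0)"
  proof (rule L1_complete[OF S_L1[OF \<phi>(1) t] cau])
    fix h assume "h \<in> L1" "(\<lambda>n. L1_dist (S t (\<phi> n)) h) \<longlonglongrightarrow> 0"
    with \<phi> show ?thesis by blast
  qed
  from someI_ex[OF this, folded semigroup_integral_def] show ?thesis .
qed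

lemma SI_L1: "f \<in> L1 \<Longrightarrow> 0 \<le> t \<Longrightarrow> SI t f \<in> L1"
  using SI_spec by blast

text \<open>
  Any two approximating sequences have the same limit, since \<open>S t\<close> is Lipschitz in mean. This frees later
  arguments from the sequence that was chosen in the definition.
\<close>

lemma SI_limit:
  assumes f: "f \<in> L1" and t: "0 \<le> t"
    and \<phi>: "\<And>n. \<phi> n \<in> L1 \<inter> L2" "(\<lambda>n. L1_dist (\<phi> n) f) \<longlonglongrightarrow> 0"
  shows "(\<lambda>n. L1_dist (S t (\<phi> n)) (SI t f)) \<longlonglongrightarrow> 0"
proof -
  obtain \<psi> where \<psi>: "\<And>n. \<psi> n \<in> L1 \<inter> L2" "(\<lambda>n. L1_dist (\<psi> n) f) \<longlonglongrightarrow> 0"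
    "(\<lambda>n. L1_dist (S t (\<psi> n)) (SI t f)) \<longlonglongrightarrow> 0"
    using SI_spec[OF f t] by blast
  let ?b = "\<lambda>n. ennreal t * (L1_dist (\<phi> n) f + L1_dist (\<psi> n) f) + L1_dist (S t (\<psi> n)) (SI t f)"
  have "?b \<longlonglongrightarrow> ennreal t * (0 + 0) + 0"
    by (intro tendsto_add ennreal_tendsto_cmult \<phi>(2) \<psi>(2,3)) simp
  then have lim: "?b \<longlonglongrightarrow> 0" by simp
  have "L1_dist (S t (\<phi> n)) (SI t f) \<le> ?b n" for n
  proof -
    have "L1_dist (S t (\<phi> n)) (SI t f) \<le> L1_dist (S t (\<phi> n)) (S t (\<psi> n)) + L1_dist (S t (\<psi> n)) (SI t f)"
      using f t \<phi>(1) \<psi>(1) by (intro L1_dist_triangle L1_measurable S_L1 SI_L1)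
    also have "L1_dist (S t (\<phi> n)) (S t (\<psi> n)) \<le> ennreal t * L1_dist (\<phi> n) (\<psi> n)"
      by (rule S_L1_dist[OF \<phi>(1) \<psi>(1) t])
    also have "L1_dist (\<phi> n) (\<psi> n) \<le> L1_dist (\<phi> n) f + L1_dist f (\<psi> n)"
      using \<phi>(1) \<psi>(1) f by (intro L1_dist_triangle) (auto simp: L1_measurable)
    finally show ?thesis by (simp add: L1_dist_sym[of f] mult_left_mono add_right_mono)
  qed
  then show ?thesis
    by (intro tendsto_sandwich[OF _ _ tendsto_const lim]) auto
qed

lemma SI_mono_time:
  assumes f: "f \<in> L1" "AE x in lborel. 0 \<le> f x" and st: "0 \<le> s" "s \<le> t"
  shows "AE x in lborel. SI s f x \<le> SI t f x"
proof -
  obtain \<phi> where \<phi>: "\<And>n. \<phi> n \<in> L1 \<inter> L2" "(\<lambda>n. L1_dist (\<phi> n) f) \<longlonglongrightarrow> 0"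
    "\<And>n. (AE x in lborel. 0 \<le> f x) \<Longrightarrow> AE x in lborel. 0 \<le> \<phi> n x"
    by (rule L1_approx[OF f(1)]) blast
  show ?thesis
  proof (rule L1_limit_mono)
    show "AE x in lborel. S s (\<phi> n) x \<le> S t (\<phi> n) x" for n
      using \<phi> f st by (intro S_mono_time) auto
    show "(\<lambda>n. L1_dist (S s (\<phi> n)) (SI s f)) \<longlonglongrightarrow> 0" "(\<lambda>n. L1_dist (S t (\<phi> n)) (SI t f)) \<longlonglongrightarrow> 0"
      using f st \<phi> by (intro SI_limit; simp)+
  qed (use f st \<phi>(1) in \<open>auto intro!: L1_measurable S_L1 SI_L1\<close>)
qed

section \<open>The maximum principle\<close>

text \<open>
  With \<open>P = run 1\<close>, the potentials \<open>U (m + 1) = k + P (U m)\<close> of the discrete skeleton stay below \<open>c\<close>: where \<open>k\<close> does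
  not vanish they are dominated by \<open>S (m + 1) g \<le> c\<close>, and elsewhere \<open>U (m + 1) = P (U m)\<close> inherits the bound from the
  previous step. Moreover \<open>S m k = S 1 (U m)\<close>, so the bound carries over to the continuous time integral of \<open>k\<close>,
  and by symmetry to that of \<open>f\<close>. The skeleton is what makes an induction over time steps possible.
\<close>

lemma maximum_principle:
  assumes g: "g \<in> L2" "AE x in lborel. 0 \<le> g x" and c: "0 < c"
    and k: "k \<in> L2" "AE x in lborel. 0 \<le> k x" "AE x in lborel. k x \<le> S 1 g x"
    and supp: "\<And>N. AE x in lborel. k x = 0 \<or> S (real N) g x \<le> c"
    and f: "f \<in> L1 \<inter> L2" "AE x in lborel. 0 \<le> f x"
  shows "L2_inner (S (real N) f) k \<le> c * (LINT x|lborel. f x)"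
proof -
  define U where "U = rec_nat (\<lambda>x. 0) (\<lambda>_ u x. k x + run 1 u x)"
  have U_0: "U 0 = (\<lambda>x. 0)" and U_Suc: "U (Suc m) = (\<lambda>x. k x + run 1 (U m) x)" for m
    by (simp_all add: U_def)
  have S_Suc: "AE x in lborel. S (real (Suc m)) v x = S 1 v x + run 1 (S (real m) v) x" if "v \<in> L2" for m v
    using S_add[OF that, of 1 "real m"] by simp
  have S_0: "AE x in lborel. S 0 v x = 0" if "v \<in> L2" for v
    by (rule L2_eq_dual) (use that L2_inner_scale[of 0 v] in \<open>auto simp: S_spec L2_zero\<close>)
  have U: "U m \<in> L2 \<and> (AE x in lborel. 0 \<le> U m x) \<and> (AE x in lborel. U m x \<le> S (real m) g x) \<and>
      (AE x in lborel. U m x \<le> c)" for m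
  proof (induction m)
    case 0
    show ?case using S_nonneg[OF g(1) _ g(2), of 0] c by (simp add: U_0 L2_zero)
  next
    case (Suc m)
    then have IH: "U m \<in> L2" "AE x in lborel. 0 \<le> U m x" "AE x in lborel. U m x \<le> S (real m) g x"
      "AE x in lborel. U m x \<le> c" by auto
    have in_L2: "U (Suc m) \<in> L2" unfolding U_Suc by (intro L2_add run_L2 k IH)
    have "AE x in lborel. run 1 (U m) x \<le> run 1 (S (real m) g) x"
      using IH g by (intro run_mono S_spec) auto
    with k(3) S_Suc[OF g(1), of m] have le: "AE x in lborel. U (Suc m) x \<le> S (real (Suc m)) g x"
      unfolding U_Suc by eventually_elim simp
    have "AE x in lborel. 0 \<le> run 1 (U m) x" by (rule run_nonneg[OF IH(1,2)])
    with k(2) have "AE x in lborel. 0 \<le> U (Suc m) x"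
      unfolding U_Suc by eventually_elim simp
    moreover
    \<comment> \<open>Where the charge lives the bound is inherited from the given potential; elsewhere the value is
        an average of values of the previous step.\<close>
    have "AE x in lborel. run 1 (U m) x \<le> c" by (rule run_le_const[OF IH(1) c IH(2,4)])
    with supp[of "Suc m"] le have "AE x in lborel. U (Suc m) x \<le> c"
    proof eventually_elim
      case (elim x)
      then show ?case by (auto simp: U_Suc)
    qed
    ultimately show ?case using in_L2 le by blast
  qed
  have "AE x in lborel. S (real m) k x = S 1 (U m) x" for m
  proof (induction m)
    case 0
    have "AE x in lborel. S 1 (\<lambda>x. 0 * k x + 0 * k x) x = 0 * S 1 k x + 0 * S 1 k x"
      by (rule S_lincomb[OF k(1) k(1)]) simp
    with S_0[OF k(1)] show ?case by (auto simp: U_0)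
  next
    case (Suc m)
    have Um: "U m \<in> L2" using U by blast
    have "AE x in lborel. run 1 (S (real m) k) x = run 1 (S 1 (U m)) x"
      using Suc k(1) Um by (intro run_cong S_spec) auto
    moreover have "AE x in lborel. run 1 (S 1 (U m)) x = S 1 (run 1 (U m)) x"
      by (rule S_run_commute[OF Um]) auto
    moreover have "AE x in lborel. S 1 (\<lambda>x. 1 * k x + 1 * run 1 (U m) x) x = 1 * S 1 k x + 1 * S 1 (run 1 (U m)) x"
      by (rule S_lincomb[OF k(1) run_L2[OF Um]]) simp
    ultimately show ?case using S_Suc[OF k(1), of m]
      unfolding U_Suc by eventually_elim simp
  qed
  then have "L2_inner (S (real N) k) f = L2_inner (S 1 (U N)) f"
    using U k f by (intro L2_inner_cong S_spec) auto
  then have "L2_inner (S (real N) f) k = L2_inner (S 1 f) (U N)"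
    using U[of N] k f by (simp add: S_sym L2_inner_sym[of f])
  also have "\<dots> \<le> 1 * (c * (LINT x|lborel. f x))"
    using U[of N] f c by (intro S_inner_le) auto
  finally show ?thesis by simp
qed

end

section \<open>Transience from a Hardy inequality\<close>

lemma integral_average_tendsto:
  fixes \<psi> :: "real \<Rightarrow> real"
  assumes c: "continuous_on {0..} \<psi>" and a: "0 \<le> a"
  shows "((\<lambda>r. integral {a..a + r} \<psi> / r) \<longlongrightarrow> \<psi> a) (at_right 0)"
proof -
  have "((\<lambda>x. integral {a..x} \<psi>) has_real_derivative \<psi> a) (at a within {a..a + 1})"
    by (rule integral_has_real_derivative) (use c a in \<open>auto elim: continuous_on_subset\<close>)
  then have "((\<lambda>x. integral {a..x} \<psi> / (x - a)) \<longlongrightarrow> \<psi> a) (at_right a)"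
    by (simp add: has_field_derivative_iff at_within_Icc_at_right)
  then show ?thesis
    by (subst (asm) filterlim_at_right_to_0) (simp add: add.commute)
qed

context L2_semigroup
begin

text \<open>
  The inner products of \<open>S t f - T r (S t f)\<close> telescope to an integral over \<open>{0..r}\<close> minus one over \<open>{t..t + r}\<close>;
  dividing by \<open>r\<close> gives the values of the integrand at the left end points.
\<close>

lemma S_approx_form:
  assumes f: "f \<in> L2" and t: "0 \<le> t" and v: "v \<in> L2"
  shows "((\<lambda>r. approx_form T r (S t f) v) \<longlongrightarrow> L2_inner f v - L2_inner (run t f) v) (at_right 0)"
proof -
  let ?\<psi> = "\<lambda>s. L2_inner (run s f) v"
  have "((\<lambda>r. integral {0..0 + r} ?\<psi> / r - integral {t..t + r} ?\<psi> / r) \<longlongrightarrow> ?\<psi> 0 - ?\<psi> t) (at_right 0)"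
    by (intro tendsto_diff integral_average_tendsto continuous_run f v t) simp
  moreover have "\<forall>\<^sub>F r in at_right 0. integral {0..0 + r} ?\<psi> / r - integral {t..t + r} ?\<psi> / r
      = approx_form T r (S t f) v"
    unfolding eventually_at_right_field
  proof (intro exI[of _ 1] conjI allI impI)
    fix r :: real assume r: "0 < r"
    have "L2_inner (\<lambda>x. S t f x - T r (S t f) x) v = L2_inner (S t f) v - L2_inner (run r (S t f)) v"
      unfolding run_pos[OF r, symmetric] using f v t by (intro L2_inner_diff run_L2 S_spec) auto
    also have "\<dots> = integral {0..t} ?\<psi> - integral {r..r + t} ?\<psi>"
      using f v t r by (simp add: S_spec inner_run_S)
    also have "\<dots> = integral {0..r} ?\<psi> - integral {t..t + r} ?\<psi>"
    proof -
      have "integral {0..t} ?\<psi> + integral {t..t + r} ?\<psi> = integral {0..t + r} ?\<psi>"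
        "integral {0..r} ?\<psi> + integral {r..t + r} ?\<psi> = integral {0..t + r} ?\<psi>"
        using t r by (intro Henstock_Kurzweil_Integration.integral_combine integrable_run f v; simp)+
      then show ?thesis by (simp add: add.commute)
    qed
    finally show "integral {0..0 + r} ?\<psi> / r - integral {t..t + r} ?\<psi> / r = approx_form T r (S t f) v"
      by (simp add: approx_form_def diff_divide_distrib)
  qed simp
  ultimately show ?thesis by (simp add: tendsto_cong)
qed

lemma S_energy:
  assumes E: "associated_semigroup E F T" and f: "f \<in> L2" and t: "0 \<le> t"
  shows "S t f \<in> F" "E (S t f) (S t f) = L2_inner f (S t f) - L2_inner (run t f) (S t f)"
proof -
  have u: "S t f \<in> L2" using f t by (rule S_spec)
  note lim = S_approx_form[OF f t u]
  have F: "F = {u \<in> L2. \<exists>l. ((\<lambda>t. approx_form T t u u) \<longlongrightarrow> l) (at_right 0)}"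
    using E by (simp only: associated_semigroup_def simp_thms)
  show in_F: "S t f \<in> F" unfolding F using u lim by blast
  have "((\<lambda>r. approx_form T r (S t f) (S t f)) \<longlongrightarrow> E (S t f) (S t f)) (at_right 0)"
    using E in_F by (auto simp: associated_semigroup_def)
  from tendsto_unique[OF _ this lim]
  show "E (S t f) (S t f) = L2_inner f (S t f) - L2_inner (run t f) (S t f)" by simp
qed

text \<open>
  The energy of \<open>S t g\<close> is at most the left-hand side \<open>I\<close>. By the arithmetic-geometric mean inequality with
  weight \<open>w\<close>, \<open>2 I\<close> is at most \<open>1 / C\<close> times the weighted square integral of \<open>S t g\<close>, which the Hardy inequality
  bounds by \<open>I\<close>, plus the right-hand side.
\<close>

lemma energy_bound:
  assumes E: "associated_semigroup E F T"
    and w: "w \<in> borel_measurable borel" "\<And>x. 0 < w x" "\<And>x. w x \<le> 1" and C: "0 < C"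
    and Hardy: "\<And>u. u \<in> F \<Longrightarrow> (\<integral>\<^sup>+x. ennreal ((u x)\<^sup>2 * w x) \<partial>lborel) \<le> ennreal (C * E u u)"
    and g: "g \<in> L2" "\<And>x. 0 < g x" "integrable lborel (\<lambda>x. (g x)\<^sup>2 / w x)" and t: "0 \<le> t"
  shows "L2_inner g (S t g) \<le> C * (LINT x|lborel. (g x)\<^sup>2 / w x)"
proof -
  let ?u = "S t g" and ?D = "LINT x|lborel. (g x)\<^sup>2 / w x"
  have [measurable]: "w \<in> borel_measurable borel" by (rule w)
  have u: "?u \<in> L2" using g(1) t by (rule S_spec)
  have [measurable]: "?u \<in> borel_measurable borel" using u by (rule L2_measurable)
  have u0: "AE x in lborel. 0 \<le> ?u x" using g t by (intro S_nonneg) (auto intro: less_imp_le)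
  have int: "integrable lborel (\<lambda>x. (?u x)\<^sup>2 * w x)"
  proof (rule Bochner_Integration.integrable_bound[OF L2_square[OF u]])
    have "(?u x)\<^sup>2 * w x \<le> (?u x)\<^sup>2" for x using w(2,3)[of x] by (simp add: mult_left_le)
    then show "AE x in lborel. norm ((?u x)\<^sup>2 * w x) \<le> norm ((?u x)\<^sup>2)"
      using w(2) by (simp add: abs_mult abs_of_pos)
  qed simp
  have "0 \<le> L2_inner (run t g) ?u"
    using g u0 by (intro L2_inner_nonneg run_nonneg) (auto intro: less_imp_le)
  then have le: "E ?u ?u \<le> L2_inner g ?u" using S_energy(2)[OF E g(1) t] by simp
  have W: "(LINT x|lborel. (?u x)\<^sup>2 * w x) \<le> C * L2_inner g ?u"
  proof -
    have "ennreal (LINT x|lborel. (?u x)\<^sup>2 * w x) = (\<integral>\<^sup>+x. ennreal ((?u x)\<^sup>2 * w x) \<partial>lborel)"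
      by (intro nn_integral_eq_integral[symmetric] int AE_I2 mult_nonneg_nonneg) (auto intro: less_imp_le w)
    also have "\<dots> \<le> ennreal (C * E ?u ?u)" by (rule Hardy[OF S_energy(1)[OF E g(1) t]])
    also have "\<dots> \<le> ennreal (C * L2_inner g ?u)"
      using le C by (intro ennreal_leI mult_left_mono) auto
    finally have "ennreal (LINT x|lborel. (?u x)\<^sup>2 * w x) \<le> ennreal (C * L2_inner g ?u)" .
    moreover have "0 \<le> C * L2_inner g ?u"
      using C g u0 by (intro mult_nonneg_nonneg L2_inner_nonneg) (auto intro: less_imp_le)
    ultimately show ?thesis by (simp add: ennreal_le_iff)
  qed
  have "2 * L2_inner g ?u = (LINT x|lborel. 2 * (g x * ?u x))"
    by (simp add: L2_inner_def)
  also have "\<dots> \<le> (LINT x|lborel. (1 / C) * ((?u x)\<^sup>2 * w x) + C * ((g x)\<^sup>2 / w x))"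
  proof (rule integral_mono)
    show "integrable lborel (\<lambda>x. 2 * (g x * ?u x))"
      by (intro integrable_mult_right L2_mult g u)
    show "integrable lborel (\<lambda>x. (1 / C) * ((?u x)\<^sup>2 * w x) + C * ((g x)\<^sup>2 / w x))"
      by (intro Bochner_Integration.integrable_add integrable_mult_right int g(3))
    fix x :: 'a
    let ?s = "sqrt (w x)"
    have s: "0 < ?s" "?s * ?s = w x" using w(2)[of x] by auto
    have "0 \<le> (?u x * ?s / sqrt C - sqrt C * g x / ?s)\<^sup>2" by simp
    also have "\<dots> = (1 / C) * ((?u x)\<^sup>2 * w x) + C * ((g x)\<^sup>2 / w x) - 2 * (g x * ?u x)"
      using s(1) C w(2)[of x]
      by (simp add: power2_diff power_mult_distrib power_divide)
    finally show "2 * (g x * ?u x) \<le> (1 / C) * ((?u x)\<^sup>2 * w x) + C * ((g x)\<^sup>2 / w x)" by simp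
  qed
  also have "\<dots> = (1 / C) * (LINT x|lborel. (?u x)\<^sup>2 * w x) + C * ?D"
    by (subst Bochner_Integration.integral_add[OF integrable_mult_right[OF int] integrable_mult_right[OF g(3)]])
       (simp only: integral_mult_right_zero)
  also have "\<dots> \<le> L2_inner g ?u + C * ?D"
    using W C by (simp add: pos_divide_le_eq mult.commute)
  finally show ?thesis by simp
qed

text \<open>
  On the set where \<open>S t g\<close> vanishes, the nonnegative continuous integrand that produces it vanishes at all
  times, in particular at time zero, where it is built from \<open>g > 0\<close>.
\<close>

lemma S_positive:
  assumes g: "g \<in> L2" "\<And>x. 0 < g x" and t: "0 < t"
  shows "AE x in lborel. 0 < S t g x"
proof -
  let ?u = "S t g"
  have u: "?u \<in> L2" using g(1) t by (intro S_spec) auto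
  have [measurable]: "?u \<in> borel_measurable borel" using u by (rule L2_measurable)
  have u0: "AE x in lborel. 0 \<le> ?u x" using g t by (intro S_nonneg) (auto intro: less_imp_le)
  define v where "v x = (if ?u x = 0 then g x else 0)" for x
  have [measurable]: "g \<in> borel_measurable borel" using g by auto
  have [measurable]: "v \<in> borel_measurable borel" unfolding v_def by measurable
  have v: "v \<in> L2" by (rule L2_bound[OF g(1)]) (auto simp: v_def)
  have v0: "\<And>x. 0 \<le> v x" using g(2) by (simp add: v_def less_imp_le)
  let ?\<psi> = "\<lambda>s. L2_inner (run s g) v"
  have "integral {0..t} ?\<psi> = L2_inner ?u v" using g v t by (simp add: S_spec)
  also have "\<dots> = 0" unfolding L2_inner_def by (rule integral_eq_zero_AE) (simp add: v_def)
  finally have "integral {0..t} ?\<psi> = 0" .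
  moreover have "0 \<le> ?\<psi> s" for s
    using g v0 by (intro L2_inner_nonneg run_nonneg) (auto intro: less_imp_le)
  ultimately have "\<forall>s\<in>{0..t}. ?\<psi> s = 0"
    using integral_eq_0_iff[OF continuous_run'[OF g(1) v, of 0 t]] t by simp
  then have "?\<psi> 0 = 0" by (rule bspec) (use t in simp)
  then have "AE x in lborel. g x * v x = 0"
    using L2_mult[OF g(1) v] g(2) v0
    by (subst integral_nonneg_eq_0_iff_AE[symmetric]) (auto simp: L2_inner_def less_imp_le)
  with u0 show ?thesis
  proof eventually_elim
    case (elim x)
    then show ?case using g(2)[of x] by (auto simp: v_def split: if_splits)
  qed
qed

lemma bounded_of_SUP_finite:
  fixes a :: "nat \<Rightarrow> real"
  assumes "(SUP n. ennreal (a n)) < \<infinity>"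
  obtains B :: nat where "\<And>n. a n \<le> real B"
proof -
  obtain r where r: "(SUP n. ennreal (a n)) = ennreal r" "0 \<le> r"
    using assms by (cases "SUP n. ennreal (a n)") auto
  obtain B :: nat where B: "r \<le> real B" using real_arch_simple by blast
  have "a n \<le> real B" for n
  proof -
    have "ennreal (a n) \<le> ennreal r" unfolding r(1)[symmetric] by (rule SUP_upper) simp
    then have "a n \<le> r" using r(2) by (cases "0 \<le> a n") (auto simp: ennreal_le_iff)
    then show ?thesis using B by simp
  qed
  then show ?thesis by (rule that)
qed

lemma increasing_bounded_AE:
  fixes a :: "nat \<Rightarrow> 'a \<Rightarrow> real"
  assumes meas: "\<And>n. a n \<in> borel_measurable borel" and k: "k \<in> borel_measurable borel"
    and mono: "\<And>n. AE x in lborel. a n x \<le> a (Suc n) x" and k0: "AE x in lborel. 0 \<le> k x"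
    and le: "\<And>n. (\<integral>\<^sup>+x. ennreal (a n x * k x) \<partial>lborel) \<le> ennreal c"
  shows "AE x in lborel. 0 < k x \<longrightarrow> (\<exists>B::nat. \<forall>n. a n x \<le> real B)"
proof -
  have [measurable]: "a n \<in> borel_measurable borel" "k \<in> borel_measurable borel" for n
    using meas k by auto
  have mono': "AE x in lborel. \<forall>n. a n x \<le> a (Suc n) x" using mono by (simp add: AE_all_countable)
  have "(\<integral>\<^sup>+x. (SUP n. ennreal (a n x * k x)) \<partial>lborel) = (SUP n. \<integral>\<^sup>+x. ennreal (a n x * k x) \<partial>lborel)"
  proof (rule nn_integral_monotone_convergence_SUP_AE)
    show "AE x in lborel. ennreal (a n x * k x) \<le> ennreal (a (Suc n) x * k x)" for n
      using mono[of n] k0 by eventually_elim (auto intro!: ennreal_leI mult_right_mono)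
  qed simp
  also have "\<dots> \<le> ennreal c" by (intro SUP_least le)
  finally have "(\<integral>\<^sup>+x. (SUP n. ennreal (a n x * k x)) \<partial>lborel) \<noteq> \<infinity>" by (auto simp: top_unique)
  then have "AE x in lborel. (SUP n. ennreal (a n x * k x)) \<noteq> \<infinity>"
    by (intro nn_integral_PInf_AE) auto
  then show ?thesis
  proof (rule eventually_mono, intro impI)
    fix x assume *: "(SUP n. ennreal (a n x * k x)) \<noteq> \<infinity>" "0 < k x"
    from *(1) have "(SUP n. ennreal (a n x * k x)) < \<infinity>" by (simp only: less_top infinity_ennreal_def)
    from bounded_of_SUP_finite[OF this] obtain B where B: "\<And>n. a n x * k x \<le> real B" by blast
    obtain B' :: nat where "real B / k x \<le> real B'" using real_arch_simple by blast
    moreover have "a n x \<le> real B / k x" for n using B[of n] *(2) by (simp add: pos_le_divide_eq)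
    ultimately have "a n x \<le> real B'" for n by (meson order_trans)
    then show "\<exists>B::nat. \<forall>n. a n x \<le> real B" by blast
  qed
qed

text \<open>
  Passes a bound from \<open>L1 \<inter> L2\<close> to \<open>L1\<close>; the weight is bounded, so convergence in mean suffices.
\<close>

lemma SI_weighted_bound:
  assumes f: "f \<in> L1" "AE x in lborel. 0 \<le> f x" and c: "0 \<le> c" and t: "0 \<le> t"
    and k: "k \<in> L2" "AE x in lborel. 0 \<le> k x" "\<And>x. k x \<le> 1"
    and bound: "\<And>\<phi>. \<phi> \<in> L1 \<inter> L2 \<Longrightarrow> AE x in lborel. 0 \<le> \<phi> x \<Longrightarrow>
      L2_inner (S t \<phi>) k \<le> c * (LINT x|lborel. \<phi> x)"
  shows "(\<integral>\<^sup>+x. ennreal (SI t f x * k x) \<partial>lborel) \<le> ennreal (c * (LINT x|lborel. f x))"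
proof -
  obtain \<phi> where \<phi>: "\<And>n. \<phi> n \<in> L1 \<inter> L2" "(\<lambda>n. L1_dist (\<phi> n) f) \<longlonglongrightarrow> 0"
    "\<And>n. (AE x in lborel. 0 \<le> f x) \<Longrightarrow> AE x in lborel. 0 \<le> \<phi> n x"
    by (rule L1_approx[OF f(1)]) blast
  have \<phi>0: "AE x in lborel. 0 \<le> \<phi> n x" for n using \<phi>(3) f(2) by blast
  have [measurable]: "f \<in> borel_measurable borel" "k \<in> borel_measurable borel"
      "SI t f \<in> borel_measurable borel" "\<phi> n \<in> borel_measurable borel" "S t (\<phi> n) \<in> borel_measurable borel" for n
    using L1_measurable[OF f(1)] L1_measurable[OF SI_L1[OF f(1) t]] L2_measurable[OF k(1)] \<phi>(1)[of n]
      L2_measurable[OF S_spec(1)[OF _ t], of "\<phi> n"]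
    by auto
  let ?I = "\<integral>\<^sup>+x. ennreal (SI t f x * k x) \<partial>lborel"
  let ?b = "\<lambda>n. L1_dist (S t (\<phi> n)) (SI t f) + ennreal c * (ennreal (LINT x|lborel. f x) + L1_dist (\<phi> n) f)"
  have "?I \<le> ?b n" for n
  proof -
    have "?I \<le> (\<integral>\<^sup>+x. ennreal \<bar>S t (\<phi> n) x - SI t f x\<bar> + ennreal (S t (\<phi> n) x * k x) \<partial>lborel)"
    proof (rule nn_integral_mono_AE)
      have "AE x in lborel. 0 \<le> S t (\<phi> n) x" using \<phi>(1) \<phi>0 t by (intro S_nonneg) auto
      with k(2) show "AE x in lborel. ennreal (SI t f x * k x)
          \<le> ennreal \<bar>S t (\<phi> n) x - SI t f x\<bar> + ennreal (S t (\<phi> n) x * k x)"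
      proof eventually_elim
        case (elim x)
        have "(SI t f x - S t (\<phi> n) x) * k x \<le> \<bar>S t (\<phi> n) x - SI t f x\<bar> * k x"
          using elim by (intro mult_right_mono) auto
        also have "\<dots> \<le> \<bar>S t (\<phi> n) x - SI t f x\<bar> * 1"
          using k(3) by (intro mult_left_mono) auto
        finally have "SI t f x * k x \<le> \<bar>S t (\<phi> n) x - SI t f x\<bar> + S t (\<phi> n) x * k x"
          by (simp add: algebra_simps)
        then show ?case using elim
          by (simp add: ennreal_plus[symmetric] ennreal_leI del: ennreal_plus)
      qed
    qed
    also have "\<dots> = L1_dist (S t (\<phi> n)) (SI t f) + (\<integral>\<^sup>+x. ennreal (S t (\<phi> n) x * k x) \<partial>lborel)"
      unfolding L1_dist_def by (rule nn_integral_add) auto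
    also have "(\<integral>\<^sup>+x. ennreal (S t (\<phi> n) x * k x) \<partial>lborel) = ennreal (L2_inner (S t (\<phi> n)) k)"
    proof -
      have "AE x in lborel. 0 \<le> S t (\<phi> n) x" using \<phi>(1) \<phi>0 t by (intro S_nonneg) auto
      with k(2) have "AE x in lborel. 0 \<le> S t (\<phi> n) x * k x" by eventually_elim simp
      then show ?thesis unfolding L2_inner_def
        using \<phi>(1) t k by (intro nn_integral_eq_integral L2_mult S_spec) auto
    qed
    also have "\<dots> \<le> ennreal (c * (LINT x|lborel. \<phi> n x))"
      using bound[OF \<phi>(1) \<phi>0] by (rule ennreal_leI)
    also have "\<dots> = ennreal c * (\<integral>\<^sup>+x. ennreal (\<phi> n x) \<partial>lborel)"
      using \<phi>(1) \<phi>0 c by (subst nn_integral_eq_integral) (auto simp: L1_def ennreal_mult')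
    also have "(\<integral>\<^sup>+x. ennreal (\<phi> n x) \<partial>lborel) \<le> (\<integral>\<^sup>+x. ennreal (f x) + ennreal \<bar>\<phi> n x - f x\<bar> \<partial>lborel)"
      using f(2) by (intro nn_integral_mono_AE)
        (auto elim!: eventually_mono intro!: ennreal_leI simp: ennreal_plus[symmetric] simp del: ennreal_plus)
    also have "\<dots> = (\<integral>\<^sup>+x. ennreal (f x) \<partial>lborel) + L1_dist (\<phi> n) f"
      unfolding L1_dist_def by (rule nn_integral_add) auto
    also have "(\<integral>\<^sup>+x. ennreal (f x) \<partial>lborel) = ennreal (LINT x|lborel. f x)"
      using f by (intro nn_integral_eq_integral) (auto simp: L1_def)
    finally show ?thesis by (simp add: add_left_mono mult_left_mono)
  qed
  moreover have "?b \<longlonglongrightarrow> 0 + ennreal c * (ennreal (LINT x|lborel. f x) + 0)"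
    using SI_limit[OF f(1) t \<phi>(1,2)] \<phi>(2)
    by (intro tendsto_add ennreal_tendsto_cmult tendsto_const) auto
  ultimately have "?I \<le> 0 + ennreal c * (ennreal (LINT x|lborel. f x) + 0)"
    by (intro LIMSEQ_le_const[where a = ?I]) auto
  then show ?thesis using c by (simp add: ennreal_mult')
qed

text \<open>
  Choosing \<open>g\<^sup>2 = w h\<close> with \<open>h > 0\<close> integrable makes both \<open>g\<^sup>2\<close> (as \<open>w \<le> 1\<close>) and \<open>g\<^sup>2 / w\<close> integrable. The maximum
  principle is applied to the part of \<open>S 1 g\<close> on the set where all \<open>S N g\<close> are at most a given bound, cut off at
  height 1; these charges are positive on sets that exhaust the space.
\<close>

theorem transient_of_Hardy:
  assumes E: "associated_semigroup E F T"
    and w: "w \<in> borel_measurable borel" "\<And>x. 0 < w x" "\<And>x. w x \<le> 1" and C: "0 < C"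
    and Hardy: "\<And>u. u \<in> F \<Longrightarrow> (\<integral>\<^sup>+x. ennreal ((u x)\<^sup>2 * w x) \<partial>lborel) \<le> ennreal (C * E u u)"
    and f: "f \<in> L1" "AE x in lborel. 0 \<le> f x"
  shows "AE x in lborel. potential T f x < \<infinity>"
proof -
  have [measurable]: "w \<in> borel_measurable borel" by (rule w)
  obtain h :: "'a \<Rightarrow> real" where h: "h \<in> borel_measurable borel" "\<And>x. 0 < h x" "integrable lborel h"
    using ex_positive_integrable by blast
  have [measurable]: "h \<in> borel_measurable borel" by (rule h)
  \<comment> \<open>The function \<open>g\<close> must be square integrable both with respect to \<open>dx\<close> and to \<open>dx / w\<close>.\<close>
  define g where "g x = sqrt (w x * h x)" for x
  have g_sq: "(g x)\<^sup>2 = w x * h x" for x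
    using w(2)[of x] h(2)[of x] by (simp add: g_def less_imp_le)
  have g_pos: "0 < g x" for x using w(2)[of x] h(2)[of x] by (simp add: g_def)
  have [measurable]: "g \<in> borel_measurable borel" unfolding g_def by measurable
  have g: "g \<in> L2"
  proof -
    have "w x * h x \<le> h x" for x using w(3)[of x] h(2)[of x] by (simp add: mult_left_le_one_le less_imp_le w)
    then have "integrable lborel (\<lambda>x. w x * h x)"
      using w(2) h(2) by (intro Bochner_Integration.integrable_bound[OF h(3)]) (auto simp: abs_mult abs_of_pos)
    then show ?thesis by (simp add: L2_def g_sq)
  qed
  have g_w: "(\<lambda>x. (g x)\<^sup>2 / w x) = h"
  proof
    show "(g x)\<^sup>2 / w x = h x" for x using w(2)[of x] by (simp add: g_sq)
  qed
  have g0: "AE x in lborel. 0 \<le> g x" using g_pos by (simp add: less_imp_le)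
  have Sg: "S t g \<in> L2" if "0 \<le> t" for t using g that by (rule S_spec)
  have [measurable]: "S (real n) g \<in> borel_measurable borel" "S 1 g \<in> borel_measurable borel" for n
    by (intro L2_measurable Sg; simp)+
  have "AE x in lborel. 0 < g x \<longrightarrow> (\<exists>B::nat. \<forall>n. S (real n) g x \<le> real B)"
  proof (rule increasing_bounded_AE)
    show "AE x in lborel. S (real n) g x \<le> S (real (Suc n)) g x" for n
      using g g0 by (intro S_mono_time) auto
    fix n
    have "AE x in lborel. 0 \<le> S (real n) g x" using g g0 by (intro S_nonneg) auto
    then have "(\<integral>\<^sup>+x. ennreal (S (real n) g x * g x) \<partial>lborel) = ennreal (L2_inner (S (real n) g) g)"
      unfolding L2_inner_def using g_pos g
      by (intro nn_integral_eq_integral L2_mult Sg) (auto elim!: eventually_mono simp: less_imp_le)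
    also have "\<dots> \<le> ennreal (C * (LINT x|lborel. (g x)\<^sup>2 / w x))"
      using energy_bound[OF E w C Hardy g g_pos, of "real n"] h(3)
      by (intro ennreal_leI) (simp add: g_w L2_inner_sym[of g])
    finally show "(\<integral>\<^sup>+x. ennreal (S (real n) g x * g x) \<partial>lborel) \<le> ennreal (C * (LINT x|lborel. (g x)\<^sup>2 / w x))" .
  qed (use g0 in auto)
  then have bounded: "AE x in lborel. \<exists>B::nat. \<forall>n. S (real n) g x \<le> real B"
    using g_pos by simp
  define A where "A B = {x. \<forall>n. S (real n) g x \<le> real B}" for B :: nat
  have [measurable]: "A B \<in> sets borel" for B unfolding A_def by measurable
  \<comment> \<open>The cut-off at 1 makes the weight bounded, as the extension to \<open>L1\<close> requires.\<close>
  define k where "k B x = min (max (S 1 g x) 0) 1 * indicator (A B) x" for B :: nat and x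
  have [measurable]: "k B \<in> borel_measurable borel" for B unfolding k_def by measurable
  have k0: "0 \<le> k B x" "k B x \<le> 1" for B x by (auto simp: k_def indicator_def)
  have k: "k B \<in> L2" for B
    by (rule L2_bound[OF Sg[of 1]]) (auto simp: k_def indicator_def)
  have "AE x in lborel. 0 \<le> S 1 g x" using g g0 by (intro S_nonneg) auto
  then have k_le: "AE x in lborel. k B x \<le> S 1 g x" for B
    by (rule eventually_mono) (auto simp: k_def indicator_def)
  have fin: "AE x in lborel. 0 < k B x \<longrightarrow> (\<exists>M::nat. \<forall>n. SI (real n) f x \<le> real M)" for B
  proof (rule increasing_bounded_AE)
    show "SI (real n) f \<in> borel_measurable borel" for n using f by (intro L1_measurable SI_L1) auto
    show "AE x in lborel. SI (real n) f x \<le> SI (real (Suc n)) f x" for n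
      using f by (intro SI_mono_time) auto
    fix n
    show "(\<integral>\<^sup>+x. ennreal (SI (real n) f x * k B x) \<partial>lborel) \<le> ennreal (real (Suc B) * (LINT x|lborel. f x))"
    proof (rule SI_weighted_bound[OF f])
      fix \<phi> :: "'a \<Rightarrow> real" assume \<phi>: "\<phi> \<in> L1 \<inter> L2" "AE x in lborel. 0 \<le> \<phi> x"
      show "L2_inner (S (real n) \<phi>) (k B) \<le> real (Suc B) * (LINT x|lborel. \<phi> x)"
      proof (rule maximum_principle[OF g g0 _ k _ k_le _ \<phi>])
        have "k B x = 0 \<or> S (real N) g x \<le> real (Suc B)" for N x
        proof (cases "x \<in> A B")
          case True
          then have "S (real N) g x \<le> real B" by (simp add: A_def)
          then show ?thesis by simp
        qed (simp add: k_def)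
        then show "AE x in lborel. k B x = 0 \<or> S (real N) g x \<le> real (Suc B)" for N by simp
      qed (use k0 in auto)
    qed (use k k0 in auto)
  qed (use k0 in auto)
  have incr: "AE x in lborel. \<forall>n. SI (real n) f x \<le> SI (real (Suc n)) f x"
    unfolding AE_all_countable using f by (intro allI SI_mono_time) auto
  have "AE x in lborel. \<forall>B. 0 < k B x \<longrightarrow> (\<exists>M::nat. \<forall>n. SI (real n) f x \<le> real M)"
    unfolding AE_all_countable using fin by blast
  with bounded incr S_positive[OF g g_pos zero_less_one] show ?thesis
  proof eventually_elim
    case (elim x)
    then obtain B where "\<forall>n. S (real n) g x \<le> real B" by blast
    then have "0 < k B x" using elim(3) by (simp add: k_def A_def)
    then obtain M :: nat where M: "\<And>n. SI (real n) f x \<le> real M" using elim(4) by blast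
    have "incseq (\<lambda>n. SI (real n) f x)" using elim(2) by (intro incseq_SucI) simp
    then obtain L where L: "(\<lambda>n. SI (real n) f x) \<longlonglongrightarrow> L"
      using incseq_convergent[of "\<lambda>n. SI (real n) f x" "real M"] M by blast
    then have "(\<lambda>n. ereal (SI (real n) f x)) \<longlonglongrightarrow> ereal L" by (intro tendsto_ereal)
    then have "potential T f x = ereal L" unfolding potential_def by (rule limI)
    then show ?case by simp
  qed
qed

end

section \<open>Second order expansion of powers\<close>

lemma powr_le_two_powr:
  fixes t a :: real
  assumes "\<bar>t\<bar> \<le> 1/2" shows "(1 + t) powr a \<le> 2 powr \<bar>a\<bar>"
proof (cases "0 \<le> a")
  case True
  then have "(1 + t) powr a \<le> 2 powr a" using assms by (intro powr_mono2) auto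
  then show ?thesis using True by simp
next
  case False
  have t: "0 < 1 + t" using assms by auto
  have "(1 + t) powr a = (1 / (1 + t)) powr (- a)"
    using t by (simp add: powr_divide powr_minus_divide)
  also have "\<dots> \<le> 2 powr (- a)"
    using False assms t by (intro powr_mono2) (auto simp: divide_simps)
  finally show ?thesis using False by simp
qed

lemma powr_taylor_2:
  fixes a :: real
  shows "\<exists>K\<ge>0. \<forall>t. \<bar>t\<bar> \<le> 1/2 \<longrightarrow> \<bar>(1 + t) powr a - (1 + a * t + a * (a - 1) / 2 * t\<^sup>2)\<bar> \<le> K * \<bar>t\<bar> ^ 3"
proof (intro exI conjI allI impI)
  let ?K = "\<bar>a * (a - 1) * (a - 2)\<bar> / 6 * 2 powr \<bar>a - 3\<bar>"
  show "0 \<le> ?K" by simp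
  fix t :: real assume t: "\<bar>t\<bar> \<le> 1/2"
  show "\<bar>(1 + t) powr a - (1 + a * t + a * (a - 1) / 2 * t\<^sup>2)\<bar> \<le> ?K * \<bar>t\<bar> ^ 3"
  proof (cases "t = 0")
    case False
    define D where "D m y = (if m = 0 then y powr a else if m = 1 then a * y powr (a - 1)
      else if m = 2 then a * (a - 1) * y powr (a - 2) else a * (a - 1) * (a - 2) * y powr (a - 3))"
      for m :: nat and y :: real
    have "\<exists>y. (if 1 + t < 1 then 1 + t < y \<and> y < 1 else 1 < y \<and> y < 1 + t) \<and>
       (1 + t) powr a = (\<Sum>m<3. D m 1 / fact m * (1 + t - 1) ^ m) + D 3 y / fact 3 * (1 + t - 1) ^ 3"
    proof (rule Taylor[where a = "1/2" and b = "3/2"])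
      show "D 0 = (\<lambda>y. y powr a)" by (auto simp: D_def)
      show "\<forall>m y. m < 3 \<and> 1/2 \<le> y \<and> y \<le> 3/2 \<longrightarrow> (D m has_real_derivative D (Suc m) y) (at y)"
      proof (intro allI impI, elim conjE)
        fix m :: nat and y :: real assume m: "m < 3" and y: "1/2 \<le> y"
        have der: "((\<lambda>y. c * y powr r) has_real_derivative c * (r * y powr (r - 1))) (at y)" for c r
          by (rule DERIV_cmult[OF has_real_derivative_powr]) (use y in simp)
        from m consider "m = 0" | "m = Suc 0" | "m = Suc (Suc 0)" by linarith
        then show "(D m has_real_derivative D (Suc m) y) (at y)"
          using der[of 1 a] der[of a "a - 1"] der[of "a * (a - 1)" "a - 2"]
          by cases (simp_all add: D_def[abs_def] mult.assoc)
      qed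
    qed (use t False in auto)
    then obtain y where y: "if 1 + t < 1 then 1 + t < y \<and> y < 1 else 1 < y \<and> y < 1 + t"
      and eq: "(1 + t) powr a = (\<Sum>m<3. D m 1 / fact m * (1 + t - 1) ^ m) + D 3 y / fact 3 * (1 + t - 1) ^ 3"
      by blast
    have "(\<Sum>m<3. D m 1 / fact m * (1 + t - 1) ^ m) = 1 + a * t + a * (a - 1) / 2 * t\<^sup>2"
      by (simp add: D_def eval_nat_numeral)
    moreover have "D 3 y / fact 3 * (1 + t - 1) ^ 3 = a * (a - 1) * (a - 2) / 6 * y powr (a - 3) * t ^ 3"
      by (simp add: D_def eval_nat_numeral)
    ultimately have rem: "(1 + t) powr a - (1 + a * t + a * (a - 1) / 2 * t\<^sup>2)
      = a * (a - 1) * (a - 2) / 6 * y powr (a - 3) * t ^ 3"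
      using eq by linarith
    have "\<bar>(1 + t) powr a - (1 + a * t + a * (a - 1) / 2 * t\<^sup>2)\<bar>
      = \<bar>a * (a - 1) * (a - 2)\<bar> / 6 * y powr (a - 3) * \<bar>t\<bar> ^ 3"
      unfolding rem by (simp add: abs_mult power_abs)
    also have "\<dots> \<le> ?K * \<bar>t\<bar> ^ 3"
    proof (intro mult_right_mono mult_left_mono)
      have "\<bar>y - 1\<bar> \<le> 1/2" using y t by (auto split: if_splits)
      from powr_le_two_powr[OF this, of "a - 3"] show "y powr (a - 3) \<le> 2 powr \<bar>a - 3\<bar>" by simp
    qed auto
    finally show ?thesis .
  qed simp
qed

text \<open>
  The right-hand side is a linear combination of powers of \<open>1 + t\<close> with exponents \<open>0\<close>, \<open>- q\<close>, \<open>p\<close> and \<open>p - q\<close>.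
  It is \<open>(- L \<phi>) / (b \<phi>)\<close> for a single jump that multiplies \<open>s\<close> by \<open>1 + t\<close>.
\<close>

lemma drift_expansion:
  fixes p q :: real
  shows "\<exists>K\<ge>0. \<forall>t. \<bar>t\<bar> \<le> 1/2 \<longrightarrow>
    2 * q * t + q * (p - q - 1) * t\<^sup>2 - K * \<bar>t\<bar> ^ 3 \<le> (1 - (1 + t) powr (- q)) * (1 + (1 + t) powr p)"
proof -
  obtain K1 where K1: "K1 \<ge> 0" "\<And>t. \<bar>t\<bar> \<le> 1/2 \<Longrightarrow>
      \<bar>(1 + t) powr (- q) - (1 + (- q) * t + (- q) * (- q - 1) / 2 * t\<^sup>2)\<bar> \<le> K1 * \<bar>t\<bar> ^ 3"
    using powr_taylor_2[of "- q"] by blast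
  obtain K2 where K2: "K2 \<ge> 0" "\<And>t. \<bar>t\<bar> \<le> 1/2 \<Longrightarrow>
      \<bar>(1 + t) powr p - (1 + p * t + p * (p - 1) / 2 * t\<^sup>2)\<bar> \<le> K2 * \<bar>t\<bar> ^ 3"
    using powr_taylor_2[of p] by blast
  obtain K3 where K3: "K3 \<ge> 0" "\<And>t. \<bar>t\<bar> \<le> 1/2 \<Longrightarrow>
      \<bar>(1 + t) powr (p - q) - (1 + (p - q) * t + (p - q) * (p - q - 1) / 2 * t\<^sup>2)\<bar> \<le> K3 * \<bar>t\<bar> ^ 3"
    using powr_taylor_2[of "p - q"] by blast
  show ?thesis
  proof (intro exI conjI allI impI)
    show "0 \<le> K1 + K2 + K3" using K1 K2 K3 by simp
    fix t :: real assume t: "\<bar>t\<bar> \<le> 1/2"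
    then have "0 < 1 + t" by auto
    then have "(1 + t) powr (- q) * (1 + t) powr p = (1 + t) powr (p - q)"
      by (simp add: powr_add[symmetric])
    then have "(1 - (1 + t) powr (- q)) * (1 + (1 + t) powr p)
        = 1 - (1 + t) powr (- q) + (1 + t) powr p - (1 + t) powr (p - q)"
      by (simp add: algebra_simps)
    moreover have "1 - (1 + (- q) * t + (- q) * (- q - 1) / 2 * t\<^sup>2) + (1 + p * t + p * (p - 1) / 2 * t\<^sup>2)
        - (1 + (p - q) * t + (p - q) * (p - q - 1) / 2 * t\<^sup>2) = 2 * q * t + q * (p - q - 1) * t\<^sup>2"
      by (simp add: field_simps)
    ultimately show "2 * q * t + q * (p - q - 1) * t\<^sup>2 - (K1 + K2 + K3) * \<bar>t\<bar> ^ 3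
        \<le> (1 - (1 + t) powr (- q)) * (1 + (1 + t) powr p)"
      using K1(2)[OF t] K2(2)[OF t] K3(2)[OF t] unfolding distrib_right by linarith
  qed
qed

section \<open>Rotation invariant jump measures\<close>

text \<open>
  The reflection in the hyperplane orthogonal to \<open>w = u - v\<close> exchanges \<open>u\<close> and \<open>v\<close>; for \<open>u = v\<close> the formula below
  is the identity because division by zero yields zero.
\<close>

lemma reflection:
  fixes u v :: "'a::euclidean_space"
  assumes "norm u = norm v"
  obtains R where "orthogonal_transformation R" "\<And>z. R (R z) = z" "\<And>z. u \<bullet> R z = v \<bullet> z"
proof
  define w where "w = u - v"
  define R where "R z = z - (2 * (w \<bullet> z) / (w \<bullet> w)) *\<^sub>R w" for z
  have wR: "w \<bullet> R z = - (w \<bullet> z)" for z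
    by (cases "w = 0") (simp_all add: R_def inner_diff_right)
  have "linear R"
    by (rule linearI) (simp_all add: R_def inner_add_right add_divide_distrib algebra_simps)
  moreover have "R y \<bullet> R z = y \<bullet> z" for y z
  proof -
    have "R y \<bullet> R z = y \<bullet> R z - 2 * (w \<bullet> y) / (w \<bullet> w) * (w \<bullet> R z)"
      by (simp add: R_def[of y] inner_diff_left)
    also have "\<dots> = y \<bullet> z"
      unfolding wR by (simp add: R_def inner_diff_right inner_commute)
    finally show ?thesis .
  qed
  ultimately show "orthogonal_transformation R" by (simp add: orthogonal_transformation_def)
  show "R (R z) = z" for z
    unfolding R_def[of "R z"] wR by (simp add: R_def)
  show "u \<bullet> R z = v \<bullet> z" for z
  proof (cases "w = 0")
    case False
    have "u \<bullet> u = v \<bullet> v" using assms by (simp add: norm_eq)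
    then have "w \<bullet> w = 2 * (u \<bullet> w)"
      by (simp add: w_def inner_diff_left inner_diff_right inner_commute)
    moreover from this have "u \<bullet> w \<noteq> 0" using False by auto
    ultimately have "u \<bullet> R z = u \<bullet> z - w \<bullet> z"
      by (simp add: R_def inner_diff_right)
    then show ?thesis by (simp add: w_def inner_diff_left)
  qed (simp add: R_def w_def)
qed

locale radial_measure = finite_measure M for M :: "'a::euclidean_space measure" +
  assumes sets_M [measurable_cong]: "sets M = sets borel"
    and rotation: "rotation_invariant M"
    and unit_ball: "AE z in M. norm z < 1"
begin

text \<open>
  For an involution image and preimage coincide, so the invariance of images is the invariance under
  push-forward. Reflections and the point reflection suffice for all moment computations.
\<close>

lemma distr_involution:
  assumes R: "orthogonal_transformation R" "\<And>z. R (R z) = z"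
  shows "distr M borel R = M" "R \<in> borel_measurable borel"
proof -
  have "continuous_on UNIV R"
    using R(1) by (simp add: linear_continuous_on linear_linear orthogonal_transformation_linear)
  then show [measurable]: "R \<in> borel_measurable borel" by (rule borel_measurable_continuous_onI)
  show "distr M borel R = M"
  proof (rule measure_eqI)
    fix A assume "A \<in> sets (distr M borel R)"
    then have A: "A \<in> sets borel" by simp
    have "R -` A = R ` A" using R(2) by (auto intro: rev_image_eqI)
    moreover have "space M = UNIV" using sets_eq_imp_space_eq[OF sets_M] by simp
    ultimately have "emeasure (distr M borel R) A = emeasure M (R ` A)"
      using A by (subst emeasure_distr) auto
    also have "\<dots> = emeasure M A" using rotation R(1) A by (auto simp: rotation_invariant_def)
    finally show "emeasure (distr M borel R) A = emeasure M A" .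
  qed (simp add: sets_M)
qed

lemma integral_involution:
  fixes f :: "'a \<Rightarrow> real"
  assumes R: "orthogonal_transformation R" "\<And>z. R (R z) = z" and f: "f \<in> borel_measurable borel"
  shows "(LINT z|M. f (R z)) = (LINT z|M. f z)"
  using integral_distr[of R M borel f] distr_involution[OF R] f
  by (simp add: measurable_cong_sets[OF sets_M refl])

lemma orthogonal_uminus: "orthogonal_transformation (uminus :: 'a \<Rightarrow> 'a)"
  by (simp add: orthogonal_transformation_neg orthogonal_transformation_id)

lemma nn_integral_uminus:
  assumes f: "f \<in> borel_measurable borel"
  shows "(\<integral>\<^sup>+z. f (- z) \<partial>M) = (\<integral>\<^sup>+z. f z \<partial>M)"
  using nn_integral_distr[of uminus M borel f] distr_involution[OF orthogonal_uminus] f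
  by (simp add: measurable_cong_sets[OF sets_M refl])

definition second_moment :: real where
  "second_moment = (LINT z|M. (norm z)\<^sup>2)"

lemma integrable_bounded_on_ball:
  fixes f :: "'a \<Rightarrow> real"
  assumes "f \<in> borel_measurable borel" "\<And>z. norm z < 1 \<Longrightarrow> \<bar>f z\<bar> \<le> B"
  shows "integrable M f"
proof (rule integrable_const_bound[of _ B])
  show "AE z in M. norm (f z) \<le> B" using unit_ball by (rule eventually_mono) (use assms(2) in auto)
  show "f \<in> borel_measurable M" using assms(1) by (simp add: measurable_cong_sets[OF sets_M refl])
qed

lemma integral_odd:
  fixes f :: "'a \<Rightarrow> real"
  assumes "f \<in> borel_measurable borel" "\<And>z. f (- z) = - f z"
  shows "(LINT z|M. f z) = 0"
  using integral_involution[OF orthogonal_uminus _ assms(1)] assms(2) by simp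

lemma integrable_inner_square: "integrable M (\<lambda>z. (x \<bullet> z)\<^sup>2)"
proof (rule integrable_bounded_on_ball[of _ "(norm x)\<^sup>2"])
  fix z :: 'a assume z: "norm z < 1"
  have "\<bar>x \<bullet> z\<bar> \<le> norm x * norm z" by (rule Cauchy_Schwarz_ineq2)
  also have "\<dots> \<le> norm x * 1" using z by (intro mult_left_mono) auto
  finally show "\<bar>(x \<bullet> z)\<^sup>2\<bar> \<le> (norm x)\<^sup>2" by (simp add: abs_le_square_iff[symmetric])
qed simp

text \<open>
  Reflections exchange any two directions, so each of the \<open>DIM('a)\<close> coordinate directions contributes the same
  share of the second moment.
\<close>

lemma integral_inner_square: "(LINT z|M. (x \<bullet> z)\<^sup>2) = (norm x)\<^sup>2 * second_moment / real DIM('a)"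
proof -
  have same: "(LINT z|M. (u \<bullet> z)\<^sup>2) = (LINT z|M. (v \<bullet> z)\<^sup>2)" if uv: "norm u = norm v" for u v :: 'a
  proof (rule reflection[OF uv])
    fix R :: "'a \<Rightarrow> 'a"
    assume R: "orthogonal_transformation R" "\<And>z. R (R z) = z" "\<And>z. u \<bullet> R z = v \<bullet> z"
    have "(LINT z|M. (u \<bullet> z)\<^sup>2) = (LINT z|M. (u \<bullet> R z)\<^sup>2)"
      by (rule integral_involution[OF R(1,2), symmetric]) simp
    then show ?thesis by (simp add: R(3))
  qed
  have Parseval: "(norm x)\<^sup>2 * (norm z)\<^sup>2 = (\<Sum>b\<in>Basis. ((norm x *\<^sub>R b) \<bullet> z)\<^sup>2)" for z :: 'a
  proof -
    have "(norm z)\<^sup>2 = (\<Sum>b\<in>Basis. (z \<bullet> b)\<^sup>2)"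
      unfolding power2_norm_eq_inner euclidean_inner[of z z] by (simp add: power2_eq_square)
    then show ?thesis by (simp add: sum_distrib_left power_mult_distrib inner_commute)
  qed
  have "(norm x)\<^sup>2 * second_moment = (LINT z|M. (\<Sum>b\<in>Basis. ((norm x *\<^sub>R b) \<bullet> z)\<^sup>2))"
    unfolding second_moment_def integral_mult_right_zero[symmetric]
    by (simp only: Parseval)
  also have "\<dots> = (\<Sum>b\<in>Basis. LINT z|M. ((norm x *\<^sub>R b) \<bullet> z)\<^sup>2)"
    by (intro Bochner_Integration.integral_sum integrable_inner_square)
  also have "\<dots> = (\<Sum>b\<in>(Basis::'a set). LINT z|M. (x \<bullet> z)\<^sup>2)"
    by (intro sum.cong refl same) simp
  finally show ?thesis by simp
qed

section \<open>The supersolution\<close>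

text \<open>The relative increment of \<open>R + |x|\<^sup>2\<close> under the jump from \<open>x\<close> to \<open>x + z\<close>.\<close>
definition rel_incr :: "real \<Rightarrow> 'a \<Rightarrow> 'a \<Rightarrow> real" where
  "rel_incr R x z = (2 * (x \<bullet> z) + (norm z)\<^sup>2) / (R + (norm x)\<^sup>2)"

lemma rel_incr_measurable [measurable]: "rel_incr R x \<in> borel_measurable borel"
  unfolding rel_incr_def[abs_def] by measurable

lemma shifted_square:
  assumes "0 < R" shows "R + (norm (x + z))\<^sup>2 = (R + (norm x)\<^sup>2) * (1 + rel_incr R x z)"
proof -
  have pos: "0 < R + (norm x)\<^sup>2" using assms by (simp add: add_pos_nonneg)
  have "(norm (x + z))\<^sup>2 = (norm x)\<^sup>2 + (2 * (x \<bullet> z) + (norm z)\<^sup>2)"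
    by (simp add: power2_norm_eq_inner inner_add_left inner_add_right inner_commute)
  moreover have "(R + (norm x)\<^sup>2) * rel_incr R x z = 2 * (x \<bullet> z) + (norm z)\<^sup>2"
    using pos by (simp add: rel_incr_def)
  ultimately show ?thesis unfolding distrib_left[of "R + (norm x)\<^sup>2"] by simp
qed

text \<open>
  Both \<open>\<bar>x\<bar>\<close> and 1 are at most the square root of \<open>R + |x|\<^sup>2\<close>; the choice \<open>36 = 6\<^sup>2\<close> makes the resulting bound at most
  \<open>3 / 6\<close>.
\<close>

lemma rel_incr_bound:
  assumes R: "36 \<le> R" and z: "norm z < 1"
  shows "\<bar>rel_incr R x z\<bar> \<le> 3 * norm z / sqrt (R + (norm x)\<^sup>2)" "\<bar>rel_incr R x z\<bar> \<le> 1/2"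
proof -
  let ?s = "R + (norm x)\<^sup>2"
  have s: "36 \<le> ?s" using R by (simp add: add_increasing2)
  have x: "norm x \<le> sqrt ?s" using R by (intro real_le_rsqrt) simp
  have root: "6 \<le> sqrt ?s" using s by (intro real_le_rsqrt) simp
  have "\<bar>x \<bullet> z\<bar> \<le> norm x * norm z" by (rule Cauchy_Schwarz_ineq2)
  also have "\<dots> \<le> sqrt ?s * norm z" using x by (rule mult_right_mono) simp
  finally have "\<bar>x \<bullet> z\<bar> \<le> sqrt ?s * norm z" .
  moreover have "norm z * norm z \<le> sqrt ?s * norm z" using z root by (intro mult_right_mono) auto
  moreover have "0 \<le> norm z * norm z" by simp
  ultimately have le: "\<bar>2 * (x \<bullet> z) + (norm z)\<^sup>2\<bar> \<le> 3 * (sqrt ?s * norm z)"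
    unfolding power2_eq_square[of "norm z"] abs_le_iff by linarith
  have "\<bar>rel_incr R x z\<bar> = \<bar>2 * (x \<bullet> z) + (norm z)\<^sup>2\<bar> / \<bar>?s\<bar>"
    by (simp only: rel_incr_def abs_divide)
  also have "\<bar>?s\<bar> = sqrt ?s * sqrt ?s" using s by simp
  also have "\<bar>2 * (x \<bullet> z) + (norm z)\<^sup>2\<bar> / (sqrt ?s * sqrt ?s)
      \<le> 3 * (sqrt ?s * norm z) / (sqrt ?s * sqrt ?s)"
    by (rule divide_right_mono[OF le]) simp
  also have "\<dots> = 3 * norm z / sqrt ?s"
    using root by (simp add: field_simps del: real_sqrt_mult_self)
  finally show *: "\<bar>rel_incr R x z\<bar> \<le> 3 * norm z / sqrt ?s" .
  also have "\<dots> \<le> 3 * 1 / 6" using z root by (intro frac_le) auto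
  finally show "\<bar>rel_incr R x z\<bar> \<le> 1/2" by simp
qed

lemma integral_rel_incr:
  assumes R: "36 \<le> R"
  shows "integrable M (rel_incr R x)" "(LINT z|M. rel_incr R x z) = second_moment / (R + (norm x)\<^sup>2)"
proof -
  show int: "integrable M (rel_incr R x)"
    by (rule integrable_bounded_on_ball[of _ "1/2"]) (simp, rule rel_incr_bound(2)[OF R])
  have xz: "integrable M (\<lambda>z. 2 * (x \<bullet> z))"
  proof (intro integrable_mult_right integrable_bounded_on_ball[of _ "norm x"])
    fix z :: 'a assume z: "norm z < 1"
    have "\<bar>x \<bullet> z\<bar> \<le> norm x * norm z" by (rule Cauchy_Schwarz_ineq2)
    also have "\<dots> \<le> norm x * 1" using z by (intro mult_left_mono) auto
    finally show "\<bar>x \<bullet> z\<bar> \<le> norm x" by simp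
  qed simp
  have zz: "integrable M (\<lambda>z. (norm z)\<^sup>2)"
    by (rule integrable_bounded_on_ball[of _ 1]) (auto simp: power_le_one)
  have "(LINT z|M. 2 * (x \<bullet> z)) = 0" by (rule integral_odd) auto
  then have "(LINT z|M. 2 * (x \<bullet> z) + (norm z)\<^sup>2) = second_moment"
    by (simp only: Bochner_Integration.integral_add[OF xz zz] second_moment_def)
  then show "(LINT z|M. rel_incr R x z) = second_moment / (R + (norm x)\<^sup>2)"
    unfolding rel_incr_def[abs_def] by simp
qed

lemma integral_rel_incr_square:
  assumes R: "36 \<le> R"
  obtains e where "integrable M (\<lambda>z. (rel_incr R x z)\<^sup>2)" "0 \<le> e" "e \<le> second_moment"
    "(LINT z|M. (rel_incr R x z)\<^sup>2)
      = (4 * (norm x)\<^sup>2 * second_moment / real DIM('a) + e) / (R + (norm x)\<^sup>2)\<^sup>2"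
proof
  let ?e = "LINT z|M. ((norm z)\<^sup>2)\<^sup>2"
  have zz: "integrable M (\<lambda>z. (norm z)\<^sup>2)" "integrable M (\<lambda>z. ((norm z)\<^sup>2)\<^sup>2)"
    by (rule integrable_bounded_on_ball[of _ 1]; auto simp: power_le_one)+
  have xz: "integrable M (\<lambda>z. 4 * (x \<bullet> z) * (norm z)\<^sup>2)"
  proof (rule integrable_bounded_on_ball[of _ "4 * norm x"])
    fix z :: 'a assume z: "norm z < 1"
    have "\<bar>x \<bullet> z\<bar> \<le> norm x * norm z" by (rule Cauchy_Schwarz_ineq2)
    also have "\<dots> \<le> norm x * 1" using z by (intro mult_left_mono) auto
    finally have "\<bar>x \<bullet> z\<bar> * (norm z)\<^sup>2 \<le> norm x * 1"
      using z by (intro mult_mono) (auto simp: power_le_one)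
    then show "\<bar>4 * (x \<bullet> z) * (norm z)\<^sup>2\<bar> \<le> 4 * norm x" by (simp add: abs_mult)
  qed simp
  show "integrable M (\<lambda>z. (rel_incr R x z)\<^sup>2)"
  proof (rule integrable_bounded_on_ball[of _ 1])
    fix z :: 'a assume "norm z < 1"
    then have "\<bar>rel_incr R x z\<bar> \<le> 1" using rel_incr_bound(2)[OF R, of z x] by simp
    then show "\<bar>(rel_incr R x z)\<^sup>2\<bar> \<le> 1" by (simp add: abs_square_le_1)
  qed simp
  show "0 \<le> ?e" by (intro integral_nonneg_AE) simp
  show "?e \<le> second_moment" unfolding second_moment_def
  proof (rule integral_mono_AE[OF zz(2,1)])
    show "AE z in M. ((norm z)\<^sup>2)\<^sup>2 \<le> (norm z)\<^sup>2"
      using unit_ball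
    proof (rule eventually_mono)
      fix z :: 'a assume "norm z < 1"
      then have "(norm z)\<^sup>2 \<le> 1" by (simp add: power_le_one)
      then show "((norm z)\<^sup>2)\<^sup>2 \<le> (norm z)\<^sup>2"
        unfolding power2_eq_square[of "(norm z)\<^sup>2"] by (rule mult_left_le) simp
    qed
  qed
  have "(2 * (x \<bullet> z) + (norm z)\<^sup>2)\<^sup>2 = (4 * (x \<bullet> z)\<^sup>2 + 4 * (x \<bullet> z) * (norm z)\<^sup>2) + ((norm z)\<^sup>2)\<^sup>2" for z
    by (simp add: power2_sum power_mult_distrib)
  then have "(LINT z|M. (2 * (x \<bullet> z) + (norm z)\<^sup>2)\<^sup>2)
      = (LINT z|M. (4 * (x \<bullet> z)\<^sup>2 + 4 * (x \<bullet> z) * (norm z)\<^sup>2) + ((norm z)\<^sup>2)\<^sup>2)" by simp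
  also have "\<dots> = (LINT z|M. 4 * (x \<bullet> z)\<^sup>2 + 4 * (x \<bullet> z) * (norm z)\<^sup>2) + ?e"
    by (rule Bochner_Integration.integral_add[OF Bochner_Integration.integrable_add[OF
          integrable_mult_right[OF integrable_inner_square] xz] zz(2)])
  also have "(LINT z|M. 4 * (x \<bullet> z)\<^sup>2 + 4 * (x \<bullet> z) * (norm z)\<^sup>2)
      = (LINT z|M. 4 * (x \<bullet> z)\<^sup>2) + (LINT z|M. 4 * (x \<bullet> z) * (norm z)\<^sup>2)"
    by (rule Bochner_Integration.integral_add[OF integrable_mult_right[OF integrable_inner_square] xz])
  also have "(LINT z|M. 4 * (x \<bullet> z) * (norm z)\<^sup>2) = 0" by (rule integral_odd) auto
  finally have "(LINT z|M. (2 * (x \<bullet> z) + (norm z)\<^sup>2)\<^sup>2)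
      = 4 * ((norm x)\<^sup>2 * second_moment / real DIM('a)) + ?e"
    by (simp add: integral_inner_square)
  then show "(LINT z|M. (rel_incr R x z)\<^sup>2)
      = (4 * (norm x)\<^sup>2 * second_moment / real DIM('a) + ?e) / (R + (norm x)\<^sup>2)\<^sup>2"
    unfolding rel_incr_def by (simp add: power_divide mult.assoc)
qed

lemma integrable_powr_rel_incr:
  assumes R: "36 \<le> R"
  shows "integrable M (\<lambda>z. (1 + rel_incr R x z) powr a)"
    "integrable M (\<lambda>z. (1 + rel_incr R x z) powr a * (1 + rel_incr R x z) powr b)"
proof -
  show 1: "integrable M (\<lambda>z. (1 + rel_incr R x z) powr a)" for a
  proof (rule integrable_bounded_on_ball[of _ "2 powr \<bar>a\<bar>"])
    fix z :: 'a assume "norm z < 1"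
    from powr_le_two_powr[OF rel_incr_bound(2)[OF R this]]
    show "\<bar>(1 + rel_incr R x z) powr a\<bar> \<le> 2 powr \<bar>a\<bar>" by simp
  qed simp
  have "(1 + rel_incr R x z) powr a * (1 + rel_incr R x z) powr b = (1 + rel_incr R x z) powr (a + b)" for z
    by (simp add: powr_add)
  then show "integrable M (\<lambda>z. (1 + rel_incr R x z) powr a * (1 + rel_incr R x z) powr b)"
    using 1 by simp
qed

text \<open>
  The factor \<open>1 + (2 (p - q - 1) / d) \<theta>\<close> of the leading term, with \<open>\<theta> = |x|\<^sup>2 / s\<close> in the unit interval, is affine in \<open>\<theta>\<close>
  and positive at both ends, hence at least \<open>k0 > 0\<close>. Fourth moments and the cubic remainder together are
  at most \<open>B / (r s)\<close> with \<open>r\<^sup>2 = R\<close>, and \<open>R\<close> is chosen such that this costs at most half of the leading term.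
\<close>

lemma drift_bound:
  assumes q: "0 < q" and pq: "0 < real DIM('a) + 2 * (p - q - 1)" and m: "0 < second_moment"
  obtains R \<kappa> where "36 \<le> R" "0 < \<kappa>"
    "\<And>x. \<kappa> / (R + (norm x)\<^sup>2)
      \<le> (LINT z|M. (1 - (1 + rel_incr R x z) powr (- q)) * (1 + (1 + rel_incr R x z) powr p))"
proof -
  let ?d = "real DIM('a)" and ?m = second_moment
  have d: "0 < ?d" by simp
  obtain K where K: "K \<ge> 0" "\<And>t. \<bar>t\<bar> \<le> 1/2 \<Longrightarrow>
    2 * q * t + q * (p - q - 1) * t\<^sup>2 - K * \<bar>t\<bar> ^ 3 \<le> (1 - (1 + t) powr (- q)) * (1 + (1 + t) powr p)"
    using drift_expansion[of q p] by blast
  define k0 where "k0 = min 1 (1 + 2 * (p - q - 1) / ?d)"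
  have k0: "0 < k0" using pq d by (simp add: k0_def field_simps)
  define B where "B = (q * \<bar>p - q - 1\<bar> + 27 * K) * ?m"
  have B: "0 \<le> B" using q K m by (simp add: B_def)
  define r where "r = max 6 (B / (q * ?m * k0))"
  have r: "6 \<le> r" "B / (q * ?m * k0) \<le> r" by (simp_all add: r_def)
  have Br: "B / r \<le> q * ?m * k0"
    using r q m k0 by (simp add: pos_divide_le_eq mult.commute)
  define R where "R = r\<^sup>2"
  have R: "36 \<le> R" using power_mono[OF r(1), of 2] by (simp add: R_def)
  show ?thesis
  proof (rule that[OF R])
    show "0 < q * ?m * k0" using q m k0 by simp
    fix x :: 'a
    let ?s = "R + (norm x)\<^sup>2" and ?t = "rel_incr R x"
    have s: "36 \<le> ?s" using R by (simp add: add_increasing2)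
    have root: "r \<le> sqrt ?s" using r by (intro real_le_rsqrt) (simp add: R_def)
    then have r_s: "r \<le> ?s"
    proof -
      have "6 \<le> sqrt ?s" using root r by simp
      then have "sqrt ?s * 1 \<le> sqrt ?s * sqrt ?s" using s by (intro mult_left_mono) auto
      then show ?thesis using root s by simp
    qed
    obtain e where e: "integrable M (\<lambda>z. (?t z)\<^sup>2)" "0 \<le> e" "e \<le> ?m"
      "(LINT z|M. (?t z)\<^sup>2) = (4 * (norm x)\<^sup>2 * ?m / ?d + e) / ?s\<^sup>2"
      by (rule integral_rel_incr_square[OF R])
    have zz: "integrable M (\<lambda>z. (norm z)\<^sup>2)"
      by (rule integrable_bounded_on_ball[of _ 1]) (auto simp: power_le_one)
    let ?c = "27 * K / (?s * sqrt ?s)"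
    have intL: "integrable M (\<lambda>z. 2 * q * ?t z)" "integrable M (\<lambda>z. q * (p - q - 1) * (?t z)\<^sup>2)"
        "integrable M (\<lambda>z. ?c * (norm z)\<^sup>2)"
      by (intro integrable_mult_right integral_rel_incr(1)[OF R] e(1) zz)+
    let ?L = "\<lambda>z. 2 * q * ?t z + q * (p - q - 1) * (?t z)\<^sup>2 - ?c * (norm z)\<^sup>2"
    have collect: "2 * q' * (m' / s') + q' * a * ((4 * n * m' / d' + e') / s'\<^sup>2) - 27 * K' / (s' * w) * m'
        = (2 * q' * m' * (1 + 2 * a / d' * (n / s')) + q' * a * e' / s' - 27 * K' * m' / w) / s'"
      if "s' \<noteq> 0" "d' \<noteq> 0" "w \<noteq> 0" for q' m' s' a n d' e' K' w :: real
      using that by (simp add: field_simps power2_eq_square)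
    have "q * ?m * k0 / ?s \<le> (LINT z|M. ?L z)"
    proof -
      have "(LINT z|M. ?L z) = 2 * q * (?m / ?s)
          + q * (p - q - 1) * ((4 * (norm x)\<^sup>2 * ?m / ?d + e) / ?s\<^sup>2) - ?c * ?m"
        by (simp only: Bochner_Integration.integral_diff[OF Bochner_Integration.integrable_add[OF intL(1,2)] intL(3)]
            Bochner_Integration.integral_add[OF intL(1,2)] integral_mult_right_zero
            integral_rel_incr(2)[OF R] e(4) second_moment_def[symmetric])
      also have "\<dots> = (2 * q * ?m * (1 + 2 * (p - q - 1) / ?d * ((norm x)\<^sup>2 / ?s))
          + q * (p - q - 1) * e / ?s - 27 * K * ?m / sqrt ?s) / ?s"
      proof (rule collect)
        show "?s \<noteq> 0" "?d \<noteq> 0" "sqrt ?s \<noteq> 0" using s by simp_all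
      qed
      finally have expand: "(LINT z|M. ?L z) = (2 * q * ?m * (1 + 2 * (p - q - 1) / ?d * ((norm x)\<^sup>2 / ?s))
          + q * (p - q - 1) * e / ?s - 27 * K * ?m / sqrt ?s) / ?s" .
      have "q * ?m * k0 / ?s \<le> (2 * q * ?m * k0 - B / r) / ?s"
      proof (rule divide_right_mono)
        have "2 * q * ?m * k0 = q * ?m * k0 + q * ?m * k0" by simp
        then show "q * ?m * k0 \<le> 2 * q * ?m * k0 - B / r" using Br by linarith
      qed (use s in simp)
      also have "\<dots> \<le> (LINT z|M. ?L z)" unfolding expand
      proof (rule divide_right_mono)
        have th: "0 \<le> (norm x)\<^sup>2 / ?s" "(norm x)\<^sup>2 / ?s \<le> 1" using R s by simp_all
        have "k0 \<le> 1 + 2 * (p - q - 1) / ?d * ((norm x)\<^sup>2 / ?s)"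
        proof (cases "0 \<le> p - q - 1")
          case True
          then have "0 \<le> 2 * (p - q - 1) / ?d * ((norm x)\<^sup>2 / ?s)"
            by (intro mult_nonneg_nonneg th(1)) simp
          then show ?thesis by (simp add: k0_def)
        next
          case False
          then have "2 * (p - q - 1) / ?d * 1 \<le> 2 * (p - q - 1) / ?d * ((norm x)\<^sup>2 / ?s)"
            by (intro mult_left_mono_neg th(2)) (simp add: divide_nonpos_pos)
          then show ?thesis by (simp add: k0_def)
        qed
        then have 1: "2 * q * ?m * k0 \<le> 2 * q * ?m * (1 + 2 * (p - q - 1) / ?d * ((norm x)\<^sup>2 / ?s))"
          using q m by (intro mult_left_mono) auto
        have "- (q * (p - q - 1) * e / ?s) \<le> q * \<bar>p - q - 1\<bar> * ?m / r"
        proof -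
          have "- (q * (p - q - 1) * e / ?s) \<le> \<bar>q * (p - q - 1) * e / ?s\<bar>" using abs_ge_minus_self by blast
          also have "\<dots> = q * \<bar>p - q - 1\<bar> * e / ?s" using q e s by (simp add: abs_mult)
          also have "\<dots> \<le> q * \<bar>p - q - 1\<bar> * ?m / r"
            using q e r r_s m by (intro frac_le mult_left_mono) auto
          finally show ?thesis .
        qed
        moreover have "27 * K * ?m / sqrt ?s \<le> 27 * K * ?m / r"
          using K m r root by (intro frac_le) auto
        moreover have "B / r = q * \<bar>p - q - 1\<bar> * ?m / r + 27 * K * ?m / r"
          by (simp add: B_def distrib_right add_divide_distrib)
        ultimately show "2 * q * ?m * k0 - B / r \<le> 2 * q * ?m * (1 + 2 * (p - q - 1) / ?d * ((norm x)\<^sup>2 / ?s))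
          + q * (p - q - 1) * e / ?s - 27 * K * ?m / sqrt ?s" using 1 by linarith
        show "0 \<le> ?s" using s by simp
      qed
      finally show ?thesis .
    qed
    also have "\<dots> \<le> (LINT z|M. (1 - (1 + ?t z) powr (- q)) * (1 + (1 + ?t z) powr p))"
    proof (rule integral_mono_AE)
      show "integrable M ?L"
        by (intro Bochner_Integration.integrable_diff Bochner_Integration.integrable_add intL)
      have "(1 - (1 + ?t z) powr (- q)) * (1 + (1 + ?t z) powr p)
        = 1 + (1 + ?t z) powr p - (1 + ?t z) powr (- q) - (1 + ?t z) powr (- q) * (1 + ?t z) powr p" for z
        by (simp add: algebra_simps)
      then show "integrable M (\<lambda>z. (1 - (1 + ?t z) powr (- q)) * (1 + (1 + ?t z) powr p))"
        using integrable_powr_rel_incr[OF R] by (simp del: powr_add)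
      show "AE z in M. ?L z \<le> (1 - (1 + ?t z) powr (- q)) * (1 + (1 + ?t z) powr p)"
        using unit_ball
      proof (rule eventually_mono)
        fix z :: 'a assume z: "norm z < 1"
        have "\<bar>?t z\<bar> ^ 3 \<le> (3 * norm z / sqrt ?s) ^ 3"
          by (rule power_mono[OF rel_incr_bound(1)[OF R z]]) simp
        also have "\<dots> = 27 * (norm z) ^ 3 / (?s * sqrt ?s)"
          using s by (simp add: power_divide power_mult_distrib power3_eq_cube)
        also have "\<dots> \<le> 27 * (norm z)\<^sup>2 / (?s * sqrt ?s)"
        proof (intro divide_right_mono mult_left_mono)
          show "(norm z) ^ 3 \<le> (norm z)\<^sup>2" using z by (intro power_decreasing) auto
        qed (use s in auto)
        finally have "K * \<bar>?t z\<bar> ^ 3 \<le> K * (27 * (norm z)\<^sup>2 / (?s * sqrt ?s))"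
          by (intro mult_left_mono K)
        then show "?L z \<le> (1 - (1 + ?t z) powr (- q)) * (1 + (1 + ?t z) powr p)"
          using K(2)[OF rel_incr_bound(2)[OF R z, of x]] by (simp add: mult.commute mult.left_commute)
      qed
    qed
    finally show "q * ?m * k0 / ?s \<le> (LINT z|M. (1 - (1 + ?t z) powr (- q)) * (1 + (1 + ?t z) powr p))" .
  qed
qed

section \<open>The Hardy inequality\<close>

text \<open>
  The kernel \<open>M(dz) dx\<close> is reversible, by translation invariance of Lebesgue measure and symmetry of \<open>M\<close>.
\<close>

lemma nn_integral_exchange:
  fixes F :: "'a \<times> 'a \<Rightarrow> ennreal"
  assumes [measurable]: "F \<in> borel_measurable (borel \<Otimes>\<^sub>M borel)"
  shows "(\<integral>\<^sup>+x. \<integral>\<^sup>+z. F (x, x + z) \<partial>M \<partial>lborel) = (\<integral>\<^sup>+x. \<integral>\<^sup>+z. F (x + z, x) \<partial>M \<partial>lborel)"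
proof -
  interpret P: pair_sigma_finite lborel M ..
  have "(\<integral>\<^sup>+x. \<integral>\<^sup>+z. F (x, x + z) \<partial>M \<partial>lborel) = (\<integral>\<^sup>+z. \<integral>\<^sup>+x. F (x, x + z) \<partial>lborel \<partial>M)"
    by (rule P.Fubini'[symmetric]) measurable
  also have "\<dots> = (\<integral>\<^sup>+z. \<integral>\<^sup>+y. F (y - z, y) \<partial>lborel \<partial>M)"
  proof (rule nn_integral_cong)
    fix z :: 'a
    have "(\<integral>\<^sup>+y. F (y - z, y) \<partial>lborel) = (\<integral>\<^sup>+y. F (y - z, y) \<partial>distr lborel borel ((+) z))"
      by (simp add: lborel_distr_plus)
    also have "\<dots> = (\<integral>\<^sup>+x. F (x, x + z) \<partial>lborel)"
      by (subst nn_integral_distr) (auto simp: add.commute)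
    finally show "(\<integral>\<^sup>+x. F (x, x + z) \<partial>lborel) = (\<integral>\<^sup>+y. F (y - z, y) \<partial>lborel)" by simp
  qed
  also have "\<dots> = (\<integral>\<^sup>+y. \<integral>\<^sup>+z. F (y - z, y) \<partial>M \<partial>lborel)"
    by (rule P.Fubini') measurable
  also have "\<dots> = (\<integral>\<^sup>+y. \<integral>\<^sup>+z. F (y + z, y) \<partial>M \<partial>lborel)"
  proof (rule nn_integral_cong)
    fix y :: 'a
    show "(\<integral>\<^sup>+z. F (y - z, y) \<partial>M) = (\<integral>\<^sup>+z. F (y + z, y) \<partial>M)"
      using nn_integral_uminus[of "\<lambda>z. F (y + z, y)"] by simp
  qed
  finally show ?thesis .
qed

text \<open>
  With \<open>\<phi> = s powr (- q)\<close> and \<open>r = \<phi> (x + z) / \<phi> x\<close>, the inequality \<open>(a - b)\<^sup>2 + r a\<^sup>2 + b\<^sup>2 / r \<ge> a\<^sup>2 + b\<^sup>2\<close> is integrated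
  over all jumps. By reversibility the two terms with \<open>r\<close> have the same integral, as have the two on the right.
  The drift bound shows that the former are smaller by the weighted square integral of \<open>u\<close>. Finiteness of the
  integral of \<open>u\<^sup>2 s powr p\<close> allows the terms with \<open>r\<close> to be cancelled; it also avoids any signed integral.
\<close>

lemma radial_Hardy:
  assumes p: "0 < 2 * p + real DIM('a) - 2" and m: "0 < second_moment"
  obtains R \<kappa> where "1 \<le> R" "0 < \<kappa>"
    "\<And>u. u \<in> borel_measurable borel \<Longrightarrow>
      (\<integral>\<^sup>+x. ennreal ((u x)\<^sup>2 * (R + (norm x)\<^sup>2) powr p) \<partial>lborel) < \<infinity> \<Longrightarrow>
      (\<integral>\<^sup>+x. ennreal (\<kappa> * ((u x)\<^sup>2 * (R + (norm x)\<^sup>2) powr (p - 1))) \<partial>lborel)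
      \<le> (\<integral>\<^sup>+x. \<integral>\<^sup>+z. ennreal ((u x - u (x + z))\<^sup>2 *
            ((R + (norm x)\<^sup>2) powr p + (R + (norm (x + z))\<^sup>2) powr p)) \<partial>M \<partial>lborel)"
proof -
  \<comment> \<open>This choice leaves \<open>d + 2 (p - q - 1) = (d + 2 p - 2) / 2 > 0\<close>.\<close>
  define q where "q = (2 * p + real DIM('a) - 2) / 4"
  have q: "0 < q" using p by (simp add: q_def)
  have "0 < real DIM('a) + 2 * (p - q - 1)" using p unfolding q_def by (simp add: field_simps)
  then obtain R \<kappa> where R: "36 \<le> R" and \<kappa>: "0 < \<kappa>" and drift: "\<And>x. \<kappa> / (R + (norm x)\<^sup>2)
      \<le> (LINT z|M. (1 - (1 + rel_incr R x z) powr (- q)) * (1 + (1 + rel_incr R x z) powr p))"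
    using drift_bound[OF q _ m] by blast
  define s where "s x = R + (norm x)\<^sup>2" for x :: 'a
  have s: "36 \<le> s x" for x using R by (simp add: s_def add_increasing2)
  have s_pos: "0 < s x" for x using s[of x] by simp
  have [measurable]: "s \<in> borel_measurable borel" unfolding s_def[abs_def] by measurable
  let ?t = "rel_incr R"
  have s_add: "s (x + z) = s x * (1 + ?t x z)" for x z
    using shifted_square[of R x z] R by (simp add: s_def)
  have t_pos: "0 < 1 + ?t x z" for x z
    using s_add[of x z] s_pos[of x] s_pos[of "x + z"] by (simp add: zero_less_mult_iff)
  define b where "b x y = s x powr p + s y powr p" for x y :: 'a
  define \<rho> where "\<rho> x y = (s y powr (- q) / s x powr (- q)) * b x y" for x y :: 'a
  have b_pos: "0 < b x y" for x y using s_pos[of x] s_pos[of y] by (simp add: b_def add_pos_pos)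
  have \<rho>_pos: "0 < \<rho> x y" for x y using s_pos[of x] s_pos[of y] b_pos[of x y] by (simp add: \<rho>_def)
  have s_powr: "s (x + z) powr a = s x powr a * (1 + ?t x z) powr a" for x z a
    unfolding s_add by (rule powr_mult)
  have b_t: "b x (x + z) = s x powr p * (1 + (1 + ?t x z) powr p)" for x z
    by (simp add: b_def s_powr distrib_left)
  have \<rho>_t: "\<rho> x (x + z) = s x powr p * ((1 + ?t x z) powr (- q) * (1 + (1 + ?t x z) powr p))" for x z
    unfolding \<rho>_def b_t s_powr using s_pos[of x] by simp
  have [measurable]: "(\<lambda>x. b (f x) (g x)) \<in> borel_measurable N" "(\<lambda>x. \<rho> (f x) (g x)) \<in> borel_measurable N"
    if [measurable]: "f \<in> borel_measurable N" "g \<in> borel_measurable N" for f g :: "'b \<Rightarrow> 'a" and N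
    unfolding b_def \<rho>_def by measurable
  have int: "integrable M (\<lambda>z. b x (x + z))" "integrable M (\<lambda>z. \<rho> x (x + z))" for x
    using integrable_powr_rel_incr[OF R, of x] by (auto simp: b_t \<rho>_t distrib_left)
  \<comment> \<open>The supersolution property, integrated over the jumps out of one point.\<close>
  have super: "\<kappa> * s x powr (p - 1) + (LINT z|M. \<rho> x (x + z)) \<le> (LINT z|M. b x (x + z))" for x
  proof -
    have "\<kappa> * s x powr (p - 1) = s x powr p * (\<kappa> / s x)"
      using s_pos[of x] by (simp add: powr_diff)
    also have "\<dots> \<le> s x powr p * (LINT z|M. (1 - (1 + ?t x z) powr (- q)) * (1 + (1 + ?t x z) powr p))"
      using drift[of x] by (intro mult_left_mono) (simp_all add: s_def)
    also have "\<dots> = (LINT z|M. b x (x + z) - \<rho> x (x + z))"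
      unfolding b_t \<rho>_t integral_mult_right_zero[symmetric]
      by (intro Bochner_Integration.integral_cong refl) (simp add: algebra_simps)
    also have "\<dots> = (LINT z|M. b x (x + z)) - (LINT z|M. \<rho> x (x + z))"
      by (rule Bochner_Integration.integral_diff[OF int])
    finally show ?thesis by simp
  qed
  obtain c0 where c0: "0 \<le> c0" "\<And>x. (LINT z|M. \<rho> x (x + z)) \<le> c0 * s x powr p"
  proof
    let ?c = "2 powr \<bar>- q\<bar> * (1 + 2 powr \<bar>p\<bar>)"
    show "0 \<le> ?c * measure M (space M)" by simp
    fix x
    have "(LINT z|M. \<rho> x (x + z)) \<le> (LINT z|M. s x powr p * ?c)"
    proof (rule integral_mono_AE[OF int(2)])
      show "AE z in M. \<rho> x (x + z) \<le> s x powr p * ?c"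
        using unit_ball
      proof (rule eventually_mono)
        fix z :: 'a assume "norm z < 1"
        note t = rel_incr_bound(2)[OF R this, of x]
        show "\<rho> x (x + z) \<le> s x powr p * ?c" unfolding \<rho>_t
          by (intro mult_left_mono mult_mono add_left_mono powr_le_two_powr[OF t]) auto
      qed
    qed simp
    then show "(LINT z|M. \<rho> x (x + z)) \<le> ?c * measure M (space M) * s x powr p"
      by (simp add: mult.commute mult.left_commute)
  qed
  show ?thesis
  proof (rule that[of R \<kappa>])
    fix u :: "'a \<Rightarrow> real" assume [measurable]: "u \<in> borel_measurable borel"
      and fin: "(\<integral>\<^sup>+x. ennreal ((u x)\<^sup>2 * (R + (norm x)\<^sup>2) powr p) \<partial>lborel) < \<infinity>"
    let ?W = "\<integral>\<^sup>+x. ennreal (\<kappa> * ((u x)\<^sup>2 * s x powr (p - 1))) \<partial>lborel"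
    let ?X = "\<integral>\<^sup>+x. \<integral>\<^sup>+z. ennreal ((u x - u (x + z))\<^sup>2 * b x (x + z)) \<partial>M \<partial>lborel"
    let ?Y = "\<integral>\<^sup>+x. \<integral>\<^sup>+z. ennreal ((u x)\<^sup>2 * \<rho> x (x + z)) \<partial>M \<partial>lborel"
    let ?Y' = "\<integral>\<^sup>+x. \<integral>\<^sup>+z. ennreal ((u (x + z))\<^sup>2 * \<rho> (x + z) x) \<partial>M \<partial>lborel"
    let ?Z = "\<integral>\<^sup>+x. \<integral>\<^sup>+z. ennreal ((u x)\<^sup>2 * b x (x + z)) \<partial>M \<partial>lborel"
    let ?Z' = "\<integral>\<^sup>+x. \<integral>\<^sup>+z. ennreal ((u (x + z))\<^sup>2 * b (x + z) x) \<partial>M \<partial>lborel"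
    have Y: "?Y = ?Y'"
      using nn_integral_exchange[of "\<lambda>(x, y). ennreal ((u x)\<^sup>2 * \<rho> x y)"] by simp
    have Z: "?Z = ?Z'"
      using nn_integral_exchange[of "\<lambda>(x, y). ennreal ((u x)\<^sup>2 * b x y)"] by simp
    have inner: "(\<integral>\<^sup>+z. ennreal ((u x)\<^sup>2 * \<rho> x (x + z)) \<partial>M) = ennreal ((u x)\<^sup>2 * (LINT z|M. \<rho> x (x + z)))"
      "(\<integral>\<^sup>+z. ennreal ((u x)\<^sup>2 * b x (x + z)) \<partial>M) = ennreal ((u x)\<^sup>2 * (LINT z|M. b x (x + z)))" for x
      unfolding integral_mult_right_zero[symmetric]
      by (intro nn_integral_eq_integral integrable_mult_right int AE_I2 mult_nonneg_nonneg
            zero_le_power2 less_imp_le[OF \<rho>_pos] less_imp_le[OF b_pos])+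
    have Y_fin: "?Y < \<infinity>"
    proof -
      have "?Y \<le> (\<integral>\<^sup>+x. ennreal c0 * ennreal ((u x)\<^sup>2 * (R + (norm x)\<^sup>2) powr p) \<partial>lborel)"
        unfolding inner
      proof (rule nn_integral_mono)
        fix x :: 'a
        have "(u x)\<^sup>2 * (LINT z|M. \<rho> x (x + z)) \<le> (u x)\<^sup>2 * (c0 * s x powr p)"
          by (rule mult_left_mono[OF c0(2)]) simp
        then show "ennreal ((u x)\<^sup>2 * (LINT z|M. \<rho> x (x + z)))
            \<le> ennreal c0 * ennreal ((u x)\<^sup>2 * (R + (norm x)\<^sup>2) powr p)"
          using c0(1) by (simp add: ennreal_mult'[symmetric] s_def ennreal_leI mult.left_commute)
      qed
      also have "\<dots> = ennreal c0 * (\<integral>\<^sup>+x. ennreal ((u x)\<^sup>2 * (R + (norm x)\<^sup>2) powr p) \<partial>lborel)"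
        by (rule nn_integral_cmult) measurable
      also have "\<dots> < \<infinity>" using fin by (simp add: ennreal_mult_less_top)
      finally show ?thesis .
    qed
    have "?W + ?Y \<le> ?Z"
    proof -
      have "?W + ?Y = (\<integral>\<^sup>+x. ennreal (\<kappa> * ((u x)\<^sup>2 * s x powr (p - 1)))
          + (\<integral>\<^sup>+z. ennreal ((u x)\<^sup>2 * \<rho> x (x + z)) \<partial>M) \<partial>lborel)"
        by (rule nn_integral_add[symmetric]) measurable
      also have "\<dots> \<le> ?Z"
      proof (rule nn_integral_mono)
        fix x :: 'a
        have nn: "0 \<le> (LINT z|M. \<rho> x (x + z))"
          by (intro integral_nonneg_AE AE_I2 less_imp_le[OF \<rho>_pos])
        have "(u x)\<^sup>2 * (\<kappa> * s x powr (p - 1) + (LINT z|M. \<rho> x (x + z))) \<le> (u x)\<^sup>2 * (LINT z|M. b x (x + z))"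
          by (rule mult_left_mono[OF super]) simp
        then have "ennreal (\<kappa> * ((u x)\<^sup>2 * s x powr (p - 1)) + (u x)\<^sup>2 * (LINT z|M. \<rho> x (x + z)))
            \<le> ennreal ((u x)\<^sup>2 * (LINT z|M. b x (x + z)))"
          by (intro ennreal_leI) (simp add: distrib_left mult.left_commute)
        then show "ennreal (\<kappa> * ((u x)\<^sup>2 * s x powr (p - 1))) + (\<integral>\<^sup>+z. ennreal ((u x)\<^sup>2 * \<rho> x (x + z)) \<partial>M)
            \<le> (\<integral>\<^sup>+z. ennreal ((u x)\<^sup>2 * b x (x + z)) \<partial>M)"
          unfolding inner using \<kappa> nn by (simp add: ennreal_plus)
      qed
      finally show ?thesis .
    qed
    moreover have "?Z + ?Z' \<le> ?X + (?Y + ?Y')"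
    proof -
      have "?Z + ?Z' = (\<integral>\<^sup>+x. \<integral>\<^sup>+z. ennreal ((u x)\<^sup>2 * b x (x + z)) + ennreal ((u (x + z))\<^sup>2 * b (x + z) x) \<partial>M \<partial>lborel)"
        by (subst nn_integral_add[symmetric], measurable, intro nn_integral_cong nn_integral_add[symmetric]) measurable
      also have "\<dots> \<le> (\<integral>\<^sup>+x. \<integral>\<^sup>+z. ennreal ((u x - u (x + z))\<^sup>2 * b x (x + z)) +
          (ennreal ((u x)\<^sup>2 * \<rho> x (x + z)) + ennreal ((u (x + z))\<^sup>2 * \<rho> (x + z) x)) \<partial>M \<partial>lborel)"
      proof (intro nn_integral_mono)
        fix x z :: 'a
        let ?y = "x + z"
        define r where "r = s ?y powr (- q) / s x powr (- q)"
        have r: "0 < r" using s_pos[of x] s_pos[of ?y] by (simp add: r_def)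
        have \<rho>r: "\<rho> x ?y = r * b x ?y" "\<rho> ?y x = (1 / r) * b x ?y"
          by (simp_all add: \<rho>_def r_def b_def add.commute)
        have "0 \<le> (u x * r - u ?y)\<^sup>2 / r" using r by simp
        also have "\<dots> = (u x)\<^sup>2 * r + (u ?y)\<^sup>2 * (1 / r) - 2 * u x * u ?y"
          using r by (simp add: field_simps power2_eq_square)
        finally have "(u x)\<^sup>2 + (u ?y)\<^sup>2 \<le> (u x - u ?y)\<^sup>2 + ((u x)\<^sup>2 * r + (u ?y)\<^sup>2 * (1 / r))"
          by (simp add: power2_diff)
        from mult_right_mono[OF this less_imp_le[OF b_pos[of x ?y]]]
        have "(u x)\<^sup>2 * b x ?y + (u ?y)\<^sup>2 * b ?y x
          \<le> (u x - u ?y)\<^sup>2 * b x ?y + ((u x)\<^sup>2 * \<rho> x ?y + (u ?y)\<^sup>2 * \<rho> ?y x)"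
          unfolding \<rho>r by (simp add: distrib_right mult.assoc b_def add.commute)
        then show "ennreal ((u x)\<^sup>2 * b x ?y) + ennreal ((u ?y)\<^sup>2 * b ?y x)
          \<le> ennreal ((u x - u ?y)\<^sup>2 * b x ?y) + (ennreal ((u x)\<^sup>2 * \<rho> x ?y) + ennreal ((u ?y)\<^sup>2 * \<rho> ?y x))"
          using less_imp_le[OF b_pos] less_imp_le[OF \<rho>_pos]
          by (simp add: ennreal_plus[symmetric] ennreal_leI del: ennreal_plus)
      qed
      also have "\<dots> = ?X + (?Y + ?Y')"
        by (simp add: nn_integral_add)
      finally show ?thesis .
    qed
    ultimately have "(?W + ?Y) + (?W + ?Y) \<le> ?X + (?Y + ?Y)"
      unfolding Y[symmetric] Z[symmetric] by (meson add_mono order_trans)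
    then have "(?Y + ?Y) + (?W + ?W) \<le> (?Y + ?Y) + ?X" by (simp add: ac_simps)
    then have "?W + ?W \<le> ?X" using Y_fin by (auto simp add: ennreal_add_left_cancel_le)
    then have "?W \<le> ?X" by (rule order_trans[rotated]) simp
    then show "(\<integral>\<^sup>+x. ennreal (\<kappa> * ((u x)\<^sup>2 * (R + (norm x)\<^sup>2) powr (p - 1))) \<partial>lborel)
      \<le> (\<integral>\<^sup>+x. \<integral>\<^sup>+z. ennreal ((u x - u (x + z))\<^sup>2 *
            ((R + (norm x)\<^sup>2) powr p + (R + (norm (x + z))\<^sup>2) powr p)) \<partial>M \<partial>lborel)"
      by (simp add: s_def b_def)
  qed (use R \<kappa> in auto)
qed

end

section \<open>Comparison of the jump form with a translation invariant one\<close>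

lemma kernel_section_measurable:
  fixes K :: "'a::euclidean_space \<Rightarrow> 'a measure" and F :: "'a \<times> 'a \<Rightarrow> ennreal"
  assumes K: "sets (K x) = sets borel" and F: "F \<in> borel_measurable borel"
  shows "(\<lambda>y. F (x, y)) \<in> borel_measurable (K x)"
proof -
  have [measurable]: "F \<in> borel_measurable (borel \<Otimes>\<^sub>M borel)"
    using F by (simp add: borel_prod)
  have "(\<lambda>y. F (x, y)) \<in> borel_measurable borel" by measurable
  then show ?thesis by (simp add: measurable_cong_sets[OF K refl])
qed

text \<open>
  Tonelli's theorem for a kernel of possibly infinite mass: the usual extension from indicators works
  because measurability of the sections of Borel sets is assumed.
\<close>

lemma kernel_measure_integral:
  fixes K :: "'a::euclidean_space \<Rightarrow> 'a measure" and F :: "'a \<times> 'a \<Rightarrow> ennreal"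
  assumes K: "\<And>x. sets (K x) = sets borel"
      "\<And>C. C \<in> sets borel \<Longrightarrow> (\<lambda>x. emeasure (K x) (Pair x -` C)) \<in> borel_measurable lebesgue"
    and F: "F \<in> borel_measurable borel"
  shows "(\<lambda>x. \<integral>\<^sup>+y. F (x, y) \<partial>K x) \<in> borel_measurable lebesgue \<and>
    (\<integral>\<^sup>+z. F z \<partial>kernel_measure K) = (\<integral>\<^sup>+x. \<integral>\<^sup>+y. F (x, y) \<partial>K x \<partial>lebesgue)"
  using F
proof (induction F rule: borel_measurable_induct)
  case (cong f g)
  then have "f = g" by auto
  with cong show ?case by simp
next
  case (set A)
  have A: "Pair x -` A \<in> sets borel" for x
  proof -
    have "A \<in> sets (borel \<Otimes>\<^sub>M borel)" unfolding borel_prod by (rule set)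
    then show ?thesis by (rule sets_Pair1)
  qed
  have "(\<integral>\<^sup>+y. indicator A (x, y) \<partial>K x) = emeasure (K x) (Pair x -` A)" for x
  proof -
    have "(\<lambda>y. indicator A (x, y) :: ennreal) = indicator (Pair x -` A)"
      by (auto simp: indicator_def)
    then show ?thesis using A[of x] K(1)[of x] by simp
  qed
  then show ?case using K(2)[OF set] emeasure_kernel_measure[OF K set] set by simp
next
  case (mult u c)
  have m: "(\<lambda>y. u (x, y)) \<in> borel_measurable (K x)" for x
    by (rule kernel_section_measurable[OF K(1) mult(2)])
  have "u \<in> borel_measurable (kernel_measure K)"
    using mult(2) by (simp add: measurable_cong_sets[OF sets_kernel_measure refl])
  moreover have [measurable]: "(\<lambda>x. \<integral>\<^sup>+y. u (x, y) \<partial>K x) \<in> borel_measurable lebesgue"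
    using mult.IH by blast
  ultimately show ?case using mult.IH
    by (simp add: nn_integral_cmult[OF m] nn_integral_cmult borel_measurable_times_ennreal)
next
  case (add u v)
  have m: "(\<lambda>y. u (x, y)) \<in> borel_measurable (K x)" "(\<lambda>y. v (x, y)) \<in> borel_measurable (K x)" for x
    by (rule kernel_section_measurable[OF K(1)]; fact)+
  have "u \<in> borel_measurable (kernel_measure K)" "v \<in> borel_measurable (kernel_measure K)"
    using add.hyps by (simp_all add: measurable_cong_sets[OF sets_kernel_measure refl])
  moreover have [measurable]: "(\<lambda>x. \<integral>\<^sup>+y. u (x, y) \<partial>K x) \<in> borel_measurable lebesgue"
      "(\<lambda>x. \<integral>\<^sup>+y. v (x, y) \<partial>K x) \<in> borel_measurable lebesgue"
    using add.IH by blast+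
  ultimately show ?case using add.IH
    by (simp add: nn_integral_add[OF m(2,1)] nn_integral_add borel_measurable_add)
next
  case (seq U)
  have m: "(\<lambda>y. U i (x, y)) \<in> borel_measurable (K x)" for i x
    by (rule kernel_section_measurable[OF K(1)]; fact)
  have m': "U i \<in> borel_measurable (kernel_measure K)" for i
    using seq.hyps by (simp add: measurable_cong_sets[OF sets_kernel_measure refl])
  have [measurable]: "(\<lambda>x. \<integral>\<^sup>+y. U i (x, y) \<partial>K x) \<in> borel_measurable lebesgue" for i
    using seq.IH by blast
  have inc: "incseq (\<lambda>i y. U i (x, y))" for x
    using seq.hyps by (auto simp: incseq_def le_fun_def)
  have ptw: "(SUP i. U i) z = (SUP i. U i z)" for z by (rule SUP_apply)
  have inner: "(\<integral>\<^sup>+y. (SUP i. U i) (x, y) \<partial>K x) = (SUP i. \<integral>\<^sup>+y. U i (x, y) \<partial>K x)" for x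
    unfolding ptw by (rule nn_integral_monotone_convergence_SUP[OF inc m])
  have "(\<integral>\<^sup>+z. (SUP i. U i) z \<partial>kernel_measure K) = (SUP i. \<integral>\<^sup>+z. U i z \<partial>kernel_measure K)"
    unfolding ptw by (rule nn_integral_monotone_convergence_SUP[OF \<open>incseq U\<close> m'])
  also have "\<dots> = (SUP i. \<integral>\<^sup>+x. \<integral>\<^sup>+y. U i (x, y) \<partial>K x \<partial>lebesgue)"
    using seq.IH by simp
  also have "\<dots> = (\<integral>\<^sup>+x. (SUP i. \<integral>\<^sup>+y. U i (x, y) \<partial>K x) \<partial>lebesgue)"
  proof (rule nn_integral_monotone_convergence_SUP[symmetric])
    show "incseq (\<lambda>i x. \<integral>\<^sup>+y. U i (x, y) \<partial>K x)"
      using \<open>incseq U\<close> by (auto simp: incseq_def le_fun_def intro!: nn_integral_mono)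
  qed measurable
  finally have eq: "(\<integral>\<^sup>+z. (SUP i. U i) z \<partial>kernel_measure K)
      = (\<integral>\<^sup>+x. (SUP i. \<integral>\<^sup>+y. U i (x, y) \<partial>K x) \<partial>lebesgue)" .
  show ?case unfolding inner
  proof (intro conjI)
    show "(\<lambda>x. SUP i. \<integral>\<^sup>+y. U i (x, y) \<partial>K x) \<in> borel_measurable lebesgue" by measurable
  qed (rule eq)
qed

lemma jump_kernel_sections:
  fixes J0 :: "'a::euclidean_space \<Rightarrow> 'a measure"
  assumes J0: "borel_kernel J0" and a: "a1 \<in> borel_measurable borel" "a2 \<in> borel_measurable borel"
  shows "sets (jump_kernel a1 a2 J0 x) = sets borel"
    and "C \<in> sets borel \<Longrightarrow> (\<lambda>x. emeasure (jump_kernel a1 a2 J0 x) (Pair x -` C)) \<in> borel_measurable lebesgue"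
    and "F \<in> borel_measurable borel \<Longrightarrow> (\<integral>\<^sup>+y. F (x, y) \<partial>jump_kernel a1 a2 J0 x)
      = (\<integral>\<^sup>+y. ennreal (jump_coeff a1 a2 x y) * F (x, y) \<partial>J0 x)"
proof -
  have K: "sets (J0 x) = sets borel" for x using J0 by (simp add: borel_kernel_def)
  have K': "(\<lambda>x. emeasure (J0 x) (Pair x -` C)) \<in> borel_measurable lebesgue" if "C \<in> sets borel" for C
    using J0 that by (simp add: borel_kernel_def)
  show sets: "sets (jump_kernel a1 a2 J0 x) = sets borel" for x by (simp add: jump_kernel_def K)
  have c: "(\<lambda>(x, y). ennreal (jump_coeff a1 a2 x y)) \<in> borel_measurable borel"
  proof -
    have [measurable]: "a1 \<in> borel_measurable borel" "a2 \<in> borel_measurable borel" by fact+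
    have "(\<lambda>(x, y). ennreal (jump_coeff a1 a2 x y)) \<in> borel_measurable (borel \<Otimes>\<^sub>M borel)"
      unfolding jump_coeff_def by measurable
    then show ?thesis by (simp add: borel_prod)
  qed
  have cx: "(\<lambda>y. ennreal (jump_coeff a1 a2 x y)) \<in> borel_measurable (J0 x)" for x
    using kernel_section_measurable[OF K c] by simp
  show int: "(\<integral>\<^sup>+y. F (x, y) \<partial>jump_kernel a1 a2 J0 x)
      = (\<integral>\<^sup>+y. ennreal (jump_coeff a1 a2 x y) * F (x, y) \<partial>J0 x)"
    if "F \<in> borel_measurable borel" for F and x
    unfolding jump_kernel_def by (rule nn_integral_density[OF cx kernel_section_measurable[OF K that]])
  show "(\<lambda>x. emeasure (jump_kernel a1 a2 J0 x) (Pair x -` C)) \<in> borel_measurable lebesgue"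
    if C: "C \<in> sets borel"
  proof -
    have ind: "indicator C \<in> borel_measurable (borel :: ('a \<times> 'a) measure)" using C by simp
    have sec: "Pair x -` C \<in> sets borel" for x
    proof -
      have "C \<in> sets (borel \<Otimes>\<^sub>M borel)" unfolding borel_prod by (rule C)
      then show ?thesis by (rule sets_Pair1)
    qed
    have "emeasure (jump_kernel a1 a2 J0 x) (Pair x -` C)
      = (\<integral>\<^sup>+y. ennreal (jump_coeff a1 a2 x y) * indicator C (x, y) \<partial>J0 x)" for x
    proof -
      have "(\<lambda>y. indicator C (x, y) :: ennreal) = indicator (Pair x -` C)"
        by (auto simp: indicator_def)
      then show ?thesis using int[OF ind, of x] sec[of x] sets[of x] by simp
    qed
    moreover have "(\<lambda>z. (case z of (x, y) \<Rightarrow> ennreal (jump_coeff a1 a2 x y)) * indicator C z)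
        \<in> borel_measurable borel"
      by (intro borel_measurable_times_ennreal c ind)
    from kernel_measure_integral[OF K K' this, THEN conjunct1]
    have "(\<lambda>x. \<integral>\<^sup>+y. ennreal (jump_coeff a1 a2 x y) * indicator C (x, y) \<partial>J0 x) \<in> borel_measurable lebesgue"
      by simp
    ultimately show ?thesis by simp
  qed
qed

text \<open>
  The translate of \<open>\<nu>\<close> by \<open>x\<close> is a measure below \<open>J0 x\<close>, and on small jumps the coefficient is \<open>a1 x + a1 y\<close>.
\<close>

lemma small_jump_energy_ge:
  fixes \<nu> :: "'a::euclidean_space measure" and J0 :: "'a \<Rightarrow> 'a measure"
  assumes J0: "borel_kernel J0" and a: "a1 \<in> borel_measurable borel" "a2 \<in> borel_measurable borel"
    and nu: "sets \<nu> = sets borel"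
    and J0_nu: "\<And>x A. A \<in> sets borel \<Longrightarrow> emeasure \<nu> A \<le> emeasure (J0 x) ((\<lambda>z. x + z) ` A)"
    and u: "u \<in> borel_measurable borel"
  shows "(\<integral>\<^sup>+x. \<integral>\<^sup>+z. ennreal ((u x - u (x + z))\<^sup>2 * (a1 x + a1 (x + z))) * indicator {z. norm z < 1} z \<partial>\<nu> \<partial>lborel)
    \<le> (\<integral>\<^sup>+(x, y). ennreal ((u x - u y)\<^sup>2) \<partial>small_jump_measure (kernel_measure (jump_kernel a1 a2 J0)))"
proof -
  let ?J = "jump_kernel a1 a2 J0"
  have [measurable]: "u \<in> borel_measurable borel" "a1 \<in> borel_measurable borel" "a2 \<in> borel_measurable borel"
    by fact+
  have K: "sets (J0 x) = sets borel" for x using J0 by (simp add: borel_kernel_def)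
  define D where "D = {(x::'a, y). norm (x - y) < 1}"
  have D: "D \<in> sets borel"
  proof (rule borel_open)
    have "open {z::'a \<times> 'a. norm (fst z - snd z) < 1}"
      by (intro open_Collect_less continuous_intros)
    then show "open D" by (simp add: D_def case_prod_unfold)
  qed
  have iD: "indicator D \<in> borel_measurable (borel :: ('a \<times> 'a) measure)" using D by simp
  have usq: "(\<lambda>(x, y). ennreal ((u x - u y)\<^sup>2)) \<in> borel_measurable borel"
  proof -
    have "(\<lambda>(x, y). ennreal ((u x - u y)\<^sup>2)) \<in> borel_measurable (borel \<Otimes>\<^sub>M borel)" by measurable
    then show ?thesis by (simp add: borel_prod)
  qed
  let ?F = "\<lambda>w. indicator D w * (case w of (x, y) \<Rightarrow> ennreal ((u x - u y)\<^sup>2))"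
  have F: "?F \<in> borel_measurable borel" by (intro borel_measurable_times_ennreal iD usq)
  have "(\<integral>\<^sup>+(x, y). ennreal ((u x - u y)\<^sup>2) \<partial>small_jump_measure (kernel_measure ?J))
      = (\<integral>\<^sup>+w. ?F w \<partial>kernel_measure ?J)"
    unfolding small_jump_measure_def D_def[symmetric]
    by (rule nn_integral_density)
       (use iD usq in \<open>simp_all only: measurable_cong_sets[OF sets_kernel_measure refl]\<close>)
  also have "\<dots> = (\<integral>\<^sup>+x. \<integral>\<^sup>+y. ?F (x, y) \<partial>?J x \<partial>lebesgue)"
    using kernel_measure_integral[OF jump_kernel_sections(1,2)[OF J0 a] F] by simp
  also have "\<dots> = (\<integral>\<^sup>+x. \<integral>\<^sup>+y. ennreal (jump_coeff a1 a2 x y) * ?F (x, y) \<partial>J0 x \<partial>lebesgue)"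
    by (intro nn_integral_cong jump_kernel_sections(3)[OF J0 a F])
  also have "\<dots> \<ge> (\<integral>\<^sup>+x. \<integral>\<^sup>+z. ennreal ((u x - u (x + z))\<^sup>2 * (a1 x + a1 (x + z)))
      * indicator {z. norm z < 1} z \<partial>\<nu> \<partial>lebesgue)"
  proof (rule nn_integral_mono)
    fix x :: 'a
    let ?G = "\<lambda>y. ennreal (jump_coeff a1 a2 x y) * ?F (x, y)"
    have shift: "(+) x \<in> measurable \<nu> borel" by (simp add: measurable_cong_sets[OF nu refl])
    have "distr \<nu> borel ((+) x) \<le> J0 x"
      unfolding le_measure[of "distr \<nu> borel ((+) x)" "J0 x", unfolded sets_distr, OF K[symmetric]]
    proof (intro ballI)
      fix A :: "'a set" assume "A \<in> sets borel"
      then have A: "A \<in> sets borel" "(+) x -` A \<in> sets borel"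
        using measurable_sets[of "(+) x" borel borel A] by auto
      have sp: "space \<nu> = UNIV" using sets_eq_imp_space_eq[OF nu] by simp
      have "(\<lambda>z. x + z) ` ((+) x -` A) = A"
        by (force intro: image_eqI[of _ _ "y - x" for y])
      then show "emeasure (distr \<nu> borel ((+) x)) A \<le> emeasure (J0 x) A"
        using J0_nu[OF A(2), of x] emeasure_distr[OF shift A(1)] sp by simp
    qed
    then have "(\<integral>\<^sup>+y. ?G y \<partial>distr \<nu> borel ((+) x)) \<le> (\<integral>\<^sup>+y. ?G y \<partial>J0 x)"
      by (intro nn_integral_mono_measure) (simp_all add: K)
    moreover have "(\<integral>\<^sup>+y. ?G y \<partial>distr \<nu> borel ((+) x)) = (\<integral>\<^sup>+z. ?G (x + z) \<partial>\<nu>)"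
    proof (rule nn_integral_distr[OF shift])
      have Fx: "(\<lambda>y. ?F (x, y)) \<in> borel_measurable borel"
        using kernel_section_measurable[of "\<lambda>_. borel", OF _ F] by simp
      have "(\<lambda>y. ennreal (jump_coeff a1 a2 x y)) \<in> borel_measurable borel"
        unfolding jump_coeff_def by measurable
      from borel_measurable_times_ennreal[OF this Fx]
      show "?G \<in> borel_measurable (distr \<nu> borel ((+) x))" by (simp only: measurable_distr_eq1)
    qed
    moreover have "?G (x + z) = ennreal ((u x - u (x + z))\<^sup>2 * (a1 x + a1 (x + z))) * indicator {z. norm z < 1} z" for z
    proof -
      have "ennreal ((u x - u (x + z))\<^sup>2 * (a1 x + a1 (x + z)))
          = ennreal (a1 x + a1 (x + z)) * ennreal ((u x - u (x + z))\<^sup>2)"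
        by (subst mult.commute, rule ennreal_mult'') simp
      then show ?thesis by (auto simp: D_def jump_coeff_def indicator_def)
    qed
    ultimately show "(\<integral>\<^sup>+z. ennreal ((u x - u (x + z))\<^sup>2 * (a1 x + a1 (x + z))) * indicator {z. norm z < 1} z \<partial>\<nu>)
      \<le> (\<integral>\<^sup>+y. ?G y \<partial>J0 x)" by simp
  qed
  finally show ?thesis by (simp add: nn_integral_completion)
qed

text \<open>
  The punctured unit ball is a countable union of annuli, so one of them is charged by \<open>\<nu>\<close>; away from the origin
  \<open>\<nu>\<close> is finite.
\<close>

lemma radial_annulus:
  fixes \<nu> :: "'a::euclidean_space measure"
  assumes nu: "sets \<nu> = sets borel" and rot: "rotation_invariant \<nu>"
    and levy: "(\<integral>\<^sup>+z\<in>UNIV - {0}. ennreal (min 1 ((norm z)\<^sup>2)) \<partial>\<nu>) < \<infinity>"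
    and pos: "0 < emeasure \<nu> {z. 0 < norm z \<and> norm z < 1}"
  obtains A where "A \<in> sets borel" "A \<subseteq> {z. norm z < 1}"
    "radial_measure (density \<nu> (indicator A))" "0 < radial_measure.second_moment (density \<nu> (indicator A))"
proof -
  have meas_nu: "borel_measurable \<nu> = (borel_measurable borel :: ('a \<Rightarrow> ennreal) set)"
    by (rule measurable_cong_sets[OF nu refl])
  have sp: "space \<nu> = UNIV" using sets_eq_imp_space_eq[OF nu] by simp
  define B where "B n = {z::'a. 1 / real (Suc n) \<le> norm z \<and> norm z < 1}" for n
  have B [measurable]: "B n \<in> sets borel" for n unfolding B_def by measurable
  have cover: "{z::'a. 0 < norm z \<and> norm z < 1} = (\<Union>n. B n)"
  proof -
    have "\<exists>n. 1 / real (Suc n) \<le> norm z" if "0 < norm z" for z :: 'a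
      using reals_Archimedean[OF that] by (auto simp: inverse_eq_divide intro: less_imp_le)
    moreover have "0 < norm z" if "1 / real (Suc n) \<le> norm z" for n and z :: 'a
      by (rule less_le_trans[OF _ that]) simp
    ultimately show ?thesis unfolding B_def by blast
  qed
  have "\<not> (\<forall>n. emeasure \<nu> (B n) = 0)"
  proof
    assume "\<forall>n. emeasure \<nu> (B n) = 0"
    then have "emeasure \<nu> (\<Union>n. B n) = 0" by (intro emeasure_UN_eq_0) (auto simp: nu)
    with pos show False unfolding cover by simp
  qed
  then obtain n where n: "emeasure \<nu> (B n) \<noteq> 0" by blast
  define e where "e = 1 / real (Suc n)"
  have e: "0 < e" "e \<le> 1" by (simp_all add: e_def)
  let ?M = "density \<nu> (indicator (B n))"
  have sets_M: "sets ?M = sets borel" by (simp add: nu)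
  have ind: "(indicator (B n) :: 'a \<Rightarrow> ennreal) \<in> borel_measurable \<nu>" unfolding meas_nu by simp
  have em: "emeasure ?M A = emeasure \<nu> (B n \<inter> A)" if "A \<in> sets borel" for A
    using that by (subst emeasure_density[OF ind]) (auto simp: nu indicator_inter_arith[symmetric])
  have fin: "emeasure \<nu> (B n) < \<infinity>"
  proof -
    have "ennreal (e\<^sup>2) * emeasure \<nu> (B n) = (\<integral>\<^sup>+z. ennreal (e\<^sup>2) * indicator (B n) z \<partial>\<nu>)"
      by (subst nn_integral_cmult_indicator) (auto simp: nu)
    also have "\<dots> \<le> (\<integral>\<^sup>+z\<in>UNIV - {0}. ennreal (min 1 ((norm z)\<^sup>2)) \<partial>\<nu>)"
    proof (rule nn_integral_mono)
      fix z :: 'a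
      show "ennreal (e\<^sup>2) * indicator (B n) z \<le> ennreal (min 1 ((norm z)\<^sup>2)) * indicator (UNIV - {0}) z"
      proof (cases "z \<in> B n")
        case True
        then have z: "e \<le> norm z" by (simp add: B_def e_def)
        have "e\<^sup>2 \<le> (norm z)\<^sup>2" "e\<^sup>2 \<le> 1" using z e by (simp_all add: power_mono power_le_one)
        moreover have "z \<noteq> 0" using z e by auto
        ultimately show ?thesis using True by (simp add: ennreal_leI)
      qed simp
    qed
    finally have "ennreal (e\<^sup>2) * emeasure \<nu> (B n) < \<infinity>" using levy by (rule le_less_trans)
    then show ?thesis using e by (auto simp: ennreal_mult_less_top)
  qed
  interpret radial_measure ?M
  proof (intro radial_measure.intro finite_measureI radial_measure_axioms.intro)
    show "emeasure ?M (space ?M) \<noteq> \<infinity>" using em[of UNIV] fin sp by simp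
    show "sets ?M = sets borel" by (rule sets_M)
    show "AE z in ?M. norm z < 1"
      by (subst AE_density[OF ind]) (auto simp: B_def indicator_def)
    show "rotation_invariant ?M"
      unfolding rotation_invariant_def
    proof (intro allI impI, elim conjE)
      fix R :: "'a \<Rightarrow> 'a" and A :: "'a set" assume R: "orthogonal_transformation R" and A: "A \<in> sets borel"
      obtain R' where R': "orthogonal_transformation R'" "\<And>z. R' (R z) = z" "\<And>z. R (R' z) = z"
        using orthogonal_transformation_inv[OF R] orthogonal_transformation_bij[OF R]
        by (metis bij_inv_eq_iff)
      have "R' \<in> borel_measurable borel"
        using R'(1) by (intro borel_measurable_continuous_onI)
          (simp add: linear_continuous_on linear_linear orthogonal_transformation_linear)
      then have "R' -` A \<in> sets borel" using measurable_sets[of R' borel borel A] A by simp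
      moreover have "R' -` A = R ` A" using R'(2,3) by (auto intro: rev_image_eqI)
      ultimately have RA: "R ` A \<in> sets borel" by simp
      have "B n \<inter> R ` A = R ` (B n \<inter> A)"
        by (auto simp: B_def orthogonal_transformation_norm[OF R])
      then have "emeasure ?M (R ` A) = emeasure \<nu> (R ` (B n \<inter> A))" using em[OF RA] by simp
      also have "\<dots> = emeasure \<nu> (B n \<inter> A)" using rot R A by (simp add: rotation_invariant_def)
      finally show "emeasure ?M (R ` A) = emeasure ?M A" using em[OF A] by simp
    qed
  qed
  have "0 < second_moment"
  proof -
    have int: "integrable ?M (\<lambda>z. (norm z)\<^sup>2)"
      by (rule integrable_bounded_on_ball[of _ 1]) (auto simp: power_le_one)
    have "(LINT z|?M. e\<^sup>2) \<le> (LINT z|?M. (norm z)\<^sup>2)"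
    proof (rule integral_mono_AE[OF _ int])
      show "AE z in ?M. e\<^sup>2 \<le> (norm z)\<^sup>2"
      proof (subst AE_density[OF ind], intro AE_I2 impI)
        fix z assume "0 < (indicator (B n) z :: ennreal)"
        then have "z \<in> B n" by (cases "z \<in> B n") auto
        then have "e \<le> norm z" by (simp add: B_def e_def)
        then show "e\<^sup>2 \<le> (norm z)\<^sup>2" using e by (intro power_mono) auto
      qed
    qed simp
    moreover have "0 < measure ?M UNIV"
      using em[of UNIV] n fin by (simp add: measure_def enn2real_positive_iff less_top zero_less_iff_neq_zero)
    ultimately show ?thesis using e sp by (simp add: second_moment_def) (smt (verit) mult_pos_pos zero_less_power)
  qed
  then show ?thesis
    by (intro that[of "B n"]) (use radial_measure_axioms in \<open>auto simp: B_def\<close>)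
qed

section \<open>Passage to the form closure\<close>

lemma test_function_measurable: "f \<in> test_functions \<Longrightarrow> f \<in> borel_measurable borel"
  and test_function_weighted_integral:
    "f \<in> test_functions \<Longrightarrow> continuous_on UNIV b \<Longrightarrow> (\<integral>\<^sup>+x. ennreal ((f x)\<^sup>2 * b x) \<partial>lborel) < \<infinity>"
proof -
  assume f: "f \<in> test_functions"
  have "f differentiable at x" for x
    using f unfolding test_functions_def by (auto dest!: spec[of _ "[]"])
  then have cont: "continuous_on UNIV f"
    by (meson continuous_at_imp_continuous_on differentiable_imp_continuous_within)
  then show "f \<in> borel_measurable borel" by (rule borel_measurable_continuous_onI)
  assume b: "continuous_on UNIV b"
  let ?K = "closure {x. f x \<noteq> 0}"
  have "compact ?K" using f by (simp add: test_functions_def)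
  then have "integrable lborel (\<lambda>x. indicator ?K x *\<^sub>R ((f x)\<^sup>2 * b x))"
    using continuous_on_subset[OF cont] continuous_on_subset[OF b]
    by (intro borel_integrable_compact continuous_intros) auto
  moreover have "indicator ?K x *\<^sub>R ((f x)\<^sup>2 * b x) = (f x)\<^sup>2 * b x" for x
    using closure_subset[of "{x. f x \<noteq> 0}"] by (auto simp: indicator_def)
  ultimately have "integrable lborel (\<lambda>x. (f x)\<^sup>2 * b x)" by (simp only:)
  then have "(\<integral>\<^sup>+x. ennreal (norm ((f x)\<^sup>2 * b x)) \<partial>lborel) < \<infinity>"
    by (simp add: integrable_iff_bounded)
  moreover have "(\<integral>\<^sup>+x. ennreal ((f x)\<^sup>2 * b x) \<partial>lborel) \<le> (\<integral>\<^sup>+x. ennreal (norm ((f x)\<^sup>2 * b x)) \<partial>lborel)"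
    by (intro nn_integral_mono ennreal_leI) simp
  ultimately show "(\<integral>\<^sup>+x. ennreal ((f x)\<^sup>2 * b x) \<partial>lborel) < \<infinity>" by (rule le_less_trans[rotated])
qed

text \<open>The value of the form on the diagonal, also where it is infinite.\<close>
definition energy :: "('a::euclidean_space \<times> 'a) measure \<Rightarrow> ('a \<Rightarrow> real) \<Rightarrow> ennreal" where
  "energy N u = (\<integral>\<^sup>+(x, y). ennreal ((u x - u y)\<^sup>2) \<partial>N)"

lemma increment_square_measurable:
  fixes u :: "'a::euclidean_space \<Rightarrow> real"
  assumes N: "sets N = sets borel" and u: "u \<in> borel_measurable borel"
  shows "(\<lambda>(x, y). (u x - u y)\<^sup>2) \<in> borel_measurable N"
proof -
  have [measurable]: "u \<in> borel_measurable borel" by (rule u)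
  have "(\<lambda>(x, y). (u x - u y)\<^sup>2) \<in> borel_measurable (borel \<Otimes>\<^sub>M borel)" by measurable
  then show ?thesis by (simp add: borel_prod measurable_cong_sets[OF N refl])
qed

lemma energy_eq_jump_form:
  assumes N: "sets N = sets borel" and u: "u \<in> jump_form_dom N"
  shows "energy N u = ennreal (jump_form N u u)"
proof -
  have m: "(\<lambda>(x, y). (u x - u y)\<^sup>2) \<in> borel_measurable N"
    using u by (intro increment_square_measurable[OF N] L2_measurable) (simp add: jump_form_dom_def)
  have eq: "energy N u = (\<integral>\<^sup>+z. ennreal ((\<lambda>(x, y). (u x - u y)\<^sup>2) z) \<partial>N)"
    by (simp add: energy_def case_prod_unfold)
  have "energy N u < \<infinity>" using u by (simp add: jump_form_dom_def energy_def)
  then have "integrable N (\<lambda>(x, y). (u x - u y)\<^sup>2)"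
    unfolding eq by (intro integrableI_nonneg[OF m]) auto
  then have "energy N u = ennreal (LINT z|N. (\<lambda>(x, y). (u x - u y)\<^sup>2) z)"
    unfolding eq by (intro nn_integral_eq_integral) auto
  also have "(LINT z|N. (\<lambda>(x, y). (u x - u y)\<^sup>2) z) = jump_form N u u"
    by (simp add: jump_form_def power2_eq_square)
  finally show ?thesis .
qed

text \<open>
  Serves for sums as well as for differences of \<open>u\<close> and \<open>v\<close>.
\<close>

lemma energy_add_le:
  fixes u v w :: "'a::euclidean_space \<Rightarrow> real"
  assumes N: "sets N = sets borel" and uv: "u \<in> borel_measurable borel" "v \<in> borel_measurable borel"
    and le: "\<And>x y. \<bar>w x - w y\<bar> \<le> \<bar>u x - u y\<bar> + \<bar>v x - v y\<bar>"
  shows "energy N w \<le> 2 * energy N u + 2 * energy N v"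
proof -
  have m: "(\<lambda>z. ennreal ((\<lambda>(x, y). (f x - f y)\<^sup>2) z)) \<in> borel_measurable N"
    if "f \<in> borel_measurable borel" for f :: "'a \<Rightarrow> real"
    by (intro measurable_ennreal[THEN measurable_compose[rotated]] increment_square_measurable[OF N that])
  have "energy N w \<le> (\<integral>\<^sup>+z. 2 * ennreal ((\<lambda>(x, y). (u x - u y)\<^sup>2) z) + 2 * ennreal ((\<lambda>(x, y). (v x - v y)\<^sup>2) z) \<partial>N)"
    unfolding energy_def
  proof (rule nn_integral_mono)
    fix z :: "'a \<times> 'a"
    obtain x y where z: "z = (x, y)" by (cases z)
    have "(w x - w y)\<^sup>2 \<le> (\<bar>u x - u y\<bar> + \<bar>v x - v y\<bar>)\<^sup>2"
      using le[of x y] by (simp add: abs_le_square_iff[symmetric])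
    also have "\<dots> \<le> 2 * (u x - u y)\<^sup>2 + 2 * (v x - v y)\<^sup>2"
      using sum_squares_bound[of "\<bar>u x - u y\<bar>" "\<bar>v x - v y\<bar>"] by (simp add: power2_sum)
    finally have "ennreal ((w x - w y)\<^sup>2) \<le> ennreal (2 * (u x - u y)\<^sup>2 + 2 * (v x - v y)\<^sup>2)"
      by (rule ennreal_leI)
    then show "(case z of (x, y) \<Rightarrow> ennreal ((w x - w y)\<^sup>2))
        \<le> 2 * ennreal (case z of (x, y) \<Rightarrow> (u x - u y)\<^sup>2) + 2 * ennreal (case z of (x, y) \<Rightarrow> (v x - v y)\<^sup>2)"
      by (simp add: z ennreal_plus ennreal_mult')
  qed
  also have "\<dots> = 2 * energy N u + 2 * energy N v"
    unfolding energy_def using m[OF uv(1)] m[OF uv(2)]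
    by (simp add: nn_integral_add nn_integral_cmult case_prod_unfold)
  finally show ?thesis .
qed

text \<open>
  The weight is bounded, so passing from an approximating test function to \<open>u\<close> costs an arbitrarily small error both
  in the weighted square integral and in the energy; the factor 4 comes from using \<open>(a + b)\<^sup>2 \<le> 2 a\<^sup>2 + 2 b\<^sup>2\<close> twice.
\<close>

lemma Hardy_closure:
  fixes N :: "('a::euclidean_space \<times> 'a) measure"
  assumes N: "sets N = sets borel" and C: "0 < C"
    and w: "w \<in> borel_measurable borel" "\<And>x. 0 < w x" "\<And>x. w x \<le> 1"
    and Hardy: "\<And>f. f \<in> test_functions \<Longrightarrow> (\<integral>\<^sup>+x. ennreal ((f x)\<^sup>2 * w x) \<partial>lborel) \<le> ennreal C * energy N f"
    and u: "u \<in> form_closure N"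
  shows "(\<integral>\<^sup>+x. ennreal ((u x)\<^sup>2 * w x) \<partial>lborel) \<le> ennreal (4 * C * jump_form N u u)"
proof (rule ennreal_le_epsilon)
  fix e :: real assume e: "0 < e"
  have u_dom: "u \<in> jump_form_dom N" and u_L2: "u \<in> L2"
    using u by (auto simp: form_closure_def jump_form_dom_def)
  \<comment> \<open>The total error below is \<open>(4 C + 2) d\<^sup>2\<close>.\<close>
  define d where "d = sqrt (e / (4 * C + 2))"
  have d: "0 < d" "(4 * C + 2) * d\<^sup>2 = e" using e C by (simp_all add: d_def)
  obtain f where f: "f \<in> test_functions" "f \<in> jump_form_dom N" "form_norm N (\<lambda>x. u x - f x) < d"
    using u d(1) unfolding form_closure_def by blast
  have f_L2: "f \<in> L2" using f(2) by (simp add: jump_form_dom_def)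
  let ?r = "\<lambda>x. u x - f x"
  have r_L2: "?r \<in> L2" using u_L2 f_L2 by (rule L2_diff)
  have [measurable]: "u \<in> borel_measurable borel" "f \<in> borel_measurable borel" "w \<in> borel_measurable borel"
    using L2_measurable[OF u_L2] L2_measurable[OF f_L2] w by auto
  have r_dom: "?r \<in> jump_form_dom N"
  proof -
    have "energy N ?r \<le> 2 * energy N u + 2 * energy N f"
      by (rule energy_add_le[OF N]) auto
    also have "\<dots> < \<infinity>"
      by (simp add: energy_eq_jump_form[OF N u_dom] energy_eq_jump_form[OF N f(2)] ennreal_mult_less_top)
    finally show ?thesis using r_L2 by (simp add: jump_form_dom_def energy_def)
  qed
  have form_nonneg: "0 \<le> jump_form N v v" for v
    by (auto simp: jump_form_def intro!: integral_nonneg_AE)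
  have norm_r: "jump_form N ?r ?r + (L2_norm ?r)\<^sup>2 < d\<^sup>2"
  proof -
    have "jump_form N ?r ?r + (L2_norm ?r)\<^sup>2 = (form_norm N ?r)\<^sup>2"
      using form_nonneg[of ?r] by (simp add: form_norm_def)
    also have "\<dots> < d\<^sup>2"
      using f(3) form_nonneg[of ?r] by (intro power_strict_mono) (simp_all add: form_norm_def)
    finally show ?thesis .
  qed
  have energy_r: "energy N ?r \<le> ennreal (d\<^sup>2)"
    unfolding energy_eq_jump_form[OF N r_dom]
    using norm_r zero_le_power2[of "L2_norm ?r"] by (intro ennreal_leI) linarith
  have square_r: "(\<integral>\<^sup>+x. ennreal ((?r x)\<^sup>2) \<partial>lborel) \<le> ennreal (d\<^sup>2)"
    unfolding nn_integral_L2[OF r_L2]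
    using norm_r form_nonneg[of ?r] by (intro ennreal_leI) linarith
  have "(\<integral>\<^sup>+x. ennreal ((u x)\<^sup>2 * w x) \<partial>lborel)
      \<le> (\<integral>\<^sup>+x. 2 * ennreal ((f x)\<^sup>2 * w x) + 2 * ennreal ((?r x)\<^sup>2) \<partial>lborel)"
  proof (rule nn_integral_mono)
    fix x
    have "(u x)\<^sup>2 = (f x)\<^sup>2 + (?r x)\<^sup>2 + 2 * f x * ?r x"
      by (simp add: power2_eq_square algebra_simps)
    then have "(u x)\<^sup>2 \<le> 2 * (f x)\<^sup>2 + 2 * (?r x)\<^sup>2"
      using sum_squares_bound[of "f x" "?r x"] by linarith
    then have "(u x)\<^sup>2 * w x \<le> (2 * (f x)\<^sup>2 + 2 * (?r x)\<^sup>2) * w x"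
      using w(2)[of x] by (intro mult_right_mono) auto
    also have "\<dots> \<le> 2 * ((f x)\<^sup>2 * w x) + 2 * (?r x)\<^sup>2"
      using mult_left_le[OF w(3)[of x], of "(?r x)\<^sup>2"] by (simp add: distrib_right)
    finally have "ennreal ((u x)\<^sup>2 * w x) \<le> ennreal (2 * ((f x)\<^sup>2 * w x) + 2 * (?r x)\<^sup>2)"
      by (rule ennreal_leI)
    also have "\<dots> = 2 * ennreal ((f x)\<^sup>2 * w x) + 2 * ennreal ((?r x)\<^sup>2)"
      using w(2)[of x] by (simp add: ennreal_plus ennreal_mult')
    finally show "ennreal ((u x)\<^sup>2 * w x) \<le> 2 * ennreal ((f x)\<^sup>2 * w x) + 2 * ennreal ((?r x)\<^sup>2)" .
  qed
  also have "\<dots> = 2 * (\<integral>\<^sup>+x. ennreal ((f x)\<^sup>2 * w x) \<partial>lborel) + 2 * (\<integral>\<^sup>+x. ennreal ((?r x)\<^sup>2) \<partial>lborel)"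
    by (simp add: nn_integral_add nn_integral_cmult)
  also have "\<dots> \<le> 2 * (ennreal C * (2 * energy N u + 2 * energy N ?r)) + 2 * ennreal (d\<^sup>2)"
  proof (intro add_mono mult_left_mono square_r order_trans[OF Hardy[OF f(1)]])
    show "energy N f \<le> 2 * energy N u + 2 * energy N ?r"
      by (rule energy_add_le[OF N]) auto
  qed auto
  also have "\<dots> \<le> 2 * (ennreal C * (2 * ennreal (jump_form N u u) + 2 * ennreal (d\<^sup>2))) + 2 * ennreal (d\<^sup>2)"
    unfolding energy_eq_jump_form[OF N u_dom]
    by (intro add_mono mult_left_mono energy_r) auto
  also have "\<dots> = ennreal (2 * (C * (2 * jump_form N u u + 2 * d\<^sup>2)) + 2 * d\<^sup>2)"
    using C form_nonneg[of u] by (simp add: ennreal_plus ennreal_mult')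
  also have "2 * (C * (2 * jump_form N u u + 2 * d\<^sup>2)) + 2 * d\<^sup>2 = 4 * C * jump_form N u u + e"
    unfolding d(2)[symmetric] by (simp add: algebra_simps)
  also have "ennreal (4 * C * jump_form N u u + e) = ennreal (4 * C * jump_form N u u) + ennreal e"
    using e C form_nonneg[of u] by (intro ennreal_plus) auto
  finally show "(\<integral>\<^sup>+x. ennreal ((u x)\<^sup>2 * w x) \<partial>lborel) \<le> ennreal (4 * C * jump_form N u u) + ennreal e" .
qed

text \<open>
  Replaces \<open>1 + t\<close> by \<open>R + t\<close> at the price of a constant: \<open>1 + t \<le> R + t \<le> R (1 + t)\<close>.
\<close>

lemma powr_weight_compare:
  fixes c p p' R :: real and t :: real
  assumes R: "1 \<le> R" and p: "p' \<le> p" and c: "0 < c" and t: "0 \<le> t"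
  shows "c * R powr (- \<bar>p'\<bar>) * (R + t) powr p' \<le> c * (1 + t) powr p"
proof -
  have "(R + t) powr p' \<le> R powr \<bar>p'\<bar> * (1 + t) powr p'"
  proof (cases "0 \<le> p'")
    case True
    have "R + t \<le> R * (1 + t)" using mult_right_mono[OF R t] by (simp add: distrib_left)
    then have "(R + t) powr p' \<le> (R * (1 + t)) powr p'" using True R t by (intro powr_mono2) auto
    then show ?thesis using True by (simp add: powr_mult)
  next
    case False
    then have "(R + t) powr p' \<le> (1 + t) powr p'" using R t by (intro powr_mono2') auto
    also have "\<dots> \<le> R powr \<bar>p'\<bar> * (1 + t) powr p'"
      using R by (intro mult_right_le_one_le[THEN order_trans] mult_le_cancel_right1[THEN iffD2]) (auto intro: ge_one_powr_ge_zero)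
    finally show ?thesis .
  qed
  then have "R powr (- \<bar>p'\<bar>) * (R + t) powr p' \<le> R powr (- \<bar>p'\<bar>) * (R powr \<bar>p'\<bar> * (1 + t) powr p')"
    by (intro mult_left_mono) auto
  also have "\<dots> = (1 + t) powr p'" using R by (simp add: mult.assoc[symmetric] powr_add[symmetric])
  also have "\<dots> \<le> (1 + t) powr p" using t p by (intro powr_mono) auto
  finally show ?thesis using c by (simp add: mult.assoc)
qed

theorem theorem3p3:
  fixes \<nu> :: "'a::euclidean_space measure"
    and J0 :: "'a \<Rightarrow> 'a measure"
    and a1 a2 :: "'a \<Rightarrow> real"
    and c p :: real
  defines "J \<equiv> jump_kernel a1 a2 J0"
  defines "J1 \<equiv> small_jump_measure (kernel_measure J)"
  assumes nu_borel: "sets \<nu> = sets borel"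
    and nu_rot: "rotation_invariant \<nu>"
    and nu_levy: "(\<integral>\<^sup>+z\<in>UNIV - {0}. ennreal (min 1 ((norm z)\<^sup>2)) \<partial>\<nu>) < \<infinity>"
    and nu_pos: "0 < emeasure \<nu> {z. 0 < norm z \<and> norm z < 1}"
    and J0_kernel: "borel_kernel J0"
    and J0_sym: "symmetric_measure (kernel_measure J0)"
    and J0_nu: "\<And>x A. A \<in> sets borel \<Longrightarrow> emeasure \<nu> A \<le> emeasure (J0 x) ((\<lambda>z. x + z) ` A)"
    and a1_meas: "a1 \<in> borel_measurable borel" and a1_pos: "\<And>x. 0 < a1 x"
    and a2_meas: "a2 \<in> borel_measurable borel" and a2_pos: "\<And>x. 0 < a2 x"
    and J_sym: "symmetric_measure (kernel_measure J)"
    and J_loc: "locally_integrable (\<lambda>x. \<integral>\<^sup>+y. ennreal (min 1 ((norm (x - y))\<^sup>2)) \<partial>J x)"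
    and c_pos: "0 < c"
    and p_gt: "p > (2 - real DIM('a)) / 2"
    and growth: "\<And>x. a1 x \<ge> c * (1 + (norm x)\<^sup>2) powr p"
  shows "transient_form (jump_form J1) (form_closure J1)"
proof -
  have J1_sets: "sets J1 = sets borel" by (simp add: J1_def small_jump_measure_def)
  obtain A where A: "A \<in> sets borel" "A \<subseteq> {z. norm z < 1}" "radial_measure (density \<nu> (indicator A))"
      "0 < radial_measure.second_moment (density \<nu> (indicator A))"
    by (rule radial_annulus[OF nu_borel nu_rot nu_levy nu_pos])
  let ?M = "density \<nu> (indicator A)"
  \<comment> \<open>An exponent of at most 1 keeps the Hardy weight bounded by 1.\<close>
  define p' where "p' = min p 1"
  have p': "0 < 2 * p' + real DIM('a) - 2" "p' \<le> p" "p' \<le> 1"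
    using p_gt DIM_positive[where 'a = 'a] by (auto simp: p'_def min_def field_simps)
  obtain R \<kappa> where R: "1 \<le> R" and \<kappa>: "0 < \<kappa>"
    and Hardy: "\<And>u. u \<in> borel_measurable borel \<Longrightarrow>
      (\<integral>\<^sup>+x. ennreal ((u x)\<^sup>2 * (R + (norm x)\<^sup>2) powr p') \<partial>lborel) < \<infinity> \<Longrightarrow>
      (\<integral>\<^sup>+x. ennreal (\<kappa> * ((u x)\<^sup>2 * (R + (norm x)\<^sup>2) powr (p' - 1))) \<partial>lborel)
      \<le> (\<integral>\<^sup>+x. \<integral>\<^sup>+z. ennreal ((u x - u (x + z))\<^sup>2 *
            ((R + (norm x)\<^sup>2) powr p' + (R + (norm (x + z))\<^sup>2) powr p')) \<partial>?M \<partial>lborel)"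
    by (rule radial_measure.radial_Hardy[OF A(3) p'(1) A(4)]) blast
  let ?s = "\<lambda>x::'a. R + (norm x)\<^sup>2"
  have s: "1 \<le> ?s x" for x using R by (simp add: add_increasing2)
  define w where "w x = ?s x powr (p' - 1)" for x
  have w_meas [measurable]: "w \<in> borel_measurable borel" unfolding w_def[abs_def] by measurable
  have w_pos: "0 < w x" for x using s[of x] by (simp add: w_def)
  have w_le: "w x \<le> 1" for x
    using powr_mono[of "p' - 1" 0 "?s x"] s[of x] p'(3) by (simp add: w_def)
  define c' where "c' = c * R powr (- \<bar>p'\<bar>)"
  have c': "0 < c'" using c_pos R by (simp add: c'_def)
  have a1_ge: "c' * ?s x powr p' \<le> a1 x" for x
    using powr_weight_compare[OF R p'(2) c_pos, of "(norm x)\<^sup>2"] growth[of x] by (simp add: c'_def)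
  let ?C = "1 / (c' * \<kappa>)"
  have test: "(\<integral>\<^sup>+x. ennreal ((f x)\<^sup>2 * w x) \<partial>lborel) \<le> ennreal ?C * energy J1 f" if f: "f \<in> test_functions" for f
  proof -
    have [measurable]: "f \<in> borel_measurable borel" using f by (rule test_function_measurable)
    have ind: "(indicator A :: 'a \<Rightarrow> ennreal) \<in> borel_measurable \<nu>"
      using A(1) by (simp add: measurable_cong_sets[OF nu_borel refl])
    \<comment> \<open>Rescaling \<open>f\<close> absorbs the constant of the growth condition.\<close>
    let ?u = "\<lambda>x. sqrt c' * f x"
    have u_sq: "(?u x)\<^sup>2 = c' * (f x)\<^sup>2" "(?u x - ?u y)\<^sup>2 = c' * (f x - f y)\<^sup>2" for x y
      using c' by (simp_all add: power_mult_distrib right_diff_distrib[symmetric])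
    have "continuous_on UNIV (\<lambda>x::'a. c' * ?s x powr p')"
      by (intro continuous_intros ballI) (use s in \<open>metis not_one_le_zero\<close>)
    from test_function_weighted_integral[OF f this]
    have fin: "(\<integral>\<^sup>+x. ennreal ((?u x)\<^sup>2 * ?s x powr p') \<partial>lborel) < \<infinity>"
      unfolding u_sq by (simp add: mult.assoc mult.left_commute)
    have "ennreal (c' * \<kappa>) * (\<integral>\<^sup>+x. ennreal ((f x)\<^sup>2 * w x) \<partial>lborel)
        = (\<integral>\<^sup>+x. ennreal (\<kappa> * ((?u x)\<^sup>2 * w x)) \<partial>lborel)"
    proof -
      have "ennreal (c' * \<kappa>) * ennreal ((f x)\<^sup>2 * w x) = ennreal (\<kappa> * ((?u x)\<^sup>2 * w x))" for x
      proof -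
        have "\<kappa> * ((?u x)\<^sup>2 * w x) = (c' * \<kappa>) * ((f x)\<^sup>2 * w x)" by (simp add: u_sq)
        then show ?thesis using c' \<kappa> by (simp only: ennreal_mult'[symmetric] mult_nonneg_nonneg less_imp_le)
      qed
      then show ?thesis by (subst nn_integral_cmult[symmetric]) simp_all
    qed
    also have "\<dots> \<le> (\<integral>\<^sup>+x. \<integral>\<^sup>+z. ennreal ((?u x - ?u (x + z))\<^sup>2 * (?s x powr p' + ?s (x + z) powr p')) \<partial>?M \<partial>lborel)"
      unfolding w_def by (rule Hardy[OF _ fin]) measurable
    also have "\<dots> \<le> (\<integral>\<^sup>+x. \<integral>\<^sup>+z. ennreal ((f x - f (x + z))\<^sup>2 * (a1 x + a1 (x + z)))
        * indicator {z. norm z < 1} z \<partial>\<nu> \<partial>lborel)"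
    proof (rule nn_integral_mono)
      fix x :: 'a
      let ?H = "\<lambda>z. ennreal ((?u x - ?u (x + z))\<^sup>2 * (?s x powr p' + ?s (x + z) powr p'))"
      have "?H \<in> borel_measurable borel" by measurable
      then have H: "?H \<in> borel_measurable \<nu>" by (simp only: measurable_cong_sets[OF nu_borel refl])
      have "(\<integral>\<^sup>+z. ?H z \<partial>?M) = (\<integral>\<^sup>+z. indicator A z * ?H z \<partial>\<nu>)"
        by (rule nn_integral_density[OF ind H])
      also have "\<dots> \<le> (\<integral>\<^sup>+z. ennreal ((f x - f (x + z))\<^sup>2 * (a1 x + a1 (x + z))) * indicator {z. norm z < 1} z \<partial>\<nu>)"
      proof (rule nn_integral_mono)
        fix z :: 'a
        have "(?u x - ?u (x + z))\<^sup>2 * (?s x powr p' + ?s (x + z) powr p')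
            = (f x - f (x + z))\<^sup>2 * (c' * ?s x powr p' + c' * ?s (x + z) powr p')"
          unfolding u_sq by (simp add: distrib_left mult.left_commute mult.assoc)
        also have "\<dots> \<le> (f x - f (x + z))\<^sup>2 * (a1 x + a1 (x + z))"
          by (intro mult_left_mono add_mono a1_ge) simp
        finally show "indicator A z * ?H z
            \<le> ennreal ((f x - f (x + z))\<^sup>2 * (a1 x + a1 (x + z))) * indicator {z. norm z < 1} z"
          using A(2) by (auto simp: indicator_def ennreal_leI)
      qed
      finally show "(\<integral>\<^sup>+z. ?H z \<partial>?M)
        \<le> (\<integral>\<^sup>+z. ennreal ((f x - f (x + z))\<^sup>2 * (a1 x + a1 (x + z))) * indicator {z. norm z < 1} z \<partial>\<nu>)" .
    qed
    also have "\<dots> \<le> energy J1 f"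
      unfolding energy_def J1_def J_def
      by (rule small_jump_energy_ge[OF J0_kernel a1_meas a2_meas nu_borel J0_nu]) simp_all
    finally have le: "ennreal (c' * \<kappa>) * (\<integral>\<^sup>+x. ennreal ((f x)\<^sup>2 * w x) \<partial>lborel) \<le> energy J1 f" .
    have "(\<integral>\<^sup>+x. ennreal ((f x)\<^sup>2 * w x) \<partial>lborel)
        = ennreal ?C * (ennreal (c' * \<kappa>) * (\<integral>\<^sup>+x. ennreal ((f x)\<^sup>2 * w x) \<partial>lborel))"
      using c' \<kappa> by (simp add: mult.assoc[symmetric] ennreal_mult'[symmetric])
    also have "\<dots> \<le> ennreal ?C * energy J1 f" by (rule mult_left_mono[OF le]) simp
    finally show ?thesis .
  qed
  show ?thesis
    unfolding transient_form_def
  proof (intro allI impI ballI)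
    fix T :: "real \<Rightarrow> ('a \<Rightarrow> real) \<Rightarrow> 'a \<Rightarrow> real" and f :: "'a \<Rightarrow> real"
    assume T: "associated_semigroup (jump_form J1) (form_closure J1) T"
      and f: "f \<in> L1" "AE x in lborel. 0 \<le> f x"
    have "L2_semigroup T" using T by (simp add: L2_semigroup_def associated_semigroup_def)
    then show "AE x in lborel. potential T f x < \<infinity>"
    proof (rule L2_semigroup.transient_of_Hardy[OF _ T w_meas w_pos w_le _ _ f])
      show "0 < 4 * ?C" using c' \<kappa> by simp
      show "(\<integral>\<^sup>+x. ennreal ((u x)\<^sup>2 * w x) \<partial>lborel) \<le> ennreal (4 * ?C * jump_form J1 u u)"
        if "u \<in> form_closure J1" for u
        using c' \<kappa> by (intro Hardy_closure[OF J1_sets _ w_meas w_pos w_le test that]) auto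
    qed
  qed
qed

end
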